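(* Let $\alpha=(\alpha_1,\alpha_2)\in\mathbb{T}^2$ be rationally independent, $\omega\in\mathbb{T}$, $\lambda\in\mathbb{C}$ and $g>0$. Consider the operator on $\ell^2(\mathbb{Z}^2)$ $$(H_\alpha(\lambda,\omega)u)(m,n)=(H_0u)(m,n)+\lambda e^{2\pi i(\omega+m\alpha_1+n\alpha_2)}u(m,n),\quad (m,n)\in\mathbb{Z}^2.$$ Then, for all $\omega\in\mathbb{T}$, $$\sigma(H_\alpha(\lambda,\omega))=\begin{cases}E,&|\lambda|<e^{g},\\ \mathrm{Conv}(E),&|\lambda|=e^{g},\end{cases}$$ where $\mathrm{Conv}$ denotes the closed convex hull. Moreover, if $$|\lambda|>e^{\max_{|z|\le2(e^g+e^{-g}+2)}G_2(z)},$$ then $\sigma(H_\alpha(\lambda,\omega))$ is a real analytic curve.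
   Context: $\mathbb{T}=\mathbb{R}/\mathbb{Z}$; $\alpha$ rationally independent means $(1,\alpha_1,\alpha_2)$ is linearly independent over $\mathbb{Q}$. The operator $H_0$ on $\ell^2(\mathbb{Z}^2)$ is $$(H_0u)(m,n)=e^{-g}u(m-1,n)+e^{g}u(m+1,n)+u(m,n-1)+u(m,n+1),$$ and $$E=\{t+e^{-g}e^{2\pi i\theta}+e^{g}e^{-2\pi i\theta}\ :\ t\in[-2,2],\ \theta\in[0,1]\}\subset\mathbb{C}.$$ $G_2(z)=\int_{\mathbb{T}^2}\log|z-V(\theta)|\,d\theta$ with $V(\theta_1,\theta_2)=2\cos2\pi\theta_1+e^{-g}e^{2\pi i\theta_2}+e^{g}e^{-2\pi i\theta_2}$. A real analytic curve is a one-dimensional real analytic submanifold of $\mathbb{R}^2\cong\mathbb{C}$. *)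

theory Defs
  imports "HOL-Analysis.Analysis"
begin

definition ell2 :: "('a \<Rightarrow> complex) set" where
  "ell2 = {u. (\<lambda>x. (cmod (u x))\<^sup>2) summable_on UNIV}"

definition ell2_norm :: "('a \<Rightarrow> complex) \<Rightarrow> real" where
  "ell2_norm u = sqrt (\<Sum>\<^sub>\<infinity>x. (cmod (u x))\<^sup>2)"

definition ell2_bounded_operator :: "(('a \<Rightarrow> complex) \<Rightarrow> ('a \<Rightarrow> complex)) \<Rightarrow> bool" where
  "ell2_bounded_operator T \<longleftrightarrow>
     (\<forall>u\<in>ell2. T u \<in> ell2) \<and>
     (\<forall>u\<in>ell2. \<forall>v\<in>ell2. T (\<lambda>x. u x + v x) = (\<lambda>x. T u x + T v x)) \<and>
     (\<forall>c. \<forall>u\<in>ell2. T (\<lambda>x. c * u x) = (\<lambda>x. c * T u x)) \<and>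
     (\<exists>C. \<forall>u\<in>ell2. ell2_norm (T u) \<le> C * ell2_norm u)"

text \<open>Operators act on all functions, but only their restriction to \<open>ell2\<close> matters here:
  \<open>z\<close> belongs to the resolvent set iff \<open>T - z\<close> has a bounded two-sided inverse \<open>R\<close> on \<open>ell2\<close>.\<close>

definition ell2_spectrum :: "(('a \<Rightarrow> complex) \<Rightarrow> ('a \<Rightarrow> complex)) \<Rightarrow> complex set" where
  "ell2_spectrum T =
     {z. \<not> (\<exists>R. ell2_bounded_operator R \<and>
              (\<forall>u\<in>ell2. R (\<lambda>x. T u x - z * u x) = u) \<and>
              (\<forall>u\<in>ell2. (\<lambda>x. T (R u) x - z * R u x) = u))}"

text \<open>Points of the torus \<open>\<real>/\<int>\<close> are represented by arbitrary real representatives; everything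
  below is unchanged when a representative is shifted by an integer.\<close>

definition rationally_independent :: "real \<Rightarrow> real \<Rightarrow> bool" where
  "rationally_independent \<alpha>\<^sub>1 \<alpha>\<^sub>2 \<longleftrightarrow>
     (\<forall>p q r :: rat. of_rat p * 1 + of_rat q * \<alpha>\<^sub>1 + of_rat r * \<alpha>\<^sub>2 = 0
        \<longrightarrow> p = 0 \<and> q = 0 \<and> r = 0)"

definition H0 :: "real \<Rightarrow> (int \<times> int \<Rightarrow> complex) \<Rightarrow> (int \<times> int \<Rightarrow> complex)" where
  "H0 g u = (\<lambda>(m, n). of_real (exp (- g)) * u (m - 1, n) + of_real (exp g) * u (m + 1, n)
                       + u (m, n - 1) + u (m, n + 1))"

definition H_op :: "real \<Rightarrow> real \<Rightarrow> real \<Rightarrow> complex \<Rightarrow> real \<Rightarrow>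
    (int \<times> int \<Rightarrow> complex) \<Rightarrow> (int \<times> int \<Rightarrow> complex)" where
  "H_op g \<alpha>\<^sub>1 \<alpha>\<^sub>2 lam \<omega> u =
     (\<lambda>(m, n). H0 g u (m, n)
        + lam * cis (2 * pi * (\<omega> + of_int m * \<alpha>\<^sub>1 + of_int n * \<alpha>\<^sub>2)) * u (m, n))"

definition E_set :: "real \<Rightarrow> complex set" where
  "E_set g = {of_real t + of_real (exp (- g)) * cis (2 * pi * \<theta>)
                + of_real (exp g) * cis (- 2 * pi * \<theta>)
              | t \<theta>. t \<in> {-2..2} \<and> \<theta> \<in> {0..1}}"

definition V :: "real \<Rightarrow> real \<Rightarrow> real \<Rightarrow> complex" where
  "V g \<theta>\<^sub>1 \<theta>\<^sub>2 = of_real (2 * cos (2 * pi * \<theta>\<^sub>1)) + of_real (exp (- g)) * cis (2 * pi * \<theta>\<^sub>2)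
                  + of_real (exp g) * cis (- 2 * pi * \<theta>\<^sub>2)"

text \<open>The torus is parametrised by the unit square. The convention \<open>ln 0 = 0\<close> is harmless,
  as \<open>V g \<theta>\<^sub>1 \<theta>\<^sub>2 = z\<close> only on a null set.\<close>

definition G2 :: "real \<Rightarrow> complex \<Rightarrow> real" where
  "G2 g z = (LINT \<theta>:{0..1} \<times> {0..1}|(lborel :: (real \<times> real) measure).
               ln (cmod (z - V g (fst \<theta>) (snd \<theta>))))"

text \<open>Real analyticity of a map between open subsets of \<open>\<real>\<^sup>2\<close>, identified with the complex plane:
  local expansion in the two real coordinates. Both components are expanded at
  once, so the coefficients are complex. This is weaker than holomorphy.\<close>

definition real_analytic_on :: "(complex \<Rightarrow> complex) \<Rightarrow> complex set \<Rightarrow> bool" where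
  "real_analytic_on f U \<longleftrightarrow>
     (\<forall>p\<in>U. \<exists>a :: nat \<Rightarrow> nat \<Rightarrow> complex. \<exists>r>0. \<forall>x y :: real. \<bar>x\<bar> < r \<longrightarrow> \<bar>y\<bar> < r \<longrightarrow>
        ((\<lambda>(j, k). a j k * of_real x ^ j * of_real y ^ k) has_sum f (p + Complex x y)) UNIV)"

text \<open>A (nonempty) one-dimensional real analytic embedded submanifold of the plane: near each of its
  points, a real analytic diffeomorphism \<open>\<phi>\<close> with inverse \<open>\<psi>\<close> straightens \<open>S\<close> to the real axis.\<close>

definition real_analytic_curve :: "complex set \<Rightarrow> bool" where
  "real_analytic_curve S \<longleftrightarrow> S \<noteq> {} \<and>
     (\<forall>p\<in>S. \<exists>U W \<phi> \<psi>. open U \<and> p \<in> U \<and> open W \<and>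
        real_analytic_on \<phi> U \<and> real_analytic_on \<psi> W \<and>
        \<phi> ` U = W \<and> (\<forall>z\<in>U. \<psi> (\<phi> z) = z) \<and>
        \<phi> ` (S \<inter> U) = {w \<in> W. Im w = 0})"

end

theory Submission
  imports Defs "HOL-Complex_Analysis.Complex_Analysis"
begin

text \<open>Write \<open>e(\<theta>)\<close> for the plane wave of frequency \<open>\<theta>\<close> on the lattice and put \<open>\<eta> = (\<alpha>\<^sub>2, - \<alpha>\<^sub>1)\<close>. The operator maps
  \<open>e(\<theta>)\<close> to \<open>V(\<theta>) e(\<theta>) + \<mu> e(\<theta> + \<eta>)\<close> with \<open>\<bar>\<mu>\<bar> = \<bar>\<lambda>\<bar>\<close>. Hence the operator minus \<open>z\<close> acts on the waves along one orbit of the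
  irrational rotation by \<open>\<eta>\<close> as a bidiagonal matrix with entries \<open>f = V - z\<close> on the diagonal and \<open>\<mu>\<close> next
  to it, and its invertibility is decided by comparing the products of \<open>\<bar>f\<bar>\<close> over \<open>N\<close> consecutive points of an orbit
  with \<open>\<bar>\<lambda>\<bar> ^ N\<close>.

  If for some \<open>N\<close> all these products are below \<open>\<bar>\<lambda>\<bar> ^ N\<close> with a gap, or all are above it, the
  operator and its adjoint are bounded below, and a Neumann series provides the inverse (\<open>cocycle_gap_resolvent\<close>).
  Conversely, a bounded inverse bounds all the orbit matrices from below (\<open>resolvent_wave_packet_bound\<close>),
  as one sees by testing with combinations of waves cut off to large boxes. If \<open>f\<close> has a zero, this
  forces the products along the orbit of the zero, and by density all products, to be exponentially
  smaller than \<open>\<bar>\<lambda>\<bar> ^ N\<close> (\<open>resolvent_orbit_of_zero_decay\<close>); if \<open>f\<close> has no zero, it rules out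
  that the products grow exactly at the rate \<open>\<bar>\<lambda>\<bar>\<close> (\<open>neutral_cocycle_in_spectrum\<close>).

  For \<open>z\<close> outside \<open>E\<close>, the range of \<open>V\<close>, uniform equidistribution shows that the products grow at
  the rate \<open>exp (G\<^sub>2(z))\<close>. In the variable \<open>x = exp (2 \<pi> \<i> \<theta>\<^sub>2)\<close> a product is up to a unimodular factor a polynomial with value
  \<open>exp (N g)\<close> in modulus at \<open>x = 0\<close>. The maximum principle therefore finds for each \<open>N\<close> a product of size at least
  \<open>exp (N g)\<close>. This puts \<open>E\<close> into the spectrum when \<open>\<bar>\<lambda>\<bar> \<le> exp g\<close>, and shows \<open>G\<^sub>2 \<ge> g\<close> outside \<open>E\<close>. A closer look at the
  zeros of the polynomial, which depend on the position of \<open>z\<close> relative to translates of an ellipse, gives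
  \<open>G\<^sub>2 = g\<close> in the part of the convex hull outside \<open>E\<close> and \<open>G\<^sub>2 > g\<close> outside the hull. This settles weak and critical
  coupling.

  Truncating the logarithm shows that \<open>\<bar>\<lambda>\<bar> > exp (G\<^sub>2(z))\<close> excludes \<open>z\<close> from the spectrum even
  when \<open>z\<close> is in \<open>E\<close>. Under the hypothesis of the third part the spectrum is thus the level set \<open>G\<^sub>2 = ln \<bar>\<lambda>\<bar>\<close> in the
  region \<open>\<bar>z\<bar> > R\<close>, where \<open>R\<close> is twice the maximum of \<open>\<bar>V\<bar>\<close>. There \<open>G\<^sub>2\<close> is locally the real part of a
  holomorphic function whose derivative does not vanish, and this function straightens the level set.\<close>

section \<open>Square summable functions\<close>

lemma L2_set_cmod_le_ell2_norm:
  assumes "u \<in> ell2" "finite F"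
  shows "L2_set (\<lambda>x. cmod (u x)) F \<le> ell2_norm u"
proof -
  have "(\<Sum>x\<in>F. (cmod (u x))\<^sup>2) \<le> (\<Sum>\<^sub>\<infinity>x. (cmod (u x))\<^sup>2)"
    using assms by (intro finite_sum_le_infsum) (auto simp: ell2_def)
  then show ?thesis by (simp add: L2_set_def ell2_norm_def)
qed

text \<open>Norm bounds are proved throughout on finite sets of sites, where the triangle inequality of
  \<open>L2_set\<close> applies; this lemma passes to the whole index set.\<close>

lemma ell2I:
  assumes "\<And>F. finite F \<Longrightarrow> L2_set (\<lambda>x. cmod (u x)) F \<le> C"
  shows "u \<in> ell2" and "ell2_norm u \<le> C"
proof -
  have C: "0 \<le> C" using assms[of "{}"] by simp
  have *: "(\<Sum>x\<in>F. (cmod (u x))\<^sup>2) \<le> C\<^sup>2" if "finite F" for F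
    using assms[OF that] unfolding L2_set_def by (rule sqrt_le_D)
  have s: "(\<lambda>x. (cmod (u x))\<^sup>2) summable_on UNIV"
    by (rule nonneg_bounded_partial_sums_imp_summable_on[where C="C\<^sup>2"])
       (auto simp: * eventually_finite_subsets_at_top intro!: exI[of _ "{}"])
  then show "u \<in> ell2" by (simp add: ell2_def)
  have "(\<Sum>\<^sub>\<infinity>x. (cmod (u x))\<^sup>2) \<le> C\<^sup>2"
    using s * by (intro infsum_le_finite_sums) auto
  then show "ell2_norm u \<le> C"
    unfolding ell2_norm_def using C by (simp add: real_le_lsqrt)
qed

lemma ell2_norm_nonneg: "0 \<le> ell2_norm u"
  by (simp add: ell2_norm_def infsum_nonneg)

lemma ell2_norm_power2: "(ell2_norm u)\<^sup>2 = (\<Sum>\<^sub>\<infinity>x. (cmod (u x))\<^sup>2)"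
  by (simp add: ell2_norm_def infsum_nonneg)

lemma cmod_le_ell2_norm: "u \<in> ell2 \<Longrightarrow> cmod (u x) \<le> ell2_norm u"
  using L2_set_cmod_le_ell2_norm[of u "{x}"] by (simp add: L2_set_def)

lemma ell2_zero: "(\<lambda>x. 0) \<in> ell2" "ell2_norm (\<lambda>x. 0) = 0"
  by (auto simp: ell2_def ell2_norm_def)

lemma ell2_add:
  assumes "u \<in> ell2" "v \<in> ell2"
  shows "(\<lambda>x. u x + v x) \<in> ell2" and "ell2_norm (\<lambda>x. u x + v x) \<le> ell2_norm u + ell2_norm v"
proof -
  have *: "L2_set (\<lambda>x. cmod (u x + v x)) F \<le> ell2_norm u + ell2_norm v" if "finite F" for F
  proof -
    have "L2_set (\<lambda>x. cmod (u x + v x)) F \<le> L2_set (\<lambda>x. cmod (u x) + cmod (v x)) F"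
      by (intro L2_set_mono) (auto intro: norm_triangle_ineq)
    also have "\<dots> \<le> L2_set (\<lambda>x. cmod (u x)) F + L2_set (\<lambda>x. cmod (v x)) F"
      by (rule L2_set_triangle_ineq)
    finally show ?thesis
      using L2_set_cmod_le_ell2_norm[OF assms(1) that] L2_set_cmod_le_ell2_norm[OF assms(2) that]
      by linarith
  qed
  from ell2I[OF *] show "(\<lambda>x. u x + v x) \<in> ell2"
    and "ell2_norm (\<lambda>x. u x + v x) \<le> ell2_norm u + ell2_norm v" by auto
qed

lemma ell2_mult:
  assumes "u \<in> ell2" "\<And>x. cmod (k x) \<le> B"
  shows "(\<lambda>x. k x * u x) \<in> ell2" and "ell2_norm (\<lambda>x. k x * u x) \<le> B * ell2_norm u"
proof -
  have B: "0 \<le> B" using assms(2)[of undefined] norm_ge_zero order_trans by blast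
  have *: "L2_set (\<lambda>x. cmod (k x * u x)) F \<le> B * ell2_norm u" if "finite F" for F
  proof -
    have "L2_set (\<lambda>x. cmod (k x * u x)) F \<le> L2_set (\<lambda>x. B * cmod (u x)) F"
      by (intro L2_set_mono) (auto simp: norm_mult intro: mult_right_mono assms)
    also have "\<dots> = B * L2_set (\<lambda>x. cmod (u x)) F"
      by (rule L2_set_right_distrib[OF B, symmetric])
    also have "\<dots> \<le> B * ell2_norm u"
      by (intro mult_left_mono L2_set_cmod_le_ell2_norm assms that B)
    finally show ?thesis .
  qed
  from ell2I[OF *] show "(\<lambda>x. k x * u x) \<in> ell2"
    and "ell2_norm (\<lambda>x. k x * u x) \<le> B * ell2_norm u" by auto
qed

lemma ell2_shift:
  fixes u :: "'a::ab_group_add \<Rightarrow> complex"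
  assumes "u \<in> ell2"
  shows "(\<lambda>x. u (x + y)) \<in> ell2" and "ell2_norm (\<lambda>x. u (x + y)) \<le> ell2_norm u"
proof -
  have *: "L2_set (\<lambda>x. cmod (u (x + y))) F \<le> ell2_norm u" if "finite F" for F
  proof -
    have "L2_set (\<lambda>x. cmod (u (x + y))) F = L2_set (\<lambda>x. cmod (u x)) ((\<lambda>x. x + y) ` F)"
      unfolding L2_set_def by (subst sum.reindex) (auto simp: inj_on_def)
    then show ?thesis using L2_set_cmod_le_ell2_norm[OF assms] that by auto
  qed
  from ell2I[OF *] show "(\<lambda>x. u (x + y)) \<in> ell2" and "ell2_norm (\<lambda>x. u (x + y)) \<le> ell2_norm u"
    by auto
qed

lemma ell2_cmult:
  assumes "u \<in> ell2"
  shows "(\<lambda>x. c * u x) \<in> ell2" and "ell2_norm (\<lambda>x. c * u x) \<le> cmod c * ell2_norm u"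
  using ell2_mult[OF assms, of "\<lambda>_. c"] by auto

lemma ell2_diff:
  assumes "u \<in> ell2" "v \<in> ell2"
  shows "(\<lambda>x. u x - v x) \<in> ell2" and "ell2_norm (\<lambda>x. u x - v x) \<le> ell2_norm u + ell2_norm v"
  using ell2_add[OF assms(1) ell2_cmult(1)[OF assms(2), of "-1"]] ell2_cmult(2)[OF assms(2), of "-1"]
  by auto

lemma ell2_sum:
  assumes "finite S" "\<And>y. y \<in> S \<Longrightarrow> g y \<in> ell2"
  shows "(\<lambda>x. \<Sum>y\<in>S. g y x) \<in> ell2 \<and> ell2_norm (\<lambda>x. \<Sum>y\<in>S. g y x) \<le> (\<Sum>y\<in>S. ell2_norm (g y))"
  using assms
proof (induction S)
  case empty
  then show ?case by (simp add: ell2_zero)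
next
  case (insert y S)
  then show ?case
    using ell2_add[of "g y" "\<lambda>x. \<Sum>y\<in>S. g y x"] by (auto intro: order_trans)
qed

lemma ell2_eq_zero:
  assumes "u \<in> ell2" "ell2_norm u \<le> 0"
  shows "u = (\<lambda>x. 0)"
proof
  show "u x = 0" for x
    using order_trans[OF cmod_le_ell2_norm[OF assms(1), of x] assms(2)] by simp
qed

lemma ell2_finite_support:
  assumes "finite X" "\<And>x. x \<notin> X \<Longrightarrow> u x = 0"
  shows "u \<in> ell2"
proof -
  have "(\<lambda>x. (cmod (u x))\<^sup>2) summable_on UNIV \<longleftrightarrow> (\<lambda>x. (cmod (u x))\<^sup>2) summable_on X"
    by (rule summable_on_cong_neutral) (use assms in auto)
  then show ?thesis using assms by (simp add: ell2_def)
qed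

lemma ell2_norm_finite_support:
  assumes X: "finite X" "\<And>x. x \<notin> X \<Longrightarrow> u x = 0"
  shows "(ell2_norm u)\<^sup>2 = (\<Sum>x\<in>X. (cmod (u x))\<^sup>2)"
proof -
  have "(\<Sum>\<^sub>\<infinity>x. (cmod (u x))\<^sup>2) = (\<Sum>\<^sub>\<infinity>x\<in>X. (cmod (u x))\<^sup>2)"
    by (rule infsum_cong_neutral) (use X in auto)
  then show ?thesis using X by (simp add: ell2_norm_power2)
qed

lemma ell2_truncation:
  assumes "u \<in> ell2" "e > 0"
  obtains X where "finite X" "ell2_norm (\<lambda>x. u x - (if x \<in> X then u x else 0)) < e"
proof -
  have s: "(\<lambda>x. (cmod (u x))\<^sup>2) summable_on UNIV" using assms by (simp add: ell2_def)
  then have hs: "((\<lambda>x. (cmod (u x))\<^sup>2) has_sum (ell2_norm u)\<^sup>2) UNIV"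
    by (simp add: ell2_norm_power2)
  have e2: "e\<^sup>2 / 2 > 0" using assms(2) by simp
  obtain X where X: "finite X" "dist (\<Sum>x\<in>X. (cmod (u x))\<^sup>2) ((ell2_norm u)\<^sup>2) \<le> e\<^sup>2 / 2"
    using has_sum_finite_approximation[OF hs e2] by blast
  have "(\<Sum>\<^sub>\<infinity>x. (cmod (u x - (if x \<in> X then u x else 0)))\<^sup>2) = (\<Sum>\<^sub>\<infinity>x\<in>UNIV - X. (cmod (u x))\<^sup>2)"
    by (rule infsum_cong_neutral) auto
  also have "\<dots> = (\<Sum>\<^sub>\<infinity>x. (cmod (u x))\<^sup>2) - (\<Sum>\<^sub>\<infinity>x\<in>X. (cmod (u x))\<^sup>2)"
    by (rule infsum_Diff) (use s X in auto)
  also have "\<dots> \<le> e\<^sup>2 / 2"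
    using X(2) abs_ge_minus_self[of "(\<Sum>x\<in>X. (cmod (u x))\<^sup>2) - (ell2_norm u)\<^sup>2"] X(1)
    unfolding dist_real_def ell2_norm_power2 infsum_finite[OF X(1)] by linarith
  also have "\<dots> < e\<^sup>2" using e2 by simp
  finally have "(ell2_norm (\<lambda>x. u x - (if x \<in> X then u x else 0)))\<^sup>2 < e\<^sup>2"
    by (simp add: ell2_norm_power2)
  then show ?thesis
    using that[OF X(1)] assms(2) power2_less_imp_less[of _ e] by simp
qed

section \<open>Banded operators and their inverses\<close>

text \<open>The adjoint of an operator of this form has the same form, and such an operator commutes with
  pointwise convergent series, as each value of the image involves finitely many values of the argument.\<close>

definition band :: "'a set \<Rightarrow> ('a \<Rightarrow> 'a \<Rightarrow> complex) \<Rightarrow> ('a::ab_group_add \<Rightarrow> complex) \<Rightarrow> 'a \<Rightarrow> complex" where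
  "band S k u x = (\<Sum>y\<in>S. k x y * u (x + y))"

text \<open>The entry of the adjoint from \<open>x\<close> to \<open>x + y\<close> is the conjugate of the entry of the operator
  from \<open>x + y\<close> back to \<open>x\<close>.\<close>

definition band_adj :: "'a set \<Rightarrow> ('a \<Rightarrow> 'a \<Rightarrow> complex) \<Rightarrow> ('a::ab_group_add \<Rightarrow> complex) \<Rightarrow> 'a \<Rightarrow> complex" where
  "band_adj S k = band (uminus ` S) (\<lambda>x y. cnj (k (x + y) (- y)))"

lemma band_adj_apply: "band_adj S k v x = (\<Sum>y\<in>S. cnj (k (x - y) y) * v (x - y))"
  unfolding band_adj_def band_def by (subst sum.reindex) (auto simp: inj_on_def)

lemma band_ell2:
  assumes "finite S" "\<And>x y. cmod (k x y) \<le> B" "u \<in> ell2"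
  shows "band S k u \<in> ell2" and "ell2_norm (band S k u) \<le> real (card S) * B * ell2_norm u"
proof -
  have B: "0 \<le> B" using assms(2)[of undefined undefined] norm_ge_zero order_trans by blast
  have 1: "(\<lambda>x. k x y * u (x + y)) \<in> ell2" "ell2_norm (\<lambda>x. k x y * u (x + y)) \<le> B * ell2_norm u" for y
    using ell2_mult[OF ell2_shift(1)[OF assms(3), of y], of "\<lambda>x. k x y" B] assms(2)
      mult_left_mono[OF ell2_shift(2)[OF assms(3), of y] B] by auto
  have eq: "band S k u = (\<lambda>x. \<Sum>y\<in>S. k x y * u (x + y))"
    by (auto simp: band_def)
  have 2: "band S k u \<in> ell2 \<and> ell2_norm (band S k u) \<le> (\<Sum>y\<in>S. ell2_norm (\<lambda>x. k x y * u (x + y)))"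
    unfolding eq by (rule ell2_sum[OF assms(1) 1(1)])
  have "(\<Sum>y\<in>S. ell2_norm (\<lambda>x. k x y * u (x + y))) \<le> (\<Sum>y\<in>S. B * ell2_norm u)"
    by (intro sum_mono 1)
  with 2 show "band S k u \<in> ell2" "ell2_norm (band S k u) \<le> real (card S) * B * ell2_norm u" by auto
qed

lemma band_add: "band S k (\<lambda>x. u x + v x) = (\<lambda>x. band S k u x + band S k v x)"
  by (auto simp: band_def algebra_simps sum.distrib)

lemma band_cmult: "band S k (\<lambda>x. c * u x) = (\<lambda>x. c * band S k u x)"
  by (auto simp: band_def algebra_simps sum_distrib_left)

lemma band_diff: "band S k (\<lambda>x. u x - v x) = (\<lambda>x. band S k u x - band S k v x)"
  by (auto simp: band_def algebra_simps sum_subtractf)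

lemma has_sum_finite_sum:
  fixes f :: "'b \<Rightarrow> 'a \<Rightarrow> complex"
  shows "(\<And>y. y \<in> S \<Longrightarrow> (f y has_sum F y) A) \<Longrightarrow> ((\<lambda>x. \<Sum>y\<in>S. f y x) has_sum (\<Sum>y\<in>S. F y)) A"
  by (induction S rule: infinite_finite_induct) (auto intro: has_sum_add)

definition ell2_inner :: "('a \<Rightarrow> complex) \<Rightarrow> ('a \<Rightarrow> complex) \<Rightarrow> complex" where
  "ell2_inner u v = (\<Sum>\<^sub>\<infinity>x. cnj (u x) * v x)"

lemma ell2_inner_summable:
  assumes "u \<in> ell2" "v \<in> ell2"
  shows "(\<lambda>x. cnj (u x) * v x) summable_on UNIV"
proof -
  have "(\<lambda>x. (cmod (u x))\<^sup>2 + (cmod (v x))\<^sup>2) summable_on UNIV"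
    using assms by (intro summable_on_add) (auto simp: ell2_def)
  moreover have "norm (cnj (u x) * v x) \<le> (cmod (u x))\<^sup>2 + (cmod (v x))\<^sup>2" for x
  proof -
    have "2 * cmod (u x) * cmod (v x) \<le> (cmod (u x))\<^sup>2 + (cmod (v x))\<^sup>2"
      using zero_le_power2[of "cmod (u x) - cmod (v x)"] by (simp add: power2_diff)
    moreover have "0 \<le> cmod (u x) * cmod (v x)" by simp
    ultimately have "cmod (u x) * cmod (v x) \<le> (cmod (u x))\<^sup>2 + (cmod (v x))\<^sup>2" by linarith
    then show ?thesis by (simp add: norm_mult)
  qed
  ultimately have "(\<lambda>x. norm (cnj (u x) * v x)) summable_on UNIV"
    by (rule summable_on_comparison_test) auto
  then show ?thesis by (rule abs_summable_summable)
qed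

lemma ell2_inner_self: "u \<in> ell2 \<Longrightarrow> ell2_inner u u = of_real ((ell2_norm u)\<^sup>2)"
proof -
  assume "u \<in> ell2"
  then have "((\<lambda>x. (cmod (u x))\<^sup>2) has_sum (ell2_norm u)\<^sup>2) UNIV"
    by (auto simp: ell2_norm_power2 ell2_def)
  then have "((\<lambda>x. complex_of_real ((cmod (u x))\<^sup>2)) has_sum of_real ((ell2_norm u)\<^sup>2)) UNIV"
    by (simp only: has_sum_of_real_iff)
  moreover have "complex_of_real ((cmod (u x))\<^sup>2) = cnj (u x) * u x" for x
    by (simp only: complex_norm_square mult.commute)
  ultimately show ?thesis
    unfolding ell2_inner_def by (intro infsumI) simp
qed

lemma band_adjoint:
  assumes S: "finite S" and B: "\<And>x y. cmod (k x y) \<le> B" and u: "u \<in> ell2" and v: "v \<in> ell2"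
  shows "ell2_inner v (band S k u) = ell2_inner (band_adj S k v) u"
proof -
  have 1: "(\<lambda>x. k x y * u (x + y)) \<in> ell2" for y
    using ell2_mult[OF ell2_shift(1)[OF u, of y], of "\<lambda>x. k x y" B] B by auto
  have s: "(\<lambda>x. cnj (v x) * (k x y * u (x + y))) summable_on UNIV" for y
    by (rule ell2_inner_summable[OF v 1])
  have bij: "bij_betw (\<lambda>x. x - y) UNIV (UNIV::'a set)" for y :: 'a
    by (rule bij_betwI[of _ _ _ "\<lambda>x. x + y"]) auto
  have s': "(\<lambda>x. cnj (v (x - y)) * (k (x - y) y * u x)) summable_on UNIV" for y
    using s[of y] summable_on_reindex_bij_betw[OF bij[of y], of "\<lambda>x. cnj (v x) * (k x y * u (x + y))"]
    by simp
  have "ell2_inner v (band S k u) = (\<Sum>\<^sub>\<infinity>x. \<Sum>y\<in>S. cnj (v x) * (k x y * u (x + y)))"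
    by (simp add: ell2_inner_def band_def sum_distrib_left)
  also have "\<dots> = (\<Sum>y\<in>S. \<Sum>\<^sub>\<infinity>x. cnj (v x) * (k x y * u (x + y)))"
    using s by (intro infsumI has_sum_finite_sum has_sum_infsum)
  also have "\<dots> = (\<Sum>y\<in>S. \<Sum>\<^sub>\<infinity>x. cnj (v (x - y)) * (k (x - y) y * u x))"
    using infsum_reindex_bij_betw[OF bij, of "\<lambda>x. cnj (v x) * (k x y * u (x + y))" y for y]
    by (intro sum.cong) auto
  also have "\<dots> = (\<Sum>\<^sub>\<infinity>x. \<Sum>y\<in>S. cnj (v (x - y)) * (k (x - y) y * u x))"
    using s' by (intro infsumI[symmetric] has_sum_finite_sum has_sum_infsum)
  also have "\<dots> = ell2_inner (band_adj S k v) u"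
    by (simp add: ell2_inner_def band_adj_apply sum_distrib_right sum_distrib_left mult_ac)
  finally show ?thesis .
qed

lemma ell2_norm_diff_power2:
  assumes u: "u \<in> ell2" and v: "v \<in> ell2"
  shows "(ell2_norm (\<lambda>x. u x - of_real t * v x))\<^sup>2
           = (ell2_norm u)\<^sup>2 - 2 * t * Re (ell2_inner u v) + t\<^sup>2 * (ell2_norm v)\<^sup>2"
proof -
  have s: "(\<lambda>x. (cmod (u x))\<^sup>2) summable_on UNIV" "(\<lambda>x. (cmod (v x))\<^sup>2) summable_on UNIV"
    using u v by (auto simp: ell2_def)
  have si: "(\<lambda>x. cnj (u x) * v x) summable_on UNIV"
    by (rule ell2_inner_summable[OF u v])
  have sR: "(\<lambda>x. Re (cnj (u x) * v x)) summable_on UNIV"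
    using summable_on_Re[OF si] .
  have "(\<Sum>\<^sub>\<infinity>x. (cmod (u x - of_real t * v x))\<^sup>2)
      = (\<Sum>\<^sub>\<infinity>x. ((cmod (u x))\<^sup>2 + (- 2 * t) * Re (cnj (u x) * v x)) + t\<^sup>2 * (cmod (v x))\<^sup>2)"
    by (intro infsum_cong) (simp add: cmod_power2, simp add: algebra_simps power2_eq_square)
  also have "\<dots> = (\<Sum>\<^sub>\<infinity>x. (cmod (u x))\<^sup>2 + (- 2 * t) * Re (cnj (u x) * v x)) + (\<Sum>\<^sub>\<infinity>x. t\<^sup>2 * (cmod (v x))\<^sup>2)"
    by (intro infsum_add summable_on_add summable_on_cmult_right s sR)
  also have "\<dots> = (\<Sum>\<^sub>\<infinity>x. (cmod (u x))\<^sup>2) + (\<Sum>\<^sub>\<infinity>x. (- 2 * t) * Re (cnj (u x) * v x)) + (\<Sum>\<^sub>\<infinity>x. t\<^sup>2 * (cmod (v x))\<^sup>2)"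
    by (subst infsum_add) (intro summable_on_cmult_right s sR refl)+
  also have "\<dots> = (\<Sum>\<^sub>\<infinity>x. (cmod (u x))\<^sup>2) + (- 2 * t) * (\<Sum>\<^sub>\<infinity>x. Re (cnj (u x) * v x)) + t\<^sup>2 * (\<Sum>\<^sub>\<infinity>x. (cmod (v x))\<^sup>2)"
    by (simp only: infsum_cmult_right')
  also have "(\<Sum>\<^sub>\<infinity>x. Re (cnj (u x) * v x)) = Re (ell2_inner u v)"
    unfolding ell2_inner_def using infsum_Re[OF si] by simp
  finally show ?thesis by (simp add: ell2_norm_power2)
qed

text \<open>If the adjoint \<open>T'\<close> is bounded below by \<open>c\<close> and \<open>A\<close> bounds the norm of \<open>T\<close>, then \<open>Q = 1 - T T' / A\<^sup>2\<close>
  satisfies \<open>\<parallel>Q v\<parallel>\<^sup>2 \<le> \<parallel>v\<parallel>\<^sup>2 - \<parallel>T' v\<parallel>\<^sup>2 / A\<^sup>2 \<le> (1 - c\<^sup>2 / A\<^sup>2) \<parallel>v\<parallel>\<^sup>2\<close>, so \<open>T T'\<close> is inverted by a Neumann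
  series. The series is summed pointwise, and \<open>T T'\<close> passes through the sum because it is banded.\<close>

lemma band_surjective:
  fixes k :: "'a::ab_group_add \<Rightarrow> 'a \<Rightarrow> complex"
  assumes S: "finite S" and B: "\<And>x y. cmod (k x y) \<le> B"
    and c: "c > 0" and below: "\<And>v. v \<in> ell2 \<Longrightarrow> c * ell2_norm v \<le> ell2_norm (band_adj S k v)"
    and w: "w \<in> ell2"
  shows "\<exists>u\<in>ell2. band S k u = w"
proof -
  define T where "T = band S k"
  define T' where "T' = band_adj S k"
  \<comment> \<open>Adding \<open>c\<close> makes the bound positive, also for the zero operator.\<close>
  define A where "A = real (card S) * B + c"
  have B0: "0 \<le> B" using B[of undefined undefined] norm_ge_zero order_trans by blast
  have A: "A > 0" using c B0 by (simp add: A_def add_nonneg_pos)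
  have TA: "T u \<in> ell2" "ell2_norm (T u) \<le> A * ell2_norm u" if "u \<in> ell2" for u
  proof -
    show "T u \<in> ell2" using band_ell2[OF S B that] by (simp add: T_def)
    have "ell2_norm (T u) \<le> (real (card S) * B) * ell2_norm u"
      using band_ell2[OF S B that] by (simp add: T_def)
    also have "\<dots> \<le> A * ell2_norm u"
      using c by (intro mult_right_mono) (auto simp: A_def ell2_norm_nonneg)
    finally show "ell2_norm (T u) \<le> A * ell2_norm u" .
  qed
  have T'ell: "T' u \<in> ell2" if "u \<in> ell2" for u
    unfolding T'_def band_adj_def
    by (rule band_ell2[where B=B]) (use S B that in auto)
  define t where "t = 1 / A\<^sup>2"
  have t: "t > 0" "t * A\<^sup>2 = 1" using A by (auto simp: t_def)
  define Q where "Q v = (\<lambda>x. v x - of_real t * T (T' v) x)" for v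
  define q where "q = sqrt (max 0 (1 - t * c\<^sup>2))"
  have q: "0 \<le> q" "q < 1" using t c by (auto simp: q_def)
  have Q: "Q v \<in> ell2" "ell2_norm (Q v) \<le> q * ell2_norm v" if v: "v \<in> ell2" for v
  proof -
    note T'v = T'ell[OF v]
    note TT'v = TA(1)[OF T'v]
    show "Q v \<in> ell2" unfolding Q_def by (intro ell2_diff ell2_cmult v TT'v)
    have ip: "ell2_inner v (T (T' v)) = of_real ((ell2_norm (T' v))\<^sup>2)"
      unfolding T_def using band_adjoint[OF S B T'v v] ell2_inner_self[OF T'v] by (simp add: T'_def)
    have "(ell2_norm (Q v))\<^sup>2 = (ell2_norm v)\<^sup>2 - 2 * t * (ell2_norm (T' v))\<^sup>2 + t\<^sup>2 * (ell2_norm (T (T' v)))\<^sup>2"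
      unfolding Q_def ell2_norm_diff_power2[OF v TT'v] ip by simp
    also have "(ell2_norm (T (T' v)))\<^sup>2 \<le> (A * ell2_norm (T' v))\<^sup>2"
      by (intro power_mono TA T'v ell2_norm_nonneg)
    also have "t\<^sup>2 * (A * ell2_norm (T' v))\<^sup>2 = t * (t * A\<^sup>2) * (ell2_norm (T' v))\<^sup>2"
      by (simp add: power2_eq_square)
    finally have "(ell2_norm (Q v))\<^sup>2 \<le> (ell2_norm v)\<^sup>2 - t * (ell2_norm (T' v))\<^sup>2"
      using t by (auto simp: mult_left_mono)
    also have "(c * ell2_norm v)\<^sup>2 \<le> (ell2_norm (T' v))\<^sup>2"
      unfolding T'_def using c by (intro power_mono below v) (auto simp: ell2_norm_nonneg)
    then have "(ell2_norm v)\<^sup>2 - t * (ell2_norm (T' v))\<^sup>2 \<le> (ell2_norm v)\<^sup>2 - t * (c * ell2_norm v)\<^sup>2"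
      using t by simp
    also have "\<dots> = (1 - t * c\<^sup>2) * (ell2_norm v)\<^sup>2" by (simp add: power2_eq_square algebra_simps)
    also have "\<dots> \<le> q\<^sup>2 * (ell2_norm v)\<^sup>2" by (intro mult_right_mono) (auto simp: q_def)
    finally have "(ell2_norm (Q v))\<^sup>2 \<le> (q * ell2_norm v)\<^sup>2" by (simp add: power_mult_distrib)
    then show "ell2_norm (Q v) \<le> q * ell2_norm v"
      using q ell2_norm_nonneg by (meson mult_nonneg_nonneg power2_le_imp_le)
  qed
  define r where "r n = (Q ^^ n) w" for n
  have r: "r n \<in> ell2 \<and> ell2_norm (r n) \<le> q ^ n * ell2_norm w" for n
  proof (induction n)
    case 0
    then show ?case using w by (simp add: r_def)
  next
    case (Suc n)
    have "ell2_norm (Q (r n)) \<le> q * (q ^ n * ell2_norm w)"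
      using Q(2)[of "r n"] Suc q by (meson mult_left_mono order_trans)
    then show ?case using Q(1)[of "r n"] Suc by (auto simp: r_def)
  qed
  have sg: "summable (\<lambda>n. q ^ n * ell2_norm w)"
    using q by (intro summable_mult2 summable_geometric) auto
  have sr: "summable (\<lambda>n. r n x)" for x
  proof (rule summable_comparison_test'[OF sg, of 0])
    show "norm (r n x) \<le> q ^ n * ell2_norm w" for n
      using r[of n] cmod_le_ell2_norm[of "r n" x] by linarith
  qed
  define s where "s x = (\<Sum>n. r n x)" for x
  have ss: "(\<lambda>n. r n x) sums s x" for x
    unfolding s_def using sr by (rule summable_sums)
  have L: "L2_set (\<lambda>x. cmod (s x)) F \<le> (\<Sum>n. q ^ n * ell2_norm w)" if F: "finite F" for F
  proof -
    have "(\<lambda>N. L2_set (\<lambda>x. cmod (\<Sum>n<N. r n x)) F) \<longlonglongrightarrow> L2_set (\<lambda>x. cmod (s x)) F"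
      unfolding L2_set_def using ss by (intro tendsto_intros) (auto simp: sums_def)
    moreover have "L2_set (\<lambda>x. cmod (\<Sum>n<N. r n x)) F \<le> (\<Sum>n. q ^ n * ell2_norm w)" for N
    proof -
      have 1: "(\<lambda>x. \<Sum>n<N. r n x) \<in> ell2 \<and> ell2_norm (\<lambda>x. \<Sum>n<N. r n x) \<le> (\<Sum>n<N. ell2_norm (r n))"
        by (rule ell2_sum) (use r in auto)
      have "L2_set (\<lambda>x. cmod (\<Sum>n<N. r n x)) F \<le> ell2_norm (\<lambda>x. \<Sum>n<N. r n x)"
        by (rule L2_set_cmod_le_ell2_norm[OF conjunct1[OF 1] F])
      also have "\<dots> \<le> (\<Sum>n<N. ell2_norm (r n))" using 1 by simp
      also have "\<dots> \<le> (\<Sum>n<N. q ^ n * ell2_norm w)" by (intro sum_mono) (use r in auto)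
      also have "\<dots> \<le> (\<Sum>n. q ^ n * ell2_norm w)"
        by (rule sum_le_suminf[OF sg]) (use q ell2_norm_nonneg[of w] in auto)
      finally show ?thesis .
    qed
    ultimately show ?thesis by (intro LIMSEQ_le_const2) auto
  qed
  have sell: "s \<in> ell2" by (rule ell2I[OF L])
  have TT: "(\<lambda>n. T (T' (r n)) x) sums T (T' s) x" for x
    unfolding T_def T'_def band_adj_def band_def by (intro sums_sum sums_mult ss)
  have "of_real t * T (T' s) x = w x" for x
  proof -
    have "(\<lambda>n. r n x - of_real t * T (T' (r n)) x) sums (s x - of_real t * T (T' s) x)"
      by (intro sums_diff sums_mult TT ss)
    then have "(\<lambda>n. r (Suc n) x) sums (s x - of_real t * T (T' s) x)"
      by (simp add: r_def Q_def)
    moreover have "(\<lambda>n. r (Suc n) x) sums (s x - w x)"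
      using ss[of x] sums_Suc_iff[of "\<lambda>n. r n x"] by (simp add: r_def)
    ultimately show ?thesis using sums_unique2 by fastforce
  qed
  then have "T (\<lambda>x. of_real t * T' s x) = w"
    unfolding T_def band_cmult by auto
  moreover have "(\<lambda>x. of_real t * T' s x) \<in> ell2" by (intro ell2_cmult T'ell sell)
  ultimately show ?thesis unfolding T_def by blast
qed

text \<open>Truncation reduces a lower bound to finitely supported functions, because the operator is bounded.\<close>

lemma band_bounded_below:
  fixes k :: "'a::ab_group_add \<Rightarrow> 'a \<Rightarrow> complex"
  assumes S: "finite S" and B: "\<And>x y. cmod (k x y) \<le> B" and K: "0 \<le> K"
    and fin: "\<And>u X. finite X \<Longrightarrow> (\<And>x. x \<notin> X \<Longrightarrow> u x = 0) \<Longrightarrow> ell2_norm u \<le> K * ell2_norm (band S k u)"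
    and u: "u \<in> ell2"
  shows "ell2_norm u \<le> K * ell2_norm (band S k u)"
proof (rule field_le_epsilon)
  fix e :: real assume e: "e > 0"
  define A where "A = real (card S) * B"
  have B0: "0 \<le> B" using B[of undefined undefined] norm_ge_zero order_trans by blast
  \<comment> \<open>Small enough to absorb the truncation error both in \<open>u\<close> and in its image.\<close>
  define d where "d = e / (1 + K * A)"
  have A: "0 \<le> A" "0 \<le> K * A" using B0 K by (auto simp: A_def)
  have d: "d > 0" using e A by (auto simp: d_def)
  obtain X where X: "finite X" "ell2_norm (\<lambda>x. u x - (if x \<in> X then u x else 0)) < d"
    using ell2_truncation[OF u d] .
  define t where "t x = (if x \<in> X then u x else 0)" for x
  define r where "r x = u x - t x" for x
  have tl: "t \<in> ell2" by (rule ell2_finite_support[OF X(1)]) (auto simp: t_def)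
  have rl: "r \<in> ell2" unfolding r_def by (intro ell2_diff u tl)
  have rd: "ell2_norm r < d" using X unfolding r_def[abs_def] t_def[abs_def] by simp
  have bl: "band S k v \<in> ell2" "ell2_norm (band S k v) \<le> A * ell2_norm v" if "v \<in> ell2" for v
    using band_ell2[OF S B that] by (auto simp: A_def)
  have "ell2_norm u = ell2_norm (\<lambda>x. t x + r x)" by (simp add: r_def)
  also have "\<dots> \<le> ell2_norm t + ell2_norm r" by (intro ell2_add tl rl)
  also have "ell2_norm t \<le> K * ell2_norm (band S k t)"
    by (rule fin[OF X(1)]) (auto simp: t_def)
  also have "ell2_norm (band S k t) \<le> ell2_norm (band S k u) + A * d"
  proof -
    have "band S k t = (\<lambda>x. band S k u x - band S k r x)"
      unfolding r_def band_diff by simp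
    then have "ell2_norm (band S k t) \<le> ell2_norm (band S k u) + ell2_norm (band S k r)"
      using ell2_diff(2)[OF bl(1)[OF u] bl(1)[OF rl]] by simp
    also have "ell2_norm (band S k r) \<le> A * ell2_norm r" by (rule bl(2)[OF rl])
    also have "\<dots> \<le> A * d" using A rd by (intro mult_left_mono) auto
    finally show ?thesis by simp
  qed
  finally have "ell2_norm u \<le> K * (ell2_norm (band S k u) + A * d) + ell2_norm r"
    using K by (simp add: mult_left_mono)
  also have "\<dots> \<le> K * ell2_norm (band S k u) + (1 + K * A) * d"
    using rd by (simp add: algebra_simps)
  also have "(1 + K * A) * d = e" using A by (simp add: d_def add_nonneg_eq_0_iff)
  finally show "ell2_norm u \<le> K * ell2_norm (band S k u) + e" .
qed

text \<open>A lower bound for the adjoint gives surjectivity, and one for the operator gives injectivity and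
  the bound on the inverse. Linearity of the inverse follows from injectivity.\<close>

lemma not_in_spectrumI:
  fixes k :: "'a::ab_group_add \<Rightarrow> 'a \<Rightarrow> complex"
  assumes S: "finite S" and B: "\<And>x y. cmod (k x y) \<le> B" and c: "c > 0"
    and below: "\<And>v. v \<in> ell2 \<Longrightarrow> c * ell2_norm v \<le> ell2_norm (band S k v)"
    and below': "\<And>v. v \<in> ell2 \<Longrightarrow> c * ell2_norm v \<le> ell2_norm (band_adj S k v)"
    and T: "\<And>u x. T u x - z * u x = band S k u x"
  shows "z \<notin> ell2_spectrum T"
proof -
  have inj: "u = v" if "u \<in> ell2" "v \<in> ell2" "band S k u = band S k v" for u v
  proof -
    have d: "(\<lambda>x. u x - v x) \<in> ell2" by (intro ell2_diff that)
    have "band S k (\<lambda>x. u x - v x) = (\<lambda>x. 0)" using that(3) by (simp add: band_diff)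
    then have "c * ell2_norm (\<lambda>x. u x - v x) \<le> 0" using below[OF d] by (simp add: ell2_zero)
    then have "ell2_norm (\<lambda>x. u x - v x) \<le> 0" using c by (simp add: mult_le_0_iff)
    from ell2_eq_zero[OF d this] show ?thesis by (auto simp: fun_eq_iff)
  qed
  define R where "R w = (SOME u. u \<in> ell2 \<and> band S k u = w)" for w
  have R: "R w \<in> ell2" "band S k (R w) = w" if "w \<in> ell2" for w
  proof -
    have "\<exists>u. u \<in> ell2 \<and> band S k u = w"
      using band_surjective[OF S B c below' that] by blast
    from someI_ex[OF this] show "R w \<in> ell2" "band S k (R w) = w" by (simp_all add: R_def)
  qed
  have RT: "R (band S k u) = u" if "u \<in> ell2" for u
    by (rule inj) (use R[OF band_ell2(1)[OF S B that]] that in auto)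
  have "ell2_bounded_operator R"
    unfolding ell2_bounded_operator_def
  proof (intro conjI ballI allI exI)
    fix u assume u: "u \<in> (ell2 :: ('a \<Rightarrow> complex) set)"
    show "R u \<in> ell2" by (rule R[OF u])
    show "ell2_norm (R u) \<le> (1 / c) * ell2_norm u"
      using below[OF R(1)[OF u]] R(2)[OF u] c by (simp add: field_simps)
    show "R (\<lambda>x. a * u x) = (\<lambda>x. a * R u x)" for a
      by (rule inj) (simp_all add: R u ell2_cmult(1) band_cmult)
    fix v assume v: "v \<in> (ell2 :: ('a \<Rightarrow> complex) set)"
    show "R (\<lambda>x. u x + v x) = (\<lambda>x. R u x + R v x)"
      by (rule inj) (simp_all add: R u v ell2_add(1) band_add)
  qed
  moreover have "(\<lambda>x. T u x - z * u x) = band S k u" for u using T by auto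
  ultimately show ?thesis using R RT by (auto simp: ell2_spectrum_def)
qed

lemma not_in_spectrumD:
  assumes "z \<notin> ell2_spectrum T"
  obtains C where "C > 0" "\<And>u. u \<in> ell2 \<Longrightarrow> (\<lambda>x. T u x - z * u x) \<in> ell2 \<Longrightarrow>
                     ell2_norm u \<le> C * ell2_norm (\<lambda>x. T u x - z * u x)"
proof -
  obtain R where R: "ell2_bounded_operator R" "\<And>u. u \<in> ell2 \<Longrightarrow> R (\<lambda>x. T u x - z * u x) = u"
    using assms by (auto simp: ell2_spectrum_def)
  then obtain C where C: "\<And>u. u \<in> ell2 \<Longrightarrow> ell2_norm (R u) \<le> C * ell2_norm u"
    unfolding ell2_bounded_operator_def by blast
  show ?thesis
  proof (rule that)
    show "max C 1 > 0" by simp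
    fix u assume "u \<in> ell2" "(\<lambda>x. T u x - z * u x) \<in> ell2"
    then have "ell2_norm u \<le> C * ell2_norm (\<lambda>x. T u x - z * u x)" using R C by metis
    also have "\<dots> \<le> max C 1 * ell2_norm (\<lambda>x. T u x - z * u x)"
      by (intro mult_right_mono ell2_norm_nonneg) auto
    finally show "ell2_norm u \<le> max C 1 * ell2_norm (\<lambda>x. T u x - z * u x)" .
  qed
qed

section \<open>Plane waves\<close>

text \<open>The pairing is \<open>n \<theta>\<^sub>1 - m \<theta>\<^sub>2\<close> for the site \<open>(m, n)\<close>. With this choice the hopping operator multiplies
  \<open>wave \<theta>\<close> by the value at \<open>\<theta>\<close> of the function \<open>V\<close>, without a change of variables.\<close>

definition wave :: "real \<times> real \<Rightarrow> int \<times> int \<Rightarrow> complex" where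
  "wave \<theta> x = cis (2 * pi * (of_int (snd x) * fst \<theta> - of_int (fst x) * snd \<theta>))"

lemma wave_simps [simp]:
  "wave \<theta> 0 = 1" "wave 0 x = 1" "cmod (wave \<theta> x) = 1" "wave \<theta> x \<noteq> 0"
  by (simp_all add: wave_def)

lemma wave_add_right: "wave \<theta> (x + y) = wave \<theta> x * wave \<theta> y"
  by (simp add: wave_def cis_mult algebra_simps)

lemma wave_add_left: "wave (\<theta> + \<eta>) x = wave \<theta> x * wave \<eta> x"
  by (simp add: wave_def cis_mult algebra_simps)

lemma wave_minus_right: "wave \<theta> (- x) = cnj (wave \<theta> x)"
  by (simp add: wave_def cis_cnj algebra_simps)

lemma wave_minus_left: "wave (- \<theta>) x = cnj (wave \<theta> x)"
  by (simp add: wave_def cis_cnj algebra_simps)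

lemma wave_diff_right: "wave \<theta> (x - y) = wave \<theta> x * cnj (wave \<theta> y)"
  using wave_add_right[of \<theta> x "- y"] by (simp add: wave_minus_right)

lemma wave_diff_left: "wave (\<theta> - \<eta>) x = wave \<theta> x * cnj (wave \<eta> x)"
  using wave_add_left[of \<theta> "- \<eta>" x] by (simp add: wave_minus_left)

lemma wave_scaleR: "wave (real j *\<^sub>R \<eta>) x = wave \<eta> x ^ j"
  unfolding wave_def Complex.DeMoivre by (rule arg_cong[where f=cis]) (simp add: algebra_simps)

text \<open>The rotation of the torus by \<open>\<eta>\<close> has no invariant character apart from the constant one.\<close>

definition nonresonant :: "real \<times> real \<Rightarrow> bool" where
  "nonresonant \<eta> \<longleftrightarrow> (\<forall>x. x \<noteq> 0 \<longrightarrow> wave \<eta> x \<noteq> 1)"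

lemma nonresonant_uminus: "nonresonant \<eta> \<Longrightarrow> nonresonant (- \<eta>)"
  by (auto simp: nonresonant_def wave_minus_left)

lemma norm_geometric_average_le:
  assumes "cmod w = 1" "w \<noteq> 1"
  shows "cmod ((\<Sum>j<N. w ^ j) / N) \<le> 2 / cmod (w - 1) / N"
proof -
  have "cmod (\<Sum>j<N. w ^ j) = cmod (w ^ N - 1) / cmod (w - 1)"
    using assms by (simp add: geometric_sum norm_divide)
  also have "\<dots> \<le> 2 / cmod (w - 1)"
    using norm_triangle_ineq4[of "w ^ N" 1] assms by (intro divide_right_mono) (simp_all add: norm_power)
  finally have "cmod (\<Sum>j<N. w ^ j) \<le> 2 / cmod (w - 1)" .
  then show ?thesis
    unfolding norm_divide norm_of_nat by (rule divide_right_mono) simp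
qed

lemma geometric_average_tendsto:
  assumes "cmod w = 1" "w \<noteq> 1"
  shows "(\<lambda>N. (\<Sum>j<N. w ^ j) / of_nat N) \<longlonglongrightarrow> 0"
proof (rule Lim_null_comparison)
  show "\<forall>\<^sub>F N in sequentially. cmod ((\<Sum>j<N. w ^ j) / of_nat N) \<le> 2 / cmod (w - 1) / real N"
    using norm_geometric_average_le[OF assms] by auto
  show "(\<lambda>N. 2 / cmod (w - 1) / real N) \<longlonglongrightarrow> 0"
    by (rule lim_const_over_n)
qed

section \<open>Fourier sums averaged along an orbit\<close>

text \<open>The sum runs over the support, so it is meaningful for finitely supported functions.\<close>

definition fourier :: "(int \<times> int \<Rightarrow> complex) \<Rightarrow> real \<times> real \<Rightarrow> complex" where
  "fourier u \<theta> = (\<Sum>x | u x \<noteq> 0. u x * cnj (wave \<theta> x))"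

lemma fourier_superset:
  assumes "finite X" "\<And>x. x \<notin> X \<Longrightarrow> u x = 0"
  shows "fourier u \<theta> = (\<Sum>x\<in>X. u x * cnj (wave \<theta> x))"
  unfolding fourier_def by (rule sum.mono_neutral_left) (use assms in auto)

text \<open>This is the orthogonality relation behind the Plancherel identity below: the average along an orbit
  replaces the integral over the torus.\<close>

lemma wave_orbit_average:
  assumes "nonresonant \<eta>"
  shows "(\<lambda>N. (\<Sum>j<N. wave (\<theta> + real j *\<^sub>R \<eta>) x) / of_nat N) \<longlonglongrightarrow> (if x = 0 then 1 else 0)"
proof (cases "x = 0")
  case True
  have "(\<lambda>N. (\<Sum>j<N. (1::complex)) / of_nat N) \<longlonglongrightarrow> 1"
    by (rule tendsto_eventually) (auto intro: eventually_sequentiallyI[of 1])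
  with True show ?thesis by simp
next
  case False
  then have "(\<lambda>N. wave \<theta> x * ((\<Sum>j<N. wave \<eta> x ^ j) / of_nat N)) \<longlonglongrightarrow> wave \<theta> x * 0"
    by (intro tendsto_mult tendsto_const geometric_average_tendsto) (use assms False in \<open>auto simp: nonresonant_def simp del: split_paired_All\<close>)
  with False show ?thesis
    by (simp add: wave_add_left wave_scaleR sum_distrib_left)
qed

text \<open>Orthonormality may hold only in the limit of a sequence of averages. It is used for averages
  over an orbit of frequencies and for averages over growing boxes of sites.\<close>

lemma mean_square_of_orthonormal_family:
  fixes w :: "'k \<Rightarrow> 'x \<Rightarrow> complex" and Q :: "nat \<Rightarrow> 'x set" and n :: "nat \<Rightarrow> real"
  assumes fin: "finite I"
    and orth: "\<And>k l. k \<in> I \<Longrightarrow> l \<in> I \<Longrightarrow>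
      (\<lambda>N. (\<Sum>x\<in>Q N. w k x * cnj (w l x)) / of_real (n N)) \<longlonglongrightarrow> (if l = k then 1 else 0)"
  shows "(\<lambda>N. (\<Sum>x\<in>Q N. (cmod (\<Sum>k\<in>I. c k * w k x))\<^sup>2) / n N) \<longlonglongrightarrow> (\<Sum>k\<in>I. (cmod (c k))\<^sup>2)"
proof -
  have sq: "complex_of_real ((cmod (\<Sum>k\<in>I. c k * w k x))\<^sup>2)
      = (\<Sum>k\<in>I. \<Sum>l\<in>I. c k * cnj (c l) * (w k x * cnj (w l x)))" for x
    unfolding complex_norm_square cnj_sum sum_product
    by (intro sum.cong refl) (simp add: mult_ac)
  have "(\<lambda>N. \<Sum>k\<in>I. \<Sum>l\<in>I. c k * cnj (c l) * ((\<Sum>x\<in>Q N. w k x * cnj (w l x)) / of_real (n N)))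
     \<longlonglongrightarrow> (\<Sum>k\<in>I. \<Sum>l\<in>I. c k * cnj (c l) * (if l = k then 1 else 0))"
    by (intro tendsto_sum tendsto_mult tendsto_const orth)
  also have "(\<Sum>k\<in>I. \<Sum>l\<in>I. c k * cnj (c l) * (if l = k then 1 else 0)) = (\<Sum>k\<in>I. c k * cnj (c k))"
    using fin by (intro sum.cong refl) (simp add: if_distrib[of "\<lambda>t. _ * t"] cong: if_cong)
  also have "\<dots> = complex_of_real (\<Sum>k\<in>I. (cmod (c k))\<^sup>2)"
    by (simp only: of_real_sum complex_norm_square)
  also have "(\<lambda>N. \<Sum>k\<in>I. \<Sum>l\<in>I. c k * cnj (c l) * ((\<Sum>x\<in>Q N. w k x * cnj (w l x)) / of_real (n N)))
     = (\<lambda>N. complex_of_real ((\<Sum>x\<in>Q N. (cmod (\<Sum>k\<in>I. c k * w k x))\<^sup>2) / n N))"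
  proof
    fix N
    have "complex_of_real ((\<Sum>x\<in>Q N. (cmod (\<Sum>k\<in>I. c k * w k x))\<^sup>2) / n N)
        = (\<Sum>x\<in>Q N. \<Sum>k\<in>I. \<Sum>l\<in>I. c k * cnj (c l) * (w k x * cnj (w l x))) / of_real (n N)"
      by (simp only: of_real_divide of_real_sum sq)
    also have "\<dots> = (\<Sum>k\<in>I. \<Sum>l\<in>I. \<Sum>x\<in>Q N. c k * cnj (c l) * (w k x * cnj (w l x))) / of_real (n N)"
      by (subst sum.swap, rule arg_cong[where f="\<lambda>t. t / _"], intro sum.cong refl, rule sum.swap)
    finally show "(\<Sum>k\<in>I. \<Sum>l\<in>I. c k * cnj (c l) * ((\<Sum>x\<in>Q N. w k x * cnj (w l x)) / of_real (n N)))
        = complex_of_real ((\<Sum>x\<in>Q N. (cmod (\<Sum>k\<in>I. c k * w k x))\<^sup>2) / n N)"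
      by (simp add: sum_distrib_left sum_divide_distrib)
  qed
  finally show ?thesis by (simp only: tendsto_of_real_iff)
qed

text \<open>Parseval's identity with the mean along an orbit in place of the integral. An inequality between
  Fourier sums that holds at each frequency, with different shifts of the frequency on the two sides, thus becomes
  an inequality between norms.\<close>

lemma plancherel_orbit:
  assumes \<eta>: "nonresonant \<eta>" and X: "finite X" "\<And>x. x \<notin> X \<Longrightarrow> u x = 0"
  shows "(\<lambda>N. (\<Sum>j<N. (cmod (fourier u (\<theta> + real j *\<^sub>R \<eta>)))\<^sup>2) / real N) \<longlonglongrightarrow> (ell2_norm u)\<^sup>2"
proof -
  have "(\<lambda>N. (\<Sum>j<N. (cmod (\<Sum>x\<in>X. u x * cnj (wave (\<theta> + real j *\<^sub>R \<eta>) x)))\<^sup>2) / real N)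
      \<longlonglongrightarrow> (\<Sum>x\<in>X. (cmod (u x))\<^sup>2)"
  proof (rule mean_square_of_orthonormal_family[OF X(1)])
    fix x y
    have "cnj (wave \<phi> x) * cnj (cnj (wave \<phi> y)) = wave \<phi> (y - x)" for \<phi>
      by (simp add: wave_diff_right)
    then show "(\<lambda>N. (\<Sum>j<N. cnj (wave (\<theta> + real j *\<^sub>R \<eta>) x) * cnj (cnj (wave (\<theta> + real j *\<^sub>R \<eta>) y)))
        / of_real (real N)) \<longlonglongrightarrow> (if y = x then 1 else 0)"
      using wave_orbit_average[OF \<eta>, of \<theta> "y - x"] by simp
  qed
  moreover have "fourier u \<phi> = (\<Sum>x\<in>X. u x * cnj (wave \<phi> x))" for \<phi>
    using X by (rule fourier_superset)
  moreover have "(ell2_norm u)\<^sup>2 = (\<Sum>x\<in>X. (cmod (u x))\<^sup>2)"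
    using X by (rule ell2_norm_finite_support)
  ultimately show ?thesis by simp
qed

section \<open>A gap of the cocycle gives a bounded inverse\<close>

text \<open>Entries of a convolution with coefficients \<open>a\<close> plus multiplication by \<open>\<mu>\<close> times a plane wave.\<close>

definition kern :: "(int \<times> int \<Rightarrow> complex) \<Rightarrow> complex \<Rightarrow> real \<times> real \<Rightarrow> int \<times> int \<Rightarrow> int \<times> int \<Rightarrow> complex" where
  "kern a \<mu> \<eta> x y = a y + (if y = 0 then \<mu> * wave \<eta> x else 0)"

text \<open>The eigenvalue of the convolution at the plane wave of frequency \<open>\<theta>\<close>.\<close>

definition symbol :: "(int \<times> int) set \<Rightarrow> (int \<times> int \<Rightarrow> complex) \<Rightarrow> real \<times> real \<Rightarrow> complex" where
  "symbol S a \<theta> = (\<Sum>y\<in>S. a y * wave \<theta> y)"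

text \<open>On Fourier sums, multiplication by \<open>wave \<eta>\<close> is a translation by \<open>\<eta>\<close>. The equation \<open>T u = 0\<close> becomes a first
  order recursion along the orbits of this translation, whose transfer factor across the \<open>N\<close> points
  from \<open>\<theta>\<close> to \<open>\<theta> + (N - 1) \<eta>\<close> has modulus \<open>cocycle S a \<eta> N \<theta> / \<bar>\<mu>\<bar> ^ N\<close>.\<close>

abbreviation cocycle ::
    "(int \<times> int) set \<Rightarrow> (int \<times> int \<Rightarrow> complex) \<Rightarrow> real \<times> real \<Rightarrow> nat \<Rightarrow> real \<times> real \<Rightarrow> real" where
  "cocycle S a \<eta> N \<theta> \<equiv> (\<Prod>k<N. cmod (symbol S a (\<theta> + real k *\<^sub>R \<eta>)))"

lemma band_kern:
  assumes "finite S" "0 \<in> S"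
  shows "band S (kern a \<mu> \<eta>) u x = (\<Sum>y\<in>S. a y * u (x + y)) + \<mu> * wave \<eta> x * u x"
proof -
  have "band S (kern a \<mu> \<eta>) u x
      = (\<Sum>y\<in>S. a y * u (x + y)) + (\<Sum>y\<in>S. if y = 0 then \<mu> * wave \<eta> x * u x else 0)"
    unfolding band_def kern_def sum.distrib[symmetric] by (intro sum.cong) (auto simp: algebra_simps)
  then show ?thesis using assms by simp
qed

text \<open>The adjoint belongs to the same class of operators, with \<open>\<eta>\<close> reversed and the symbol
  conjugated; each estimate for the operator therefore also serves for its adjoint.\<close>

lemma band_adj_kern:
  "band_adj S (kern a \<mu> \<eta>) = band (uminus ` S) (kern (\<lambda>y. cnj (a (- y))) (cnj \<mu>) (- \<eta>))"
  unfolding band_adj_def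
  by (rule arg_cong[where f="band _"]) (auto simp: kern_def fun_eq_iff wave_minus_left)

lemma symbol_adj: "symbol (uminus ` S) (\<lambda>y. cnj (a (- y))) \<theta> = cnj (symbol S a \<theta>)"
  unfolding symbol_def cnj_sum
  by (subst sum.reindex) (auto simp: inj_on_def wave_minus_right)

lemma kern_bounded:
  assumes "finite S"
  obtains B where "\<And>x y. y \<in> S \<Longrightarrow> cmod (kern a \<mu> \<eta> x y) \<le> B"
proof
  fix x y assume "y \<in> S"
  have "cmod (kern a \<mu> \<eta> x y) \<le> cmod (a y) + cmod \<mu>"
    unfolding kern_def by (rule order_trans[OF norm_triangle_ineq]) (auto simp: norm_mult)
  also have "cmod (a y) \<le> (\<Sum>y\<in>S. cmod (a y))"
    using \<open>y \<in> S\<close> assms by (intro member_le_sum) auto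
  finally show "cmod (kern a \<mu> \<eta> x y) \<le> (\<Sum>y\<in>S. cmod (a y)) + cmod \<mu>" by simp
qed

lemma symbol_bounded: "cmod (symbol S a \<theta>) \<le> (\<Sum>y\<in>S. cmod (a y))"
  unfolding symbol_def by (rule order_trans[OF norm_sum]) (simp add: norm_mult)

lemma fourier_band:
  assumes S: "finite S" "0 \<in> S" and X: "finite X" "\<And>x. x \<notin> X \<Longrightarrow> u x = 0"
  shows "fourier (band S (kern a \<mu> \<eta>) u) \<theta> = symbol S a \<theta> * fourier u \<theta> + \<mu> * fourier u (\<theta> - \<eta>)"
proof -
  define Y where "Y = (\<lambda>(x, y). x - y) ` (X \<times> S)"
  have Y: "finite Y" using S X by (auto simp: Y_def)
  have YI: "x \<in> Y" if "y \<in> S" "x + y \<in> X" for x y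
    using that unfolding Y_def by (intro image_eqI[of _ _ "(x + y, y)"]) auto
  have XY: "X \<subseteq> Y" using YI[of 0] S by auto
  have u0: "u (x + y) = 0" if "x \<notin> Y" "y \<in> S" for x y
    using YI[of y x] that X by blast
  have "fourier (band S (kern a \<mu> \<eta>) u) \<theta> = (\<Sum>x\<in>Y. band S (kern a \<mu> \<eta>) u x * cnj (wave \<theta> x))"
    using Y by (rule fourier_superset) (auto simp: band_def u0)
  also have "\<dots> = (\<Sum>x\<in>Y. \<Sum>y\<in>S. a y * u (x + y) * cnj (wave \<theta> x)) + (\<Sum>x\<in>Y. \<mu> * wave \<eta> x * u x * cnj (wave \<theta> x))"
    unfolding band_kern[OF S] by (simp add: algebra_simps sum.distrib sum_distrib_left)
  also have "(\<Sum>x\<in>Y. \<mu> * wave \<eta> x * u x * cnj (wave \<theta> x)) = \<mu> * fourier u (\<theta> - \<eta>)"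
    using X XY by (subst fourier_superset[OF Y]) (auto simp: wave_diff_left sum_distrib_left mult_ac)
  also have "(\<Sum>x\<in>Y. \<Sum>y\<in>S. a y * u (x + y) * cnj (wave \<theta> x)) = (\<Sum>y\<in>S. \<Sum>x\<in>Y. a y * u (x + y) * cnj (wave \<theta> x))"
    by (rule sum.swap)
  also have "\<dots> = (\<Sum>y\<in>S. a y * wave \<theta> y * fourier u \<theta>)"
  proof (intro sum.cong refl)
    fix y assume y: "y \<in> S"
    have "(\<Sum>x\<in>Y. a y * u (x + y) * cnj (wave \<theta> x)) = (\<Sum>x\<in>Y. a y * wave \<theta> y * (u (x + y) * cnj (wave \<theta> (x + y))))"
    proof (intro sum.cong refl)
      fix x
      have "wave \<theta> y * cnj (wave \<theta> (x + y)) = cnj (wave \<theta> x) * (wave \<theta> y * cnj (wave \<theta> y))"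
        by (simp add: wave_add_right mult_ac)
      also have "\<dots> = cnj (wave \<theta> x)"
        by (simp add: complex_norm_square[symmetric])
      finally show "a y * u (x + y) * cnj (wave \<theta> x) = a y * wave \<theta> y * (u (x + y) * cnj (wave \<theta> (x + y)))"
        by (simp add: mult_ac)
    qed
    also have "\<dots> = a y * wave \<theta> y * (\<Sum>x\<in>Y. u (x + y) * cnj (wave \<theta> (x + y)))"
      by (simp add: sum_distrib_left)
    also have "(\<Sum>x\<in>Y. u (x + y) * cnj (wave \<theta> (x + y))) = (\<Sum>x\<in>(\<lambda>x. x + y) ` Y. u x * cnj (wave \<theta> x))"
      by (subst sum.reindex) (auto simp: inj_on_def)
    also have "\<dots> = fourier u \<theta>"
    proof (rule fourier_superset[symmetric])
      show "finite ((\<lambda>x. x + y) ` Y)" using Y by simp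
      fix x assume "x \<notin> (\<lambda>x. x + y) ` Y"
      then have "x - y \<notin> Y" by (metis diff_add_cancel imageI)
      then show "u x = 0" using u0[of "x - y" y] y by simp
    qed
    finally show "(\<Sum>x\<in>Y. a y * u (x + y) * cnj (wave \<theta> x)) = a y * wave \<theta> y * fourier u \<theta>" .
  qed
  finally show ?thesis by (simp add: symbol_def sum_distrib_right)
qed

text \<open>Solving the inhomogeneous recursion \<open>\<mu> w (j + 1) = v j - f j w j\<close> for \<open>N\<close> steps.\<close>

lemma cocycle_iterate:
  fixes f w v :: "nat \<Rightarrow> complex"
  assumes rec: "\<And>j. v j = f j * w j + \<mu> * w (Suc j)"
    and C: "\<And>j. cmod (f j) \<le> C" "cmod \<mu> \<le> C" "1 \<le> C"
  shows "cmod ((- \<mu>) ^ N * w N - (\<Prod>j<N. f j) * w 0) \<le> C ^ N * (\<Sum>j<N. cmod (v j))"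
proof (induction N)
  case 0
  then show ?case by simp
next
  case (Suc N)
  have "- \<mu> * w (Suc N) = f N * w N - v N" using rec[of N] by simp
  then have "(- \<mu>) ^ Suc N * w (Suc N) = (- \<mu>) ^ N * (f N * w N - v N)"
    by (metis mult.assoc power_Suc2)
  then have "(- \<mu>) ^ Suc N * w (Suc N) - (\<Prod>j<Suc N. f j) * w 0
     = f N * ((- \<mu>) ^ N * w N - (\<Prod>j<N. f j) * w 0) - (- \<mu>) ^ N * v N"
    by (simp add: algebra_simps)
  then have "cmod ((- \<mu>) ^ Suc N * w (Suc N) - (\<Prod>j<Suc N. f j) * w 0)
    \<le> cmod (f N) * cmod ((- \<mu>) ^ N * w N - (\<Prod>j<N. f j) * w 0) + cmod \<mu> ^ N * cmod (v N)"
    using norm_triangle_ineq4[of "f N * ((- \<mu>) ^ N * w N - (\<Prod>j<N. f j) * w 0)" "(- \<mu>) ^ N * v N"]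
    by (simp only: norm_mult norm_power norm_minus_cancel)
  also have "\<dots> \<le> C * (C ^ N * (\<Sum>j<N. cmod (v j))) + (C * C ^ N) * cmod (v N)"
  proof (intro add_mono mult_mono Suc C mult_nonneg_nonneg)
    have "cmod \<mu> ^ N \<le> 1 * C ^ N" using C by (simp add: power_mono)
    also have "\<dots> \<le> C * C ^ N" using C by (intro mult_right_mono) auto
    finally show "cmod \<mu> ^ N \<le> C * C ^ N" .
  qed (use C in auto)
  also have "\<dots> = C ^ Suc N * (\<Sum>j<Suc N. cmod (v j))" by (simp add: algebra_simps)
  finally show ?case .
qed

text \<open>The pointwise inequality is squared, with \<open>(b + s)\<^sup>2 \<le> (1 + e) b\<^sup>2 + (1 + 1 / e) s\<^sup>2\<close>, and averaged along an
  orbit. Both Fourier sums of \<open>u\<close> then turn into the norm of \<open>u\<close>, so the terms with \<open>L\<close> and \<open>l\<close> can be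
  compared; \<open>e\<close> is chosen so small that half of the gap \<open>L\<^sup>2 - l\<^sup>2\<close> survives.\<close>

lemma norm_comparison_from_fourier:
  assumes \<eta>: "nonresonant \<eta>"
    and X: "finite X" "\<And>x. x \<notin> X \<Longrightarrow> u x = 0" and Y: "finite Y" "\<And>x. x \<notin> Y \<Longrightarrow> v x = 0"
    and lL: "0 \<le> l" "l < L" and C: "0 \<le> C"
    and le: "\<And>\<theta>. L * cmod (fourier u (\<theta> + p)) \<le> l * cmod (fourier u (\<theta> + q)) + C * (\<Sum>j<N. cmod (fourier v (\<theta> + r j)))"
  defines "e \<equiv> (L\<^sup>2 - l\<^sup>2) / (2 * (l\<^sup>2 + 1))"
  shows "(L\<^sup>2 - l\<^sup>2) / 2 * (ell2_norm u)\<^sup>2 \<le> (1 + 1 / e) * C\<^sup>2 * (real N)\<^sup>2 * (ell2_norm v)\<^sup>2"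
proof -
  have L2: "l\<^sup>2 < L\<^sup>2" using lL by (simp add: power_strict_mono)
  have lpos: "l\<^sup>2 + 1 > 0" by (simp add: add_nonneg_pos)
  have e: "e > 0" unfolding e_def using L2 lpos by simp
  have el: "e * l\<^sup>2 \<le> (L\<^sup>2 - l\<^sup>2) / 2"
  proof -
    have "e * l\<^sup>2 \<le> e * (l\<^sup>2 + 1)" using e by simp
    also have "\<dots> = (L\<^sup>2 - l\<^sup>2) / 2" unfolding e_def using lpos by (simp add: field_simps)
    finally show ?thesis .
  qed
  have sq: "L\<^sup>2 * (cmod (fourier u (\<theta> + p)))\<^sup>2 \<le> (1 + e) * l\<^sup>2 * (cmod (fourier u (\<theta> + q)))\<^sup>2
       + (1 + 1 / e) * C\<^sup>2 * real N * (\<Sum>j<N. (cmod (fourier v (\<theta> + r j)))\<^sup>2)" for \<theta>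
  proof -
    define b where "b = l * cmod (fourier u (\<theta> + q))"
    define s where "s = (\<Sum>j<N. cmod (fourier v (\<theta> + r j)))"
    have "(L * cmod (fourier u (\<theta> + p)))\<^sup>2 \<le> (b + C * s)\<^sup>2"
      unfolding b_def s_def using le[of \<theta>] lL by (intro power_mono) auto
    also have "\<dots> \<le> (1 + e) * b\<^sup>2 + (1 + 1 / e) * (C * s)\<^sup>2"
    proof -
      have "0 \<le> (sqrt e * b - C * s / sqrt e)\<^sup>2" by simp
      also have "\<dots> = e * b\<^sup>2 - 2 * b * (C * s) + (C * s)\<^sup>2 / e"
        using e by (simp add: power2_diff power_mult_distrib power_divide)
      finally show ?thesis by (simp add: power2_sum algebra_simps)
    qed
    also have "(C * s)\<^sup>2 \<le> C\<^sup>2 * (real N * (\<Sum>j<N. (cmod (fourier v (\<theta> + r j)))\<^sup>2))"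
      using sum_squared_le_sum_of_squares[of "\<lambda>j. cmod (fourier v (\<theta> + r j))" "{..<N}"]
      by (auto simp: power_mult_distrib s_def mult.commute[of "real N"] intro!: mult_left_mono)
    finally have "(L * cmod (fourier u (\<theta> + p)))\<^sup>2 \<le> (1 + e) * b\<^sup>2
        + (1 + 1 / e) * (C\<^sup>2 * (real N * (\<Sum>j<N. (cmod (fourier v (\<theta> + r j)))\<^sup>2)))"
      using e by (simp add: mult_left_mono)
    then show ?thesis by (simp only: b_def power_mult_distrib mult.assoc)
  qed
  define A where "A w J \<theta> = (\<Sum>j<J. (cmod (fourier w (\<theta> + real j *\<^sub>R \<eta>)))\<^sup>2) / real J" for w J \<theta>
  have Au: "(\<lambda>J. A u J \<theta>) \<longlonglongrightarrow> (ell2_norm u)\<^sup>2" for \<theta>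
    unfolding A_def by (rule plancherel_orbit[OF \<eta> X])
  have Av: "(\<lambda>J. A v J \<theta>) \<longlonglongrightarrow> (ell2_norm v)\<^sup>2" for \<theta>
    unfolding A_def by (rule plancherel_orbit[OF \<eta> Y])
  have ave: "L\<^sup>2 * A u J p \<le> (1 + e) * l\<^sup>2 * A u J q + (1 + 1 / e) * C\<^sup>2 * real N * (\<Sum>j<N. A v J (r j))" for J
  proof -
    define orb where "orb i = real i *\<^sub>R \<eta>" for i
    have "(\<Sum>i<J. L\<^sup>2 * (cmod (fourier u (p + orb i)))\<^sup>2) \<le>
       (\<Sum>i<J. (1 + e) * l\<^sup>2 * (cmod (fourier u (q + orb i)))\<^sup>2
       + (1 + 1 / e) * C\<^sup>2 * real N * (\<Sum>j<N. (cmod (fourier v (r j + orb i)))\<^sup>2))"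
      by (rule sum_mono) (use sq[of "orb i" for i] in \<open>simp add: add.commute\<close>)
    also have "\<dots> = (1 + e) * l\<^sup>2 * (\<Sum>i<J. (cmod (fourier u (q + orb i)))\<^sup>2)
       + (1 + 1 / e) * C\<^sup>2 * real N * (\<Sum>j<N. \<Sum>i<J. (cmod (fourier v (r j + orb i)))\<^sup>2)"
      unfolding sum.distrib sum_distrib_left[symmetric]
      by (subst sum.swap[of _ "{..<J}"]) (rule refl)
    finally have "L\<^sup>2 * (\<Sum>i<J. (cmod (fourier u (p + orb i)))\<^sup>2) / real J \<le>
       ((1 + e) * l\<^sup>2 * (\<Sum>i<J. (cmod (fourier u (q + orb i)))\<^sup>2)
       + (1 + 1 / e) * C\<^sup>2 * real N * (\<Sum>j<N. \<Sum>i<J. (cmod (fourier v (r j + orb i)))\<^sup>2)) / real J"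
      by (intro divide_right_mono) (auto simp: sum_distrib_left)
    then show ?thesis
      unfolding A_def orb_def by (simp add: add_divide_distrib sum_divide_distrib[symmetric])
  qed
  have "L\<^sup>2 * (ell2_norm u)\<^sup>2 \<le> (1 + e) * l\<^sup>2 * (ell2_norm u)\<^sup>2 + (1 + 1 / e) * C\<^sup>2 * real N * (\<Sum>j<N. (ell2_norm v)\<^sup>2)"
  proof (rule LIMSEQ_le)
    show "(\<lambda>J. L\<^sup>2 * A u J p) \<longlonglongrightarrow> L\<^sup>2 * (ell2_norm u)\<^sup>2"
      by (intro tendsto_intros Au)
    show "(\<lambda>J. (1 + e) * l\<^sup>2 * A u J q + (1 + 1 / e) * C\<^sup>2 * real N * (\<Sum>j<N. A v J (r j)))
      \<longlonglongrightarrow> (1 + e) * l\<^sup>2 * (ell2_norm u)\<^sup>2 + (1 + 1 / e) * C\<^sup>2 * real N * (\<Sum>j<N. (ell2_norm v)\<^sup>2)"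
      by (intro tendsto_add tendsto_mult tendsto_const tendsto_sum Au Av)
  qed (use ave in blast)
  then have "(L\<^sup>2 - l\<^sup>2 - e * l\<^sup>2) * (ell2_norm u)\<^sup>2 \<le> (1 + 1 / e) * C\<^sup>2 * (real N)\<^sup>2 * (ell2_norm v)\<^sup>2"
    by (simp add: algebra_simps power2_eq_square)
  moreover have "(L\<^sup>2 - l\<^sup>2) / 2 * (ell2_norm u)\<^sup>2 \<le> (L\<^sup>2 - l\<^sup>2 - e * l\<^sup>2) * (ell2_norm u)\<^sup>2"
    by (intro mult_right_mono) (use el in \<open>auto simp: field_simps\<close>)
  ultimately show ?thesis by linarith
qed

text \<open>A product along a backward orbit is a product along a forward orbit from its other end.\<close>

lemma prod_orbit_reverse:
  fixes \<theta> \<eta> :: "'a::real_vector" and F :: "'a \<Rightarrow> real"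
  shows "(\<Prod>k<N. F (\<theta> - real k *\<^sub>R \<eta>)) = (\<Prod>k<N. F ((\<theta> - real (N - 1) *\<^sub>R \<eta>) + real k *\<^sub>R \<eta>))"
proof -
  have "(\<Prod>k<N. F (\<theta> - real k *\<^sub>R \<eta>)) = (\<Prod>k<N. F (\<theta> - real (N - Suc k) *\<^sub>R \<eta>))"
    by (rule prod.nat_diff_reindex[symmetric])
  also have "\<dots> = (\<Prod>k<N. F ((\<theta> - real (N - 1) *\<^sub>R \<eta>) + real k *\<^sub>R \<eta>))"
  proof (intro prod.cong refl)
    fix k assume "k \<in> {..<N}"
    then have "real (N - Suc k) = real (N - 1) - real k" by (auto simp: of_nat_diff)
    then show "F (\<theta> - real (N - Suc k) *\<^sub>R \<eta>) = F ((\<theta> - real (N - 1) *\<^sub>R \<eta>) + real k *\<^sub>R \<eta>)"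
      by (simp only: scaleR_left_diff_distrib) (simp add: algebra_simps)
  qed
  finally show ?thesis .
qed

text \<open>By \<open>cocycle_iterate\<close>, \<open>\<bar>\<mu>\<bar> ^ N\<close> times the Fourier sum of \<open>u\<close> at one frequency and the \<open>N\<close>-step product times the
  Fourier sum at another frequency differ by Fourier sums of \<open>T u\<close>. If the product stays on one side of
  \<open>\<bar>\<mu>\<bar> ^ N\<close> with a gap, the equality of the mean squares of the two Fourier sums forces \<open>T u\<close> to be large.\<close>

lemma cocycle_gap_bounded_below:
  assumes S: "finite S" "0 \<in> S" and \<eta>: "nonresonant \<eta>"
    and gap: "(\<forall>\<theta>. cocycle S a \<eta> N \<theta> \<le> s) \<and> 0 \<le> s \<and> s < cmod \<mu> ^ N
      \<or> (\<forall>\<theta>. s \<le> cocycle S a \<eta> N \<theta>) \<and> cmod \<mu> ^ N < s"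
  obtains K where "K > 0" "\<And>u X. finite X \<Longrightarrow> (\<And>x. x \<notin> X \<Longrightarrow> u x = 0) \<Longrightarrow>
     ell2_norm u \<le> K * ell2_norm (band S (kern a \<mu> \<eta>) u)"
proof -
  define P where "P \<theta> = (\<Prod>k<N. cmod (symbol S a (\<theta> - real k *\<^sub>R \<eta>)))" for \<theta>
  have P: "P \<theta> = cocycle S a \<eta> N (\<theta> - real (N - 1) *\<^sub>R \<eta>)" for \<theta>
    unfolding P_def by (rule prod_orbit_reverse)
  have gapP: "(\<forall>\<theta>. P \<theta> \<le> s) \<and> 0 \<le> s \<and> s < cmod \<mu> ^ N \<or> (\<forall>\<theta>. s \<le> P \<theta>) \<and> cmod \<mu> ^ N < s"
    unfolding P using gap by blast
  define C where "C = max 1 (max (\<Sum>y\<in>S. cmod (a y)) (cmod \<mu>))"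
  have C: "cmod (symbol S a \<theta>) \<le> C" "cmod \<mu> \<le> C" "1 \<le> C" for \<theta>
    using symbol_bounded[of S a \<theta>] by (auto simp: C_def)
  \<comment> \<open>The two sides of the gap; which of \<open>s\<close> and \<open>\<bar>\<mu>\<bar> ^ N\<close> is the larger one depends on the case.\<close>
  define L l where "L = max s (cmod \<mu> ^ N)" and "l = min s (cmod \<mu> ^ N)"
  have lL: "0 \<le> l" "l < L"
    using gapP by (auto simp: L_def l_def min_def max_def intro: order_trans[OF zero_le_power, of "cmod \<mu>"])
  define e where "e = (L\<^sup>2 - l\<^sup>2) / (2 * (l\<^sup>2 + 1))"
  define D where "D = (1 + 1 / e) * (C ^ N)\<^sup>2 * (real N)\<^sup>2"
  define d where "d = (L\<^sup>2 - l\<^sup>2) / 2"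
  have d: "d > 0" unfolding d_def using lL by (simp add: power_strict_mono)
  have e: "e > 0" unfolding e_def using lL by (auto intro!: divide_pos_pos power_strict_mono add_nonneg_pos)
  have D: "D \<ge> 0" unfolding D_def using e by simp
  show ?thesis
  proof
    show "sqrt (D / d) + 1 > 0" using D d by (simp add: add_nonneg_pos)
    fix u :: "int \<times> int \<Rightarrow> complex" and X assume X: "finite X" "\<And>x. x \<notin> X \<Longrightarrow> u x = 0"
    define v where "v = band S (kern a \<mu> \<eta>) u"
    define Y where "Y = (\<lambda>(x, y). x - y) ` (X \<times> S)"
    have Y: "finite Y" using S X by (auto simp: Y_def)
    have v0: "v x = 0" if "x \<notin> Y" for x
    proof -
      have "u (x + y) = 0" if "y \<in> S" for y
      proof (rule X(2), rule notI)
        assume "x + y \<in> X"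
        then have "x \<in> Y" using that unfolding Y_def by (intro image_eqI[of _ _ "(x + y, y)"]) auto
        with \<open>x \<notin> Y\<close> show False by simp
      qed
      then show ?thesis by (simp add: v_def band_def)
    qed
    have fourier_v: "fourier v \<theta> = symbol S a \<theta> * fourier u \<theta> + \<mu> * fourier u (\<theta> - \<eta>)" for \<theta>
      unfolding v_def by (rule fourier_band[OF S X])
    have key: "\<bar>cmod \<mu> ^ N * cmod (fourier u (\<theta> - real N *\<^sub>R \<eta>)) - P \<theta> * cmod (fourier u \<theta>)\<bar>
        \<le> C ^ N * (\<Sum>j<N. cmod (fourier v (\<theta> - real j *\<^sub>R \<eta>)))" for \<theta>
    proof -
      have "cmod ((- \<mu>) ^ N * fourier u (\<theta> - real N *\<^sub>R \<eta>) - (\<Prod>j<N. symbol S a (\<theta> - real j *\<^sub>R \<eta>)) * fourier u (\<theta> - real 0 *\<^sub>R \<eta>))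
        \<le> C ^ N * (\<Sum>j<N. cmod (fourier v (\<theta> - real j *\<^sub>R \<eta>)))"
        by (rule cocycle_iterate[where w="\<lambda>j. fourier u (\<theta> - real j *\<^sub>R \<eta>)"])
           (use C in \<open>auto simp: fourier_v algebra_simps\<close>)
      moreover have "\<bar>cmod ((- \<mu>) ^ N * fourier u (\<theta> - real N *\<^sub>R \<eta>)) - cmod ((\<Prod>j<N. symbol S a (\<theta> - real j *\<^sub>R \<eta>)) * fourier u \<theta>)\<bar>
        \<le> cmod ((- \<mu>) ^ N * fourier u (\<theta> - real N *\<^sub>R \<eta>) - (\<Prod>j<N. symbol S a (\<theta> - real j *\<^sub>R \<eta>)) * fourier u \<theta>)"
        by (rule norm_triangle_ineq3)
      ultimately show ?thesis by (simp add: norm_mult norm_power P_def prod_norm)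
    qed
    have "d * (ell2_norm u)\<^sup>2 \<le> D * (ell2_norm v)\<^sup>2"
    proof (cases "s < cmod \<mu> ^ N")
      case True
      then have Ps: "P \<theta> \<le> s" for \<theta> using gapP by (auto simp del: split_paired_All)
      have "L * cmod (fourier u (\<theta> + (- real N *\<^sub>R \<eta>))) \<le> l * cmod (fourier u (\<theta> + 0))
              + C ^ N * (\<Sum>j<N. cmod (fourier v (\<theta> + (- real j *\<^sub>R \<eta>))))" for \<theta>
      proof -
        have "P \<theta> * cmod (fourier u \<theta>) \<le> s * cmod (fourier u \<theta>)" by (intro mult_right_mono Ps) auto
        then show ?thesis using key[of \<theta>] True by (simp add: L_def l_def)
      qed
      from norm_comparison_from_fourier[OF \<eta> X Y v0 lL _ this] show ?thesis
        using C(3) by (simp add: d_def D_def e_def)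
    next
      case False
      then have Ps: "s \<le> P \<theta>" "cmod \<mu> ^ N < s" for \<theta> using gapP by (auto simp del: split_paired_All)
      have "L * cmod (fourier u (\<theta> + 0)) \<le> l * cmod (fourier u (\<theta> + (- real N *\<^sub>R \<eta>)))
              + C ^ N * (\<Sum>j<N. cmod (fourier v (\<theta> + (- real j *\<^sub>R \<eta>))))" for \<theta>
      proof -
        have "s * cmod (fourier u \<theta>) \<le> P \<theta> * cmod (fourier u \<theta>)" by (intro mult_right_mono Ps) auto
        then show ?thesis using key[of \<theta>] Ps(2) by (simp add: L_def l_def)
      qed
      from norm_comparison_from_fourier[OF \<eta> X Y v0 lL _ this] show ?thesis
        using C(3) by (simp add: d_def D_def e_def)
    qed
    then have "(ell2_norm u)\<^sup>2 \<le> D / d * (ell2_norm v)\<^sup>2" using d by (simp add: field_simps)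
    also have "\<dots> = (sqrt (D / d) * ell2_norm v)\<^sup>2" using d D by (simp add: power_mult_distrib)
    finally have "ell2_norm u \<le> sqrt (D / d) * ell2_norm v"
      using d D ell2_norm_nonneg by (meson divide_nonneg_pos mult_nonneg_nonneg power2_le_imp_le real_sqrt_ge_zero)
    also have "\<dots> \<le> (sqrt (D / d) + 1) * ell2_norm v" by (simp add: algebra_simps ell2_norm_nonneg)
    finally show "ell2_norm u \<le> (sqrt (D / d) + 1) * ell2_norm (band S (kern a \<mu> \<eta>) u)"
      by (simp add: v_def)
  qed
qed

text \<open>The moduli of the products for the adjoint are those for the operator at shifted frequencies,
  so the same gap bounds both from below.\<close>

theorem cocycle_gap_resolvent:
  assumes S: "finite S" "0 \<in> S" and \<eta>: "nonresonant \<eta>"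
    and gap: "(\<forall>\<theta>. cocycle S a \<eta> N \<theta> \<le> s) \<and> 0 \<le> s \<and> s < cmod \<mu> ^ N
      \<or> (\<forall>\<theta>. s \<le> cocycle S a \<eta> N \<theta>) \<and> cmod \<mu> ^ N < s"
    and a: "\<And>y. y \<notin> S \<Longrightarrow> a y = 0"
    and T: "\<And>u x. T u x - z * u x = band S (kern a \<mu> \<eta>) u x"
  shows "z \<notin> ell2_spectrum T"
proof -
  obtain B where B: "\<And>x y. y \<in> S \<Longrightarrow> cmod (kern a \<mu> \<eta> x y) \<le> B"
    using kern_bounded[OF S(1)] by blast
  have B': "cmod (kern a \<mu> \<eta> x y) \<le> max B 0" for x y
    using B[of y x] a[of y] S(2) by (cases "y \<in> S") (auto simp: kern_def)
  define S' a' where "S' = uminus ` S" and "a' = (\<lambda>y. cnj (a (- y)))"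
  have S': "finite S'" "0 \<in> S'" using S by (auto simp: S'_def image_iff intro!: bexI[of _ 0])
  have adj: "band_adj S (kern a \<mu> \<eta>) = band S' (kern a' (cnj \<mu>) (- \<eta>))"
    unfolding S'_def a'_def by (rule band_adj_kern)
  have B'': "cmod (kern a' (cnj \<mu>) (- \<eta>) x y) \<le> max B 0" for x y
  proof -
    have "kern a' (cnj \<mu>) (- \<eta>) x y = cnj (kern a \<mu> \<eta> (x + y) (- y))"
      by (auto simp: kern_def a'_def wave_minus_left)
    then show ?thesis using B'[of "x + y" "- y"] by simp
  qed
  obtain K where K: "K > 0" "\<And>u X. finite X \<Longrightarrow> (\<And>x. x \<notin> X \<Longrightarrow> u x = 0) \<Longrightarrow>
     ell2_norm u \<le> K * ell2_norm (band S (kern a \<mu> \<eta>) u)"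
    using cocycle_gap_bounded_below[OF S \<eta> gap] by blast
  have rev: "cocycle S' a' (- \<eta>) N \<theta>
      = cocycle S a \<eta> N (\<theta> - real (N - 1) *\<^sub>R \<eta>)" for \<theta>
  proof -
    have "cocycle S' a' (- \<eta>) N \<theta> = (\<Prod>k<N. cmod (symbol S a (\<theta> - real k *\<^sub>R \<eta>)))"
      by (simp add: S'_def a'_def symbol_adj)
    also have "\<dots> = cocycle S a \<eta> N (\<theta> - real (N - 1) *\<^sub>R \<eta>)"
      by (rule prod_orbit_reverse)
    finally show ?thesis .
  qed
  have gap': "(\<forall>\<theta>. cocycle S' a' (- \<eta>) N \<theta> \<le> s) \<and> 0 \<le> s \<and> s < cmod (cnj \<mu>) ^ N
      \<or> (\<forall>\<theta>. s \<le> cocycle S' a' (- \<eta>) N \<theta>) \<and> cmod (cnj \<mu>) ^ N < s"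
    unfolding rev complex_mod_cnj using gap by blast
  obtain K' where K': "K' > 0" "\<And>u X. finite X \<Longrightarrow> (\<And>x. x \<notin> X \<Longrightarrow> u x = 0) \<Longrightarrow>
     ell2_norm u \<le> K' * ell2_norm (band S' (kern a' (cnj \<mu>) (- \<eta>)) u)"
    using cocycle_gap_bounded_below[OF S' nonresonant_uminus[OF \<eta>] gap'] by blast
  define c where "c = min (1 / K) (1 / K')"
  have c: "c > 0" "c \<le> 1 / K" "c \<le> 1 / K'" using K K' by (auto simp: c_def)
  show ?thesis
  proof (rule not_in_spectrumI[OF S(1) B' c(1) _ _ T])
    fix v :: "int \<times> int \<Rightarrow> complex" assume v: "v \<in> ell2"
    have "c * ell2_norm v \<le> 1 / K * ell2_norm v" by (intro mult_right_mono c ell2_norm_nonneg)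
    also have "\<dots> \<le> ell2_norm (band S (kern a \<mu> \<eta>) v)"
      using band_bounded_below[OF S(1) B' less_imp_le[OF K(1)] K(2) v] K(1) by (simp add: field_simps)
    finally show "c * ell2_norm v \<le> ell2_norm (band S (kern a \<mu> \<eta>) v)" .
    have "c * ell2_norm v \<le> 1 / K' * ell2_norm v" by (intro mult_right_mono c ell2_norm_nonneg)
    also have "\<dots> \<le> ell2_norm (band S' (kern a' (cnj \<mu>) (- \<eta>)) v)"
      using band_bounded_below[OF S'(1) B'' less_imp_le[OF K'(1)] K'(2) v] K'(1) by (simp add: field_simps)
    finally show "c * ell2_norm v \<le> ell2_norm (band_adj S (kern a \<mu> \<eta>) v)" by (simp add: adj)
  qed
qed

section \<open>A bounded inverse controls the orbit matrices\<close>

lemma box_average_wave: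
  assumes "wave \<zeta> (1, 0) \<noteq> 1"
  shows "(\<lambda>L. (\<Sum>x\<in>{0..<int L} \<times> {0..<int L}. wave \<zeta> x) / (of_nat L)\<^sup>2) \<longlonglongrightarrow> 0"
proof -
  define A B where "A = wave \<zeta> (1, 0)" and "B = wave \<zeta> (0, 1)"
  have w: "wave \<zeta> (int m, int n) = A ^ m * B ^ n" for m n
    unfolding A_def B_def wave_def Complex.DeMoivre cis_mult
    by (rule arg_cong[where f=cis]) (simp add: algebra_simps)
  have "(\<Sum>x\<in>{0..<int L} \<times> {0..<int L}. wave \<zeta> x) = (\<Sum>m<L. A ^ m) * (\<Sum>n<L. B ^ n)" for L
  proof -
    have "{0..<int L} = int ` {..<L}"
      using image_int_atLeastLessThan[of 0 L] by (simp add: lessThan_atLeast0)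
    moreover have "(\<Sum>x\<in>{0..<int L} \<times> {0..<int L}. wave \<zeta> x) = (\<Sum>m\<in>{0..<int L}. \<Sum>n\<in>{0..<int L}. wave \<zeta> (m, n))"
      by (simp add: sum.cartesian_product)
    ultimately have "(\<Sum>x\<in>{0..<int L} \<times> {0..<int L}. wave \<zeta> x) = (\<Sum>m<L. \<Sum>n<L. wave \<zeta> (int m, int n))"
      by (simp add: sum.reindex)
    then show ?thesis by (simp add: w sum_product)
  qed
  then have eq: "(\<Sum>x\<in>{0..<int L} \<times> {0..<int L}. wave \<zeta> x) / (of_nat L)\<^sup>2
      = ((\<Sum>m<L. A ^ m) / of_nat L) * ((\<Sum>n<L. B ^ n) / of_nat L)" for L
    by (simp add: power2_eq_square)
  have "(\<lambda>L. (\<Sum>m<L. A ^ m) / of_nat L) \<longlonglongrightarrow> 0"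
    using assms by (intro geometric_average_tendsto) (auto simp: A_def)
  then have "(\<lambda>L. ((\<Sum>m<L. A ^ m) / of_nat L) * ((\<Sum>n<L. B ^ n) / of_nat L)) \<longlonglongrightarrow> 0"
  proof (rule Lim_transform_bound[rotated])
    show "\<forall>\<^sub>F L in sequentially. cmod (((\<Sum>m<L. A ^ m) / of_nat L) * ((\<Sum>n<L. B ^ n) / of_nat L))
            \<le> cmod ((\<Sum>m<L. A ^ m) / of_nat L)"
    proof (rule always_eventually, rule allI)
      fix L
      have "cmod (\<Sum>n<L. B ^ n) \<le> (\<Sum>n<L. cmod (B ^ n))" by (rule norm_sum)
      also have "\<dots> = real L" by (simp add: norm_power B_def)
      finally have "cmod ((\<Sum>n<L. B ^ n) / of_nat L) \<le> 1"
        by (cases "L = 0") (simp_all add: norm_divide)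
      then show "cmod (((\<Sum>m<L. A ^ m) / of_nat L) * ((\<Sum>n<L. B ^ n) / of_nat L))
            \<le> cmod ((\<Sum>m<L. A ^ m) / of_nat L)"
        unfolding norm_mult by (simp add: mult_left_le)
    qed
  qed
  then show ?thesis by (simp only: eq)
qed

text \<open>For distinct frequencies the geometric sum in the first coordinate stays bounded, and the one in
  the second coordinate is at most the side length, which is of smaller order than the area of the box.\<close>

lemma box_plancherel:
  assumes fin: "finite I" and sep: "\<And>k l. k \<in> I \<Longrightarrow> l \<in> I \<Longrightarrow> k \<noteq> l \<Longrightarrow> wave (t k - t l) (1, 0) \<noteq> 1"
  shows "(\<lambda>L. (\<Sum>x\<in>{0..<int L} \<times> {0..<int L}. (cmod (\<Sum>k\<in>I. c k * wave (t k) x))\<^sup>2) / (real L)\<^sup>2)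
           \<longlonglongrightarrow> (\<Sum>k\<in>I. (cmod (c k))\<^sup>2)"
proof (rule mean_square_of_orthonormal_family[OF fin])
  fix k l assume kl: "k \<in> I" "l \<in> I"
  have "(\<lambda>L. (\<Sum>x\<in>{0..<int L} \<times> {0..<int L}. wave (t k - t l) x) / (of_nat L)\<^sup>2) \<longlonglongrightarrow> (if l = k then 1 else 0)"
  proof (cases "l = k")
    case True
    have "(\<lambda>L. (\<Sum>x\<in>{0..<int L} \<times> {0..<int L}. (1::complex)) / (of_nat L)\<^sup>2) \<longlonglongrightarrow> 1"
      by (rule tendsto_eventually, rule eventually_sequentiallyI[of 1])
         (simp add: card_cartesian_product power2_eq_square)
    with True show ?thesis by simp
  next
    case False
    then show ?thesis using box_average_wave sep[OF kl] by auto
  qed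
  then show "(\<lambda>L. (\<Sum>x\<in>{0..<int L} \<times> {0..<int L}. wave (t k) x * cnj (wave (t l) x)) / of_real ((real L)\<^sup>2))
      \<longlonglongrightarrow> (if l = k then 1 else 0)"
    by (simp add: wave_diff_left)
qed

lemma boundary_layer_count:
  fixes r :: nat
  assumes "2 * r \<le> L"
  shows "real (card ({- int r..<int L + int r} \<times> {- int r..<int L + int r}
           - {int r..<int L - int r} \<times> {int r..<int L - int r})) \<le> 8 * real r * real L"
proof -
  define b where "b p q = {p..<q} \<times> {p..<q::int}" for p q
  have "card (b (- int r) (int L + int r) - b (int r) (int L - int r))
      = card (b (- int r) (int L + int r)) - card (b (int r) (int L - int r))"
    by (rule card_Diff_subset) (auto simp: b_def)
  also have "\<dots> = (L + 2 * r)\<^sup>2 - (L - 2 * r)\<^sup>2"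
    by (simp add: b_def card_cartesian_product power2_eq_square nat_diff_distrib' nat_add_distrib algebra_simps nat_mult_distrib)
  also have "\<dots> = 8 * r * L"
  proof -
    obtain m where m: "L = 2 * r + m" using assms le_Suc_ex by blast
    show ?thesis unfolding m by (simp add: power2_eq_square algebra_simps)
  qed
  finally show ?thesis unfolding b_def by simp
qed

text \<open>A uniform lower bound for the bidiagonal matrices with diagonal entries given by the symbol along an
  orbit and with \<open>\<mu>\<close> next to the diagonal. The set \<open>J\<close> contains all rows in which the image of \<open>c\<close> can be nonzero.\<close>

abbreviation packet_bound ::
    "(int \<times> int) set \<Rightarrow> (int \<times> int \<Rightarrow> complex) \<Rightarrow> complex \<Rightarrow> real \<times> real \<Rightarrow> real \<Rightarrow> bool" where
  "packet_bound S a \<mu> \<eta> K \<equiv> \<forall>\<theta> (c :: int \<Rightarrow> complex) I J. finite I \<longrightarrow> (\<forall>k. k \<notin> I \<longrightarrow> c k = 0) \<longrightarrow>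
     finite J \<longrightarrow> I \<subseteq> J \<longrightarrow> (\<lambda>k. k + 1) ` I \<subseteq> J \<longrightarrow>
     (\<Sum>k\<in>I. (cmod (c k))\<^sup>2)
       \<le> K * (\<Sum>k\<in>J. (cmod (symbol S a (\<theta> + of_int k *\<^sub>R \<eta>) * c k + \<mu> * c (k - 1)))\<^sup>2)"

text \<open>The operator maps the combination \<open>v = (\<Sum>k. c k * wave (\<theta> + k \<eta>))\<close> of plane waves to the combination whose
  coefficients are the image of \<open>c\<close> under the orbit matrix. Cut off to a box of side \<open>L\<close>, \<open>v\<close> and its image have square
  norms close to \<open>L\<^sup>2\<close> times the square norms of the coefficients, and the cut-off affects only the \<open>O(L)\<close> sites
  near the boundary.\<close>

theorem resolvent_wave_packet_bound:
  assumes z: "z \<notin> ell2_spectrum T"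
    and S: "finite S" "0 \<in> S" and \<eta>: "nonresonant \<eta>"
    and a: "\<And>y. y \<notin> S \<Longrightarrow> a y = 0"
    and T: "\<And>u x. T u x - z * u x = band S (kern a \<mu> \<eta>) u x"
  shows "\<exists>K>0. packet_bound S a \<mu> \<eta> K"
proof -
  define k where "k = kern a \<mu> \<eta>"
  have Tb: "(\<lambda>x. T u x - z * u x) = band S k u" for u by (auto simp: T k_def)
  obtain C where C: "C > 0" "\<And>u. u \<in> ell2 \<Longrightarrow> band S k u \<in> ell2 \<Longrightarrow> ell2_norm u \<le> C * ell2_norm (band S k u)"
    using not_in_spectrumD[OF z] unfolding Tb by metis
  obtain B where B0: "\<And>x y. y \<in> S \<Longrightarrow> cmod (k x y) \<le> B"
    using kern_bounded[OF S(1)] unfolding k_def by blast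
  have B: "0 \<le> B" using B0[OF S(2)] norm_ge_zero order_trans by blast
  obtain r :: nat where r: "\<And>y. y \<in> S \<Longrightarrow> \<bar>fst y\<bar> \<le> int r \<and> \<bar>snd y\<bar> \<le> int r"
  proof
    fix y assume y: "y \<in> S"
    have "nat \<bar>fst y\<bar> + nat \<bar>snd y\<bar> \<le> (\<Sum>y\<in>S. nat \<bar>fst y\<bar> + nat \<bar>snd y\<bar>)"
      using y S(1) by (intro member_le_sum[of y S "\<lambda>y. nat \<bar>fst y\<bar> + nat \<bar>snd y\<bar>"]) auto
    then show "\<bar>fst y\<bar> \<le> int (\<Sum>y\<in>S. nat \<bar>fst y\<bar> + nat \<bar>snd y\<bar>) \<and> \<bar>snd y\<bar> \<le> int (\<Sum>y\<in>S. nat \<bar>fst y\<bar> + nat \<bar>snd y\<bar>)"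
      by linarith
  qed
  show ?thesis
  proof (intro exI[of _ "C\<^sup>2"] conjI allI impI)
    show "C\<^sup>2 > 0" using C by simp
    fix \<theta> and c :: "int \<Rightarrow> complex" and I J :: "int set"
    assume I: "finite I" and I0: "\<forall>k. k \<notin> I \<longrightarrow> c k = 0" and J: "finite J" "I \<subseteq> J" "(\<lambda>k. k + 1) ` I \<subseteq> J"
    define t where "t j = \<theta> + of_int j *\<^sub>R \<eta>" for j :: int
    define d where "d j = symbol S a (t j) * c j + \<mu> * c (j - 1)" for j
    define v where "v x = (\<Sum>j\<in>I. c j * wave (t j) x)" for x
    have sep: "wave (t i - t j) (1, 0) \<noteq> 1" if "i \<noteq> j" for i j
    proof -
      have "t i - t j = of_int (i - j) *\<^sub>R \<eta>" by (simp add: t_def algebra_simps)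
      moreover have "wave (of_int (i - j) *\<^sub>R \<eta>) (1, 0) = wave \<eta> (i - j, 0)"
        unfolding wave_def by (rule arg_cong[where f=cis]) (simp add: algebra_simps)
      ultimately show ?thesis using \<eta> that by (simp add: nonresonant_def zero_prod_def)
    qed
    have bv: "band S k v x = (\<Sum>j\<in>J. d j * wave (t j) x)" for x
    proof -
      have "band S k v x = (\<Sum>y\<in>S. a y * v (x + y)) + \<mu> * wave \<eta> x * v x"
        unfolding k_def by (rule band_kern[OF S])
      also have "(\<Sum>y\<in>S. a y * v (x + y)) = (\<Sum>j\<in>I. symbol S a (t j) * c j * wave (t j) x)"
        unfolding v_def sum_distrib_left symbol_def sum_distrib_right
        by (subst sum.swap) (simp add: wave_add_right mult_ac)
      also have "\<dots> = (\<Sum>j\<in>J. symbol S a (t j) * c j * wave (t j) x)"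
        using I I0 J by (intro sum.mono_neutral_left) auto
      also have "\<mu> * wave \<eta> x * v x = (\<Sum>j\<in>I. \<mu> * c j * wave (t (j + 1)) x)"
        unfolding v_def sum_distrib_left t_def
        by (intro sum.cong refl) (simp add: wave_add_left scaleR_left_distrib mult_ac)
      also have "\<dots> = (\<Sum>j\<in>(\<lambda>k. k + 1) ` I. \<mu> * c (j - 1) * wave (t j) x)"
        by (subst sum.reindex) (auto simp: inj_on_def)
      also have "\<dots> = (\<Sum>j\<in>J. \<mu> * c (j - 1) * wave (t j) x)"
      proof (rule sum.mono_neutral_left)
        show "\<forall>j\<in>J - (\<lambda>k. k + 1) ` I. \<mu> * c (j - 1) * wave (t j) x = 0"
        proof
          fix j assume "j \<in> J - (\<lambda>k. k + 1) ` I"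
          then have "j - 1 \<notin> I" by (metis DiffD2 diff_add_cancel imageI)
          then show "\<mu> * c (j - 1) * wave (t j) x = 0" using I0 by simp
        qed
      qed (use J in auto)
      finally show ?thesis by (simp add: d_def sum.distrib distrib_right)
    qed
    define M where "M = (\<Sum>j\<in>I. cmod (c j))"
    have vM: "cmod (v x) \<le> M" for x
      unfolding v_def M_def by (rule order_trans[OF norm_sum]) (simp add: norm_mult)
    have M: "0 \<le> M" unfolding M_def by (simp add: sum_nonneg)
    define Q where "Q L = {0..<int L} \<times> {0..<int L}" for L
    \<comment> \<open>A bound for the square of the image of a cut-off packet at a site.\<close>
    define W where "W = (real (card S) * (B * M))\<^sup>2"
    have est: "(\<Sum>x\<in>Q L. (cmod (v x))\<^sup>2) \<le> C\<^sup>2 * ((\<Sum>x\<in>Q L. (cmod (band S k v x))\<^sup>2) + W * (8 * real r * real L))"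
      if L: "2 * r \<le> L" for L
    proof -
      define u where "u x = (if x \<in> Q L then v x else 0)" for x
      define Out I' where "Out = {- int r..<int L + int r} \<times> {- int r..<int L + int r}"
        and "I' = {int r..<int L - int r} \<times> {int r..<int L - int r}"
      have fin: "finite (Q L)" "finite Out" by (auto simp: Q_def Out_def)
      have u0: "u x = 0" if "x \<notin> Q L" for x using that by (simp add: u_def)
      have ul: "u \<in> ell2" by (rule ell2_finite_support[OF fin(1) u0])
      have bu0: "band S k u x = 0" if "x \<notin> Out" for x
        unfolding band_def
      proof (intro sum.neutral ballI)
        fix y assume "y \<in> S"
        from r[OF this] that have "x + y \<notin> Q L"
          by (cases x, cases y) (auto simp: Out_def Q_def)
        then show "k x y * u (x + y) = 0" by (simp add: u_def)
      qed
      have bui: "band S k u x = band S k v x" if "x \<in> I'" for x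
        unfolding band_def
      proof (intro sum.cong refl)
        fix y assume "y \<in> S"
        from r[OF this] that have "x + y \<in> Q L"
          by (cases x, cases y) (auto simp: I'_def Q_def)
        then show "k x y * u (x + y) = k x y * v (x + y)" by (simp add: u_def)
      qed
      have buM: "(cmod (band S k u x))\<^sup>2 \<le> W" for x
      proof -
        have "cmod (band S k u x) \<le> (\<Sum>y\<in>S. cmod (k x y * u (x + y)))"
          unfolding band_def by (rule norm_sum)
        also have "\<dots> \<le> (\<Sum>y\<in>S. B * M)"
          by (intro sum_mono) (auto simp: norm_mult u_def intro!: mult_mono B0 vM B M mult_nonneg_nonneg)
        finally show ?thesis unfolding W_def by (intro power_mono) auto
      qed
      have I'Out: "I' \<subseteq> Out" "I' \<subseteq> Q L" by (auto simp: I'_def Out_def Q_def)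
      have "(ell2_norm u)\<^sup>2 \<le> (C * ell2_norm (band S k u))\<^sup>2"
        using C(2)[OF ul] ell2_finite_support[OF fin(2) bu0] by (intro power_mono) (auto simp: ell2_norm_nonneg)
      also have "\<dots> = C\<^sup>2 * (\<Sum>x\<in>Out. (cmod (band S k u x))\<^sup>2)"
        by (simp add: power_mult_distrib ell2_norm_finite_support[OF fin(2) bu0])
      finally have 1: "(ell2_norm u)\<^sup>2 \<le> C\<^sup>2 * (\<Sum>x\<in>Out. (cmod (band S k u x))\<^sup>2)" .
      have 2: "(\<Sum>x\<in>Out. (cmod (band S k u x))\<^sup>2) = (\<Sum>x\<in>Out - I'. (cmod (band S k u x))\<^sup>2) + (\<Sum>x\<in>I'. (cmod (band S k u x))\<^sup>2)"
        by (rule sum.subset_diff[OF I'Out(1) fin(2)])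
      have "(\<Sum>x\<in>I'. (cmod (band S k u x))\<^sup>2) = (\<Sum>x\<in>I'. (cmod (band S k v x))\<^sup>2)"
        by (intro sum.cong refl) (simp add: bui)
      also have "\<dots> \<le> (\<Sum>x\<in>Q L. (cmod (band S k v x))\<^sup>2)"
        by (intro sum_mono2 fin I'Out) auto
      finally have 3: "(\<Sum>x\<in>I'. (cmod (band S k u x))\<^sup>2) \<le> (\<Sum>x\<in>Q L. (cmod (band S k v x))\<^sup>2)" .
      have "(\<Sum>x\<in>Out - I'. (cmod (band S k u x))\<^sup>2) \<le> (\<Sum>x\<in>Out - I'. W)"
        by (intro sum_mono buM)
      also have "(\<Sum>x\<in>Out - I'. W) = W * real (card (Out - I'))" by simp
      also have "\<dots> \<le> W * (8 * real r * real L)"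
        unfolding Out_def I'_def by (intro mult_left_mono boundary_layer_count L) (simp add: W_def)
      finally have 4: "(\<Sum>x\<in>Out - I'. (cmod (band S k u x))\<^sup>2) \<le> W * (8 * real r * real L)" .
      have "(ell2_norm u)\<^sup>2 = (\<Sum>x\<in>Q L. (cmod (u x))\<^sup>2)"
        by (rule ell2_norm_finite_support[OF fin(1) u0])
      also have "\<dots> = (\<Sum>x\<in>Q L. (cmod (v x))\<^sup>2)" by (intro sum.cong) (auto simp: u_def)
      finally have 5: "(ell2_norm u)\<^sup>2 = (\<Sum>x\<in>Q L. (cmod (v x))\<^sup>2)" .
      have "C\<^sup>2 * (\<Sum>x\<in>Out. (cmod (band S k u x))\<^sup>2)
          \<le> C\<^sup>2 * ((\<Sum>x\<in>Q L. (cmod (band S k v x))\<^sup>2) + W * (8 * real r * real L))"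
        using 2 3 4 by (intro mult_left_mono) auto
      with 1 5 show ?thesis by linarith
    qed
    have lim: "(\<lambda>L. C\<^sup>2 * ((\<Sum>x\<in>Q L. (cmod (band S k v x))\<^sup>2) / (real L)\<^sup>2 + W * 8 * real r / real L))
        \<longlonglongrightarrow> C\<^sup>2 * ((\<Sum>j\<in>J. (cmod (d j))\<^sup>2) + 0)"
      unfolding bv Q_def
      by (intro tendsto_intros box_plancherel J sep lim_const_over_n)
    have "(\<Sum>j\<in>I. (cmod (c j))\<^sup>2) \<le> C\<^sup>2 * ((\<Sum>j\<in>J. (cmod (d j))\<^sup>2) + 0)"
    proof (rule LIMSEQ_le[OF _ lim])
      show "(\<lambda>L. (\<Sum>x\<in>Q L. (cmod (v x))\<^sup>2) / (real L)\<^sup>2) \<longlonglongrightarrow> (\<Sum>j\<in>I. (cmod (c j))\<^sup>2)"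
        unfolding v_def Q_def by (intro box_plancherel I sep)
      show "\<exists>N. \<forall>L\<ge>N. (\<Sum>x\<in>Q L. (cmod (v x))\<^sup>2) / (real L)\<^sup>2
          \<le> C\<^sup>2 * ((\<Sum>x\<in>Q L. (cmod (band S k v x))\<^sup>2) / (real L)\<^sup>2 + W * 8 * real r / real L)"
      proof (intro exI[of _ "2 * r + 1"] allI impI)
        fix L assume "2 * r + 1 \<le> L"
        then have L: "2 * r \<le> L" "real L > 0" by auto
        have "(\<Sum>x\<in>Q L. (cmod (v x))\<^sup>2) / (real L)\<^sup>2
          \<le> C\<^sup>2 * ((\<Sum>x\<in>Q L. (cmod (band S k v x))\<^sup>2) + W * (8 * real r * real L)) / (real L)\<^sup>2"
          by (intro divide_right_mono est L) auto
        also have "\<dots> = C\<^sup>2 * ((\<Sum>x\<in>Q L. (cmod (band S k v x))\<^sup>2) / (real L)\<^sup>2 + W * 8 * real r / real L)"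
          using L(2) by (simp add: field_simps power2_eq_square)
        finally show "(\<Sum>x\<in>Q L. (cmod (v x))\<^sup>2) / (real L)\<^sup>2
          \<le> C\<^sup>2 * ((\<Sum>x\<in>Q L. (cmod (band S k v x))\<^sup>2) / (real L)\<^sup>2 + W * 8 * real r / real L)" .
      qed
    qed
    then show "(\<Sum>k\<in>I. (cmod (c k))\<^sup>2)
        \<le> C\<^sup>2 * (\<Sum>k\<in>J. (cmod (symbol S a (\<theta> + of_int k *\<^sub>R \<eta>) * c k + \<mu> * c (k - 1)))\<^sup>2)"
      by (simp add: d_def t_def)
  qed
qed

text \<open>In the application \<open>s n\<close> is the sum over \<open>j \<le> n\<close> of the products of \<open>\<rho>\<close> over \<open>{j<..n}\<close>. Since \<open>\<rho> (n + 1) = (s (n + 1) - 1) / s n\<close>, a product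
  of \<open>\<rho>\<close> telescopes up to factors \<open>1 - 1 / s n \<le> 1 - 1 / K\<close>.\<close>

lemma geometric_decay_from_bounded_sums:
  fixes \<rho> s :: "nat \<Rightarrow> real"
  assumes \<rho>: "\<And>k. 0 \<le> \<rho> k" and rec: "\<And>n. s (Suc n) = 1 + \<rho> (Suc n) * s n"
    and s: "\<And>n. 1 \<le> s n" "\<And>n. s n \<le> K"
  shows "(\<Prod>k<M. \<rho> (j + 1 + k)) \<le> K * (1 - 1 / K) ^ M"
proof -
  have K: "1 \<le> K" using s[of 0] by simp
  then have q: "0 \<le> 1 - 1 / K" by simp
  have "(\<Prod>k<M. \<rho> (j + 1 + k)) * s j \<le> s (j + M) * (1 - 1 / K) ^ M"
  proof (induction M)
    case (Suc M)
    have "(\<Prod>k<Suc M. \<rho> (j + 1 + k)) * s j = \<rho> (Suc (j + M)) * ((\<Prod>k<M. \<rho> (j + 1 + k)) * s j)"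
      by simp
    also have "\<dots> \<le> \<rho> (Suc (j + M)) * (s (j + M) * (1 - 1 / K) ^ M)"
      by (intro mult_left_mono Suc \<rho>)
    also have "\<dots> = (s (Suc (j + M)) - 1) * (1 - 1 / K) ^ M"
      using rec[of "j + M"] by simp
    also have "\<dots> \<le> (s (Suc (j + M)) * (1 - 1 / K)) * (1 - 1 / K) ^ M"
      using s(2)[of "Suc (j + M)"] K by (intro mult_right_mono zero_le_power q) (simp add: field_simps)
    finally show ?case by simp
  qed simp
  moreover have "(\<Prod>k<M. \<rho> (j + 1 + k)) * 1 \<le> (\<Prod>k<M. \<rho> (j + 1 + k)) * s j"
    by (intro mult_left_mono s prod_nonneg ballI \<rho>)
  moreover have "s (j + M) * (1 - 1 / K) ^ M \<le> K * (1 - 1 / K) ^ M"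
    by (intro mult_right_mono s zero_le_power q)
  ultimately show ?thesis by linarith
qed

text \<open>The backward solution of the recursion, started with the value \<open>1\<close> at step \<open>n\<close> (up to scaling), stops by itself at
  the zero of the symbol. Its image under the orbit matrix is supported in the single row \<open>n + 1\<close>, so the lower
  bound limits the sum of its squares uniformly in \<open>n\<close>, and bounded sums of this kind decay geometrically.\<close>

theorem resolvent_orbit_of_zero_decay:
  assumes z: "z \<notin> ell2_spectrum T"
    and S: "finite S" "0 \<in> S" and \<eta>: "nonresonant \<eta>"
    and a: "\<And>y. y \<notin> S \<Longrightarrow> a y = 0"
    and T: "\<And>u x. T u x - z * u x = band S (kern a \<mu> \<eta>) u x"
    and zero: "symbol S a \<theta> = 0"
  shows "\<exists>K q. 0 \<le> q \<and> q < 1 \<and> 0 < K \<and>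
    (\<forall>M j. (\<Prod>k<M. (cmod (symbol S a (\<theta> + real (j + 1 + k) *\<^sub>R \<eta>)))\<^sup>2) \<le> K * q ^ M * (cmod \<mu>) ^ (2 * M))"
proof -
  obtain C where C: "C > 0" "packet_bound S a \<mu> \<eta> C"
    using resolvent_wave_packet_bound[OF z S \<eta> a T] by blast
  define f where "f k = symbol S a (\<theta> + real k *\<^sub>R \<eta>)" for k :: nat
  have f0: "f 0 = 0" using zero by (simp add: f_def)
  define \<nu> where "\<nu> = (cmod \<mu>)\<^sup>2"
  define p where "p n j = (\<Prod>k\<in>{j<..n}. f k)" for n j :: nat
  have pS: "p (Suc n) j = f (Suc n) * p n j" if "j \<le> n" for n j
  proof -
    have "{j<..Suc n} = insert (Suc n) {j<..n}" using that by auto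
    then show ?thesis by (simp add: p_def)
  qed
  have pj: "p n j = f (Suc j) * p n (Suc j)" if "j < n" for n j
  proof -
    have "{j<..n} = insert (Suc j) {Suc j<..n}" using that by auto
    then show ?thesis by (simp add: p_def)
  qed
  have bound: "(\<Sum>j\<le>n. \<nu> ^ j * (cmod (p n j))\<^sup>2) \<le> C * \<nu> ^ Suc n" for n
  proof -
    \<comment> \<open>The backward solution, scaled by a power of \<open>\<mu>\<close> so that no division is needed when \<open>\<mu> = 0\<close>.\<close>
    define c where "c k = (if 0 \<le> k \<and> k \<le> int n then (- \<mu>) ^ nat k * p n (nat k) else 0)" for k :: int
    have im: "{0..int n} = int ` {..n}" by (auto simp: image_iff intro!: bexI[of _ "nat _"])
    have "(\<Sum>k\<in>{0..int n}. (cmod (c k))\<^sup>2)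
        \<le> C * (\<Sum>k\<in>{0..int n + 1}. (cmod (symbol S a (\<theta> + of_int k *\<^sub>R \<eta>) * c k + \<mu> * c (k - 1)))\<^sup>2)"
      by (rule C(2)[rule_format]) (auto simp: c_def)
    also have "(\<Sum>k\<in>{0..int n + 1}. (cmod (symbol S a (\<theta> + of_int k *\<^sub>R \<eta>) * c k + \<mu> * c (k - 1)))\<^sup>2)
        = (\<Sum>k\<in>{0..int n + 1}. if k = int n + 1 then \<nu> ^ Suc n else 0)"
    proof (intro sum.cong refl)
      fix k assume "k \<in> {0..int n + 1}"
      then consider "k = 0" | "0 < k" "k \<le> int n" | "k = int n + 1" by force
      then show "(cmod (symbol S a (\<theta> + of_int k *\<^sub>R \<eta>) * c k + \<mu> * c (k - 1)))\<^sup>2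
        = (if k = int n + 1 then \<nu> ^ Suc n else 0)"
      proof cases
        case 1
        then show ?thesis using zero by (simp add: c_def)
      next
        case 2
        define j where "j = nat (k - 1)"
        have j: "j < n" "k = int (Suc j)" using 2 by (auto simp: j_def)
        have "symbol S a (\<theta> + of_int k *\<^sub>R \<eta>) = f (Suc j)" unfolding j(2) f_def by simp
        moreover have "c k = (- \<mu>) ^ Suc j * p n (Suc j)" "c (k - 1) = (- \<mu>) ^ j * p n j"
          using j by (auto simp: c_def nat_add_distrib)
        ultimately have "symbol S a (\<theta> + of_int k *\<^sub>R \<eta>) * c k + \<mu> * c (k - 1) = 0"
          using pj[of j n] j(1) by simp
        then show ?thesis using 2 by simp
      next
        case 3
        then show ?thesis
          by (simp add: c_def p_def norm_mult norm_power \<nu>_def power_mult_distrib power_mult[symmetric] mult.commute)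
      qed
    qed
    also have "\<dots> = \<nu> ^ Suc n" by simp
    finally show ?thesis
      unfolding im by (simp add: sum.reindex c_def norm_mult norm_power power_mult_distrib \<nu>_def power_mult[symmetric] mult.commute)
  qed
  have \<nu>: "\<nu> > 0"
  proof (rule ccontr)
    assume "\<not> \<nu> > 0"
    then have "\<nu> = 0" by (simp add: \<nu>_def)
    then show False using bound[of 0] by (simp add: p_def)
  qed
  define \<rho> where "\<rho> k = (cmod (f k))\<^sup>2 / \<nu>" for k
  define s where "s n = (\<Sum>j\<le>n. \<nu> ^ j * (cmod (p n j))\<^sup>2) / \<nu> ^ n" for n
  have rec: "s (Suc n) = 1 + \<rho> (Suc n) * s n" for n
  proof -
    have "(\<Sum>j\<le>Suc n. \<nu> ^ j * (cmod (p (Suc n) j))\<^sup>2)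
        = \<nu> ^ Suc n + (cmod (f (Suc n)))\<^sup>2 * (\<Sum>j\<le>n. \<nu> ^ j * (cmod (p n j))\<^sup>2)"
      by (simp add: p_def[of "Suc n" "Suc n"] pS norm_mult power_mult_distrib sum_distrib_left mult_ac)
    then show ?thesis using \<nu> by (simp add: s_def \<rho>_def field_simps)
  qed
  have \<rho>0: "0 \<le> \<rho> k" for k using \<nu> by (simp add: \<rho>_def)
  have s1: "1 \<le> s n" for n
  proof (induction n)
    case 0
    then show ?case by (simp add: s_def p_def)
  next
    case (Suc n)
    then show ?case using \<rho>0[of "Suc n"] by (simp add: rec)
  qed
  have sK: "s n \<le> C * \<nu>" for n
    using bound[of n] \<nu> by (simp add: s_def field_simps)
  define K where "K = C * \<nu>"
  have K1: "1 \<le> K" using s1[of 0] sK[of 0] by (simp add: K_def)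
  show ?thesis
  proof (rule exI[of _ K], rule exI[of _ "1 - 1 / K"], intro conjI allI)
    show "0 \<le> 1 - 1 / K" "1 - 1 / K < 1" "K > 0" using K1 by auto
    fix M j
    have "(\<Prod>k<M. (cmod (f (j + 1 + k)))\<^sup>2) = (\<Prod>k<M. \<rho> (j + 1 + k)) * \<nu> ^ M"
      using \<nu> by (simp add: \<rho>_def prod_dividef)
    also have "\<dots> \<le> (K * (1 - 1 / K) ^ M) * \<nu> ^ M"
      using geometric_decay_from_bounded_sums[where \<rho>=\<rho> and s=s and K=K, OF \<rho>0 rec s1] sK \<nu>
      by (intro mult_right_mono) (auto simp: K_def)
    finally show "(\<Prod>k<M. (cmod (symbol S a (\<theta> + real (j + 1 + k) *\<^sub>R \<eta>)))\<^sup>2)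
        \<le> K * (1 - 1 / K) ^ M * cmod \<mu> ^ (2 * M)"
      by (simp add: f_def \<nu>_def power_mult)
  qed
qed

text \<open>A solution \<open>u\<close> of the homogeneous recursion, cut off to \<open>{-n..n}\<close>, has an image supported at the two ends.
  With a bounded inverse, the mass of \<open>u\<close> in the window would be bounded by the mass at its two ends, and
  would therefore grow exponentially in \<open>n\<close>; this contradicts the subexponential growth of the products.\<close>

theorem neutral_cocycle_in_spectrum:
  assumes S: "finite S" "0 \<in> S" and \<eta>: "nonresonant \<eta>"
    and a: "\<And>y. y \<notin> S \<Longrightarrow> a y = 0"
    and T: "\<And>u x. T u x - z * u x = band S (kern a \<mu> \<eta>) u x"
    and nz: "\<And>\<theta>. symbol S a \<theta> \<noteq> 0" and \<mu>: "\<mu> \<noteq> 0"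
    and subexp: "\<And>e. e > 0 \<Longrightarrow> \<exists>N. \<forall>n\<ge>N. \<forall>\<theta>.
       exp (- e * n) * cmod \<mu> ^ n \<le> cocycle S a \<eta> n \<theta> \<and>
       cocycle S a \<eta> n \<theta> \<le> exp (e * n) * cmod \<mu> ^ n"
  shows "z \<in> ell2_spectrum T"
proof (rule ccontr)
  assume z: "z \<notin> ell2_spectrum T"
  obtain C where C: "C > 0" "packet_bound S a \<mu> \<eta> C"
    using resolvent_wave_packet_bound[OF z S \<eta> a T] by blast
  define f where "f k = symbol S a (of_int k *\<^sub>R \<eta>)" for k :: int
  have f0: "f k \<noteq> 0" for k by (simp add: f_def nz)
  define u where "u k = (if 0 \<le> k then (\<Prod>j<nat k. - \<mu> / f (int j + 1)) else (\<Prod>j<nat (- k). f (- int j) / (- \<mu>)))" for k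
  have u0: "u 0 = 1" by (simp add: u_def)
  have step: "f k * u k + \<mu> * u (k - 1) = 0" for k
  proof (cases "0 < k")
    case True
    then obtain n where n: "k = int (Suc n)" using zero_less_imp_eq_int gr0_implies_Suc by (metis of_nat_0_less_iff)
    then have "u k = u (k - 1) * (- \<mu> / f k)" by (simp add: u_def nat_add_distrib add.commute)
    then show ?thesis using f0[of k] by (simp add: field_simps)
  next
    case False
    then obtain n where n: "k = - int n" by (metis linorder_not_less nonpos_int_cases)
    have "u (k - 1) = (\<Prod>j<Suc n. f (- int j) / (- \<mu>))"
      unfolding n u_def by (simp add: nat_add_distrib del: prod.lessThan_Suc)
    also have "\<dots> = u k * (f k / (- \<mu>))" unfolding n u_def by (cases "n = 0") auto
    finally show ?thesis using \<mu> by simp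
  qed
  define A where "A n = (\<Sum>k\<in>{- int n..int n}. (cmod (u k))\<^sup>2)" for n
  have AS: "A (Suc n) = A n + ((cmod (u (int (Suc n))))\<^sup>2 + (cmod (u (- int (Suc n))))\<^sup>2)" for n
  proof -
    have "{- int (Suc n)..int (Suc n)} = insert (int (Suc n)) (insert (- int (Suc n)) {- int n..int n})" by auto
    then show ?thesis by (simp add: A_def)
  qed
  define M where "M = (\<Sum>y\<in>S. cmod (a y))"
  \<comment> \<open>The summand \<open>1\<close> makes the growth factor \<open>D / (D - 1)\<close> below meaningful.\<close>
  define D where "D = C * (M\<^sup>2 + (cmod \<mu>)\<^sup>2) + 1"
  have D: "D > 1" using C \<mu> by (simp add: D_def add_nonneg_pos)
  have window: "A n \<le> D * ((cmod (u (int n)))\<^sup>2 + (cmod (u (- int n)))\<^sup>2)" for n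
  proof -
    define c where "c k = (if k \<in> {- int n..int n} then u k else 0)" for k
    have "(\<Sum>k\<in>{- int n..int n}. (cmod (c k))\<^sup>2)
      \<le> C * (\<Sum>k\<in>{- int n..int n + 1}. (cmod (symbol S a (0 + of_int k *\<^sub>R \<eta>) * c k + \<mu> * c (k - 1)))\<^sup>2)"
      by (rule C(2)[rule_format]) (auto simp: c_def)
    also have "(\<Sum>k\<in>{- int n..int n + 1}. (cmod (symbol S a (0 + of_int k *\<^sub>R \<eta>) * c k + \<mu> * c (k - 1)))\<^sup>2)
      = (\<Sum>k\<in>{- int n..int n + 1}. (if k = - int n then (cmod (f (- int n) * u (- int n)))\<^sup>2 else 0)
           + (if k = int n + 1 then (cmod (\<mu> * u (int n)))\<^sup>2 else 0))"
    proof (intro sum.cong refl)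
      fix k assume "k \<in> {- int n..int n + 1}"
      then show "(cmod (symbol S a (0 + of_int k *\<^sub>R \<eta>) * c k + \<mu> * c (k - 1)))\<^sup>2
        = (if k = - int n then (cmod (f (- int n) * u (- int n)))\<^sup>2 else 0)
           + (if k = int n + 1 then (cmod (\<mu> * u (int n)))\<^sup>2 else 0)"
        using step[of k] by (auto simp: c_def f_def)
    qed
    also have "\<dots> = (cmod (f (- int n) * u (- int n)))\<^sup>2 + (cmod (\<mu> * u (int n)))\<^sup>2"
      by (simp add: sum.distrib)
    also have "\<dots> \<le> (M\<^sup>2 + (cmod \<mu>)\<^sup>2) * ((cmod (u (int n)))\<^sup>2 + (cmod (u (- int n)))\<^sup>2)"
    proof -
      have "(cmod (f (- int n)))\<^sup>2 * (cmod (u (- int n)))\<^sup>2 \<le> M\<^sup>2 * (cmod (u (- int n)))\<^sup>2"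
        using symbol_bounded[of S a] by (intro mult_right_mono power_mono) (auto simp: f_def M_def)
      moreover have "0 \<le> M\<^sup>2 * (cmod (u (int n)))\<^sup>2" "0 \<le> (cmod \<mu>)\<^sup>2 * (cmod (u (- int n)))\<^sup>2" by auto
      ultimately show ?thesis unfolding norm_mult power_mult_distrib distrib_left distrib_right by linarith
    qed
    finally have "A n \<le> C * ((M\<^sup>2 + (cmod \<mu>)\<^sup>2) * ((cmod (u (int n)))\<^sup>2 + (cmod (u (- int n)))\<^sup>2))"
      using C(1) by (simp add: A_def c_def)
    also have "\<dots> \<le> D * ((cmod (u (int n)))\<^sup>2 + (cmod (u (- int n)))\<^sup>2)"
      unfolding D_def mult.assoc[symmetric] by (intro mult_right_mono) auto
    finally show ?thesis .
  qed
  define Q where "Q = D / (D - 1)"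
  have Q: "Q > 1" using D by (simp add: Q_def)
  have grow: "Q ^ n \<le> A n" for n
  proof (induction n)
    case 0
    then show ?case by (simp add: A_def u0)
  next
    case (Suc n)
    have "A (Suc n) \<le> D * (A (Suc n) - A n)" using window[of "Suc n"] AS[of n] by simp
    then have "D * A n \<le> (D - 1) * A (Suc n)" by (simp add: algebra_simps)
    then have "Q * A n \<le> A (Suc n)" using D by (simp add: Q_def field_simps)
    moreover have "Q ^ Suc n \<le> Q * A n" using Suc Q by simp
    ultimately show ?case by linarith
  qed
  \<comment> \<open>With this rate the square of the solution grows at most like \<open>sqrt Q ^ n\<close>, slower than \<open>Q ^ n\<close>.\<close>
  define e where "e = ln Q / 4"
  have e: "e > 0" using Q by (simp add: e_def)
  obtain N where N: "\<And>n \<theta>. n \<ge> N \<Longrightarrow> exp (- e * n) * cmod \<mu> ^ n \<le> cocycle S a \<eta> n \<theta>"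
      "\<And>n \<theta>. n \<ge> N \<Longrightarrow> cocycle S a \<eta> n \<theta> \<le> exp (e * n) * cmod \<mu> ^ n"
    using subexp[OF e] by blast
  have small: "cmod (u (int n)) \<le> exp (e * n)" "cmod (u (- int n)) \<le> exp (e * n)" if n: "n \<ge> N" for n
  proof -
    define P where "P \<theta> = cocycle S a \<eta> n \<theta>" for \<theta>
    have P: "exp (- e * n) * cmod \<mu> ^ n \<le> P \<theta>" "P \<theta> \<le> exp (e * n) * cmod \<mu> ^ n" for \<theta>
      unfolding P_def using N n by blast+
    have P0: "P \<theta> > 0" for \<theta> unfolding P_def by (intro prod_pos) (simp add: nz)
    have "cmod (u (int n)) = cmod \<mu> ^ n / P \<eta>"
      by (simp add: u_def P_def prod_norm[symmetric] prod_dividef norm_divide norm_power f_def scaleR_left_distrib add.commute)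
    also have "\<dots> \<le> exp (e * n)"
      using P(1)[of \<eta>] P0[of \<eta>] by (simp add: field_simps exp_minus)
    finally show "cmod (u (int n)) \<le> exp (e * n)" .
    have "cmod (u (- int n)) = (\<Prod>k<n. cmod (symbol S a (0 - real k *\<^sub>R \<eta>))) / cmod \<mu> ^ n"
      by (cases "n = 0") (auto simp: u_def prod_dividef norm_divide norm_power f_def prod_norm[symmetric])
    also have "(\<Prod>k<n. cmod (symbol S a (0 - real k *\<^sub>R \<eta>))) = P (0 - real (n - 1) *\<^sub>R \<eta>)"
      unfolding P_def by (rule prod_orbit_reverse)
    also have "\<dots> / cmod \<mu> ^ n \<le> exp (e * n)"
      using P(2) \<mu> by (simp add: field_simps)
    finally show "cmod (u (- int n)) \<le> exp (e * n)" .
  qed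
  have "Q ^ n \<le> 2 * D * sqrt Q ^ n" if n: "n \<ge> N" for n
  proof -
    have ee: "(exp (e * n))\<^sup>2 = sqrt Q ^ n"
    proof -
      have "(exp (e * n))\<^sup>2 = exp (real n * (2 * e))"
        by (simp add: power2_eq_square exp_add[symmetric])
      also have "\<dots> = exp (2 * e) ^ n" by (simp add: exp_of_nat_mult)
      also have "exp (2 * e) = sqrt Q"
        using Q by (simp add: e_def ln_sqrt[symmetric] exp_ln)
      finally show ?thesis .
    qed
    have "Q ^ n \<le> D * ((cmod (u (int n)))\<^sup>2 + (cmod (u (- int n)))\<^sup>2)"
      using grow[of n] window[of n] by linarith
    also have "\<dots> \<le> D * ((exp (e * n))\<^sup>2 + (exp (e * n))\<^sup>2)"
      using D small[OF n] by (intro mult_left_mono add_mono power_mono) auto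
    finally show ?thesis by (simp add: ee)
  qed
  moreover have "Q ^ n = sqrt Q ^ n * sqrt Q ^ n" for n
    using Q by (simp add: power_mult_distrib[symmetric])
  moreover have "sqrt Q ^ n > 0" for n using Q by simp
  ultimately have "sqrt Q ^ n \<le> 2 * D" if "n \<ge> N" for n
    using that mult_le_cancel_right_pos[of "sqrt Q ^ n" "sqrt Q ^ n" "2 * D"] by simp
  moreover obtain n where n: "2 * D < sqrt Q ^ n"
    using real_arch_pow[of "sqrt Q"] Q by auto
  moreover have "sqrt Q ^ n \<le> sqrt Q ^ (n + N)"
    using Q by (intro power_increasing) auto
  ultimately show False by (meson le_add2 linorder_not_less order_trans)
qed

section \<open>Uniform equidistribution on the torus\<close>

definition torus :: "(complex \<times> complex) set" where
  "torus = sphere 0 1 \<times> sphere 0 1"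

text \<open>Continuity on the torus is expressed through functions of a pair of unit complex numbers; periodicity is
  then automatic and the torus is a compact subset of a Euclidean space.\<close>

definition torus_point :: "real \<times> real \<Rightarrow> complex \<times> complex" where
  "torus_point \<theta> = (cis (2 * pi * fst \<theta>), cis (2 * pi * snd \<theta>))"

abbreviation orbit_sum :: "(complex \<times> complex \<Rightarrow> real) \<Rightarrow> real \<times> real \<Rightarrow> nat \<Rightarrow> real \<times> real \<Rightarrow> real" where
  "orbit_sum G \<eta> N \<theta> \<equiv> (\<Sum>j<N. G (torus_point (\<theta> + real j *\<^sub>R \<eta>)))"

lemma torus_point_in_torus [simp]: "torus_point \<theta> \<in> torus"
  by (simp add: torus_point_def torus_def)

lemma torus_point_frac: "torus_point (frac (fst \<theta>), frac (snd \<theta>)) = torus_point \<theta>"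
proof -
  have "cis (2 * pi * t) = cis (2 * pi * frac t)" for t
  proof -
    have "cis (2 * pi * t) = cis (2 * pi * frac t) * cis (2 * pi * of_int \<lfloor>t\<rfloor>)"
      by (simp add: cis_mult frac_def algebra_simps)
    then show ?thesis by (simp add: cis_multiple_2pi)
  qed
  then show ?thesis by (simp add: torus_point_def)
qed

lemma compact_torus: "compact torus"
  unfolding torus_def by (intro compact_Times) auto

lemma continuous_on_torus_point [continuous_intros]:
  "continuous_on A f \<Longrightarrow> continuous_on A (\<lambda>x. torus_point (f x))"
  unfolding torus_point_def by (intro continuous_intros)

lemma continuous_on_torus_comp:
  assumes "continuous_on torus G"
  shows "continuous_on A (\<lambda>\<theta>. G (torus_point \<theta>))"
  by (rule continuous_on_compose2[OF assms]) (auto intro!: continuous_intros)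

text \<open>Frequencies may be repeated in a sum of this kind, so closure under addition needs no normal form.\<close>

inductive_set trig_polys :: "(real \<times> real \<Rightarrow> complex) set" where
  monomial: "(\<lambda>\<theta>. c * wave \<theta> x) \<in> trig_polys"
| plus: "p \<in> trig_polys \<Longrightarrow> q \<in> trig_polys \<Longrightarrow> (\<lambda>\<theta>. p \<theta> + q \<theta>) \<in> trig_polys"

lemma trig_polys_const: "(\<lambda>\<theta>. c) \<in> trig_polys"
  using trig_polys.monomial[of c 0] by simp

lemma trig_polys_mult:
  assumes "p \<in> trig_polys" "q \<in> trig_polys"
  shows "(\<lambda>\<theta>. p \<theta> * q \<theta>) \<in> trig_polys"
  using assms
proof (induction p rule: trig_polys.induct)
  case (monomial c x)
  from monomial show ?case
  proof (induction q rule: trig_polys.induct)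
    case (monomial d y)
    have "(\<lambda>\<theta>. c * wave \<theta> x * (d * wave \<theta> y)) = (\<lambda>\<theta>. (c * d) * wave \<theta> (x + y))"
      by (simp add: wave_add_right fun_eq_iff)
    then show ?case by (simp only: trig_polys.monomial)
  next
    case (plus p q)
    then show ?case by (simp add: distrib_left trig_polys.plus)
  qed
next
  case (plus p p')
  then show ?case by (simp add: distrib_right trig_polys.plus)
qed

lemma trig_polys_coordinates:
  "(\<lambda>\<theta>. complex_of_real (Re (fst (torus_point \<theta>)))) \<in> trig_polys"
  "(\<lambda>\<theta>. complex_of_real (Im (fst (torus_point \<theta>)))) \<in> trig_polys"
  "(\<lambda>\<theta>. complex_of_real (Re (snd (torus_point \<theta>)))) \<in> trig_polys"
  "(\<lambda>\<theta>. complex_of_real (Im (snd (torus_point \<theta>)))) \<in> trig_polys"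
proof -
  have *: "(\<lambda>\<theta>. c * wave \<theta> x + d * cnj (wave \<theta> x)) \<in> trig_polys" for c d x
    using trig_polys.plus[OF trig_polys.monomial[of c x] trig_polys.monomial[of d "- x"]]
    by (simp add: wave_minus_right)
  have Re: "complex_of_real (Re w) = (1/2) * w + (1/2) * cnj w" for w
    using complex_add_cnj[of w] by (simp add: field_simps)
  have Im: "complex_of_real (Im w) = (1/(2*\<i>)) * w + (- 1/(2*\<i>)) * cnj w" for w
    using complex_diff_cnj[of w] by (simp add: field_simps)
  have fst: "fst (torus_point \<theta>) = wave \<theta> (0, 1)" and snd: "snd (torus_point \<theta>) = wave \<theta> (-1, 0)" for \<theta>
    by (simp_all add: torus_point_def wave_def)
  show "(\<lambda>\<theta>. complex_of_real (Re (fst (torus_point \<theta>)))) \<in> trig_polys"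
    "(\<lambda>\<theta>. complex_of_real (Im (fst (torus_point \<theta>)))) \<in> trig_polys"
    "(\<lambda>\<theta>. complex_of_real (Re (snd (torus_point \<theta>)))) \<in> trig_polys"
    "(\<lambda>\<theta>. complex_of_real (Im (snd (torus_point \<theta>)))) \<in> trig_polys"
    unfolding Re Im fst snd by (rule *)+
qed

text \<open>This turns the polynomials of the Stone-Weierstrass theorem into trigonometric polynomials.\<close>

lemma real_polynomial_trig_poly:
  fixes G :: "complex \<times> complex \<Rightarrow> real"
  assumes "real_polynomial_function G"
  shows "(\<lambda>\<theta>. complex_of_real (G (torus_point \<theta>))) \<in> trig_polys"
  using assms
proof (induction G rule: real_polynomial_function.induct)
  case (linear f)
  then interpret f: bounded_linear f .
  have f: "f w = f (1, 0) * Re (fst w) + f (\<i>, 0) * Im (fst w) + f (0, 1) * Re (snd w) + f (0, \<i>) * Im (snd w)" for w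
  proof -
    have "w = Re (fst w) *\<^sub>R (1, 0) + Im (fst w) *\<^sub>R (\<i>, 0) + Re (snd w) *\<^sub>R (0, 1) + Im (snd w) *\<^sub>R (0, \<i>)"
      by (cases w) (auto simp: complex_eq_iff)
    then have "f w = f (Re (fst w) *\<^sub>R (1, 0) + Im (fst w) *\<^sub>R (\<i>, 0) + Re (snd w) *\<^sub>R (0, 1) + Im (snd w) *\<^sub>R (0, \<i>))"
      by (rule arg_cong)
    then show ?thesis by (simp only: f.add f.scaleR real_scaleR_def mult.commute)
  qed
  show ?case
    by (subst f) (simp only: of_real_add of_real_mult,
      intro trig_polys.plus trig_polys_mult trig_polys_const trig_polys_coordinates)
next
  case (const c)
  then show ?case by (rule trig_polys_const)
next
  case (add f g)
  then show ?case by (simp add: trig_polys.plus)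
next
  case (mult f g)
  then show ?case by (simp add: trig_polys_mult)
qed

lemma integral_cis_periods:
  assumes "k \<noteq> 0"
  shows "integral {0..1} (\<lambda>t. cis (2 * pi * (of_int k * t + b))) = 0"
proof -
  define F where "F t = cis (2 * pi * (of_int k * t + b)) / (2 * pi * of_int k * \<i>)" for t :: real
  have "((\<lambda>t. cis (2 * pi * (of_int k * t + b))) has_integral (F 1 - F 0)) {0..1}"
  proof (rule fundamental_theorem_of_calculus)
    fix t :: real
    show "(F has_vector_derivative cis (2 * pi * (of_int k * t + b))) (at t within {0..1})"
    proof -
      define Fc :: "complex \<Rightarrow> complex" where "Fc w = exp (\<i> * (of_real (2 * pi) * (of_int k * w + of_real b))) / (of_real (2 * pi) * of_int k * \<i>)" for w :: complex
      have "(Fc has_field_derivative exp (\<i> * (of_real (2 * pi) * (of_int k * of_real t + of_real b)))) (at (of_real t))"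
        unfolding Fc_def using assms by (auto intro!: derivative_eq_intros)
      then have "((\<lambda>x. Fc (of_real x)) has_vector_derivative exp (\<i> * (of_real (2 * pi) * (of_int k * of_real t + of_real b)))) (at t within {0..1})"
        by (rule has_vector_derivative_real_field)
      then show ?thesis by (simp add: F_def[abs_def] Fc_def cis_conv_exp)
    qed
  qed auto
  moreover have "F 1 = F 0"
  proof -
    have "cis (2 * pi * (of_int k * 1 + b)) = cis (2 * pi * of_int k) * cis (2 * pi * (of_int k * 0 + b))"
      by (simp add: cis_mult algebra_simps)
    also have "cis (2 * pi * of_int k) = 1" by (simp add: cis_multiple_2pi)
    finally show ?thesis by (simp add: F_def)
  qed
  ultimately show ?thesis by (simp add: integral_unique)
qed

lemma continuous_on_wave [continuous_intros]:
  "continuous_on A f \<Longrightarrow> continuous_on A (\<lambda>t. wave (f t) x)"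
  unfolding wave_def by (intro continuous_intros)

text \<open>The Haar integral of a function given on a fundamental domain.\<close>

definition torus_mean :: "(real \<times> real \<Rightarrow> 'a::euclidean_space) \<Rightarrow> 'a" where
  "torus_mean F = integral (cbox (0, 0) (1, 1)) F"

lemma torus_mean_wave: "torus_mean (\<lambda>\<theta>. wave \<theta> x) = (if x = 0 then 1 else 0)"
proof -
  obtain m n where x: "x = (m, n)" by (cases x)
  have "torus_mean (\<lambda>\<theta>. wave \<theta> x) = integral {0..1} (\<lambda>s. integral {0..1} (\<lambda>t. wave (s, t) x))"
    unfolding torus_mean_def by (subst integral_prod_continuous) (auto intro!: continuous_intros)
  also have "\<dots> = (if x = 0 then 1 else 0)"
  proof (cases "m = 0")
    case False
    have "integral {0..1} (\<lambda>t. wave (s, t) x) = 0" for s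
      using integral_cis_periods[of "- m" "of_int n * s"] False by (simp add: wave_def x)
    then show ?thesis using False by (simp add: x zero_prod_def)
  next
    case True
    have "integral {0..1} (\<lambda>t. wave (s, t) x) = wave (s, 0) x" for s
      using True by (simp add: wave_def x)
    then have "integral {0..1} (\<lambda>s. integral {0..1} (\<lambda>t. wave (s, t) x)) = integral {0..1} (\<lambda>s. wave (s, 0) x)"
      by simp
    also have "\<dots> = (if x = 0 then 1 else 0)"
      using integral_cis_periods[of n 0] True by (cases "n = 0") (auto simp: wave_def x zero_prod_def)
    finally show ?thesis .
  qed
  finally show ?thesis .
qed

lemma continuous_on_trig_poly: "p \<in> trig_polys \<Longrightarrow> continuous_on A p"
  by (induction rule: trig_polys.induct) (intro continuous_intros; assumption)+

text \<open>For a single plane wave the average is a geometric sum whose size does not depend on the starting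
  point; this is the source of uniformity.\<close>

lemma trig_poly_uniform_average:
  assumes \<eta>: "nonresonant \<eta>" and "p \<in> trig_polys" "e > 0"
  shows "\<exists>N0. \<forall>N\<ge>N0. \<forall>\<theta>. cmod ((\<Sum>j<N. p (\<theta> + real j *\<^sub>R \<eta>)) / of_nat N - torus_mean p) < e"
  using assms(2,3)
proof (induction arbitrary: e rule: trig_polys.induct)
  case (monomial c x)
  have mean: "torus_mean (\<lambda>\<theta>. c * wave \<theta> x) = c * (if x = 0 then 1 else 0)"
    using torus_mean_wave[of x] unfolding torus_mean_def by simp
  show ?case
  proof (cases "x = 0")
    case True
    have "cmod ((\<Sum>j<N. c * wave (\<theta> + real j *\<^sub>R \<eta>) x) / of_nat N - torus_mean (\<lambda>\<theta>. c * wave \<theta> x)) < e"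
      if "N \<ge> 1" for N \<theta>
      unfolding mean using True that monomial by simp
    then show ?thesis by blast
  next
    case False
    define B where "B = cmod c * (2 / cmod (wave \<eta> x - 1))"
    have w1: "wave \<eta> x \<noteq> 1" using \<eta> False unfolding nonresonant_def by blast
    obtain N0 :: nat where N0: "N0 > 0" "B / real N0 < e"
    proof -
      obtain n :: nat where "B / e < real n" using reals_Archimedean2 by blast
      then have "B / e < real (Suc n)" by simp
      then have "B / real (Suc n) < e" using monomial by (simp add: field_simps)
      then show ?thesis using that[of "Suc n"] by simp
    qed
    have "cmod ((\<Sum>j<N. c * wave (\<theta> + real j *\<^sub>R \<eta>) x) / of_nat N - torus_mean (\<lambda>\<theta>. c * wave \<theta> x)) < e"
      if "N \<ge> N0" for N \<theta>
    proof -
      have "(\<Sum>j<N. c * wave (\<theta> + real j *\<^sub>R \<eta>) x) / of_nat N = c * wave \<theta> x * ((\<Sum>j<N. wave \<eta> x ^ j) / of_nat N)"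
        by (simp add: wave_add_left wave_scaleR sum_distrib_left mult.assoc)
      then have "cmod ((\<Sum>j<N. c * wave (\<theta> + real j *\<^sub>R \<eta>) x) / of_nat N - torus_mean (\<lambda>\<theta>. c * wave \<theta> x))
         = cmod c * cmod ((\<Sum>j<N. wave \<eta> x ^ j) / of_nat N)"
        unfolding mean using False by (simp add: norm_mult del: times_divide_eq_right)
      also have "\<dots> \<le> cmod c * (2 / cmod (wave \<eta> x - 1) / real N)"
        by (intro mult_left_mono norm_geometric_average_le w1) auto
      also have "\<dots> = B / real N" by (simp add: B_def)
      also have "\<dots> \<le> B / real N0"
        using that N0 by (intro divide_left_mono) (auto simp: B_def)
      finally show ?thesis using N0 by simp
    qed
    then show ?thesis by blast
  qed
next
  case (plus p q)
  have mean: "torus_mean (\<lambda>\<theta>. p \<theta> + q \<theta>) = torus_mean p + torus_mean q"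
    unfolding torus_mean_def
    by (intro integral_add integrable_continuous continuous_on_trig_poly plus)
  obtain N1 where N1: "\<forall>N\<ge>N1. \<forall>\<theta>. cmod ((\<Sum>j<N. p (\<theta> + real j *\<^sub>R \<eta>)) / of_nat N - torus_mean p) < e / 2"
    using plus.IH(1)[of "e / 2"] plus.prems by auto
  obtain N2 where N2: "\<forall>N\<ge>N2. \<forall>\<theta>. cmod ((\<Sum>j<N. q (\<theta> + real j *\<^sub>R \<eta>)) / of_nat N - torus_mean q) < e / 2"
    using plus.IH(2)[of "e / 2"] plus.prems by auto
  have "cmod ((\<Sum>j<N. p (\<theta> + real j *\<^sub>R \<eta>) + q (\<theta> + real j *\<^sub>R \<eta>)) / of_nat N - torus_mean (\<lambda>\<theta>. p \<theta> + q \<theta>)) < e"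
    if "N \<ge> max N1 N2" for N \<theta>
  proof -
    have "(\<Sum>j<N. p (\<theta> + real j *\<^sub>R \<eta>) + q (\<theta> + real j *\<^sub>R \<eta>)) / of_nat N - torus_mean (\<lambda>\<theta>. p \<theta> + q \<theta>)
      = ((\<Sum>j<N. p (\<theta> + real j *\<^sub>R \<eta>)) / of_nat N - torus_mean p) + ((\<Sum>j<N. q (\<theta> + real j *\<^sub>R \<eta>)) / of_nat N - torus_mean q)"
      unfolding mean by (simp add: sum.distrib add_divide_distrib)
    moreover have "cmod ((\<Sum>j<N. p (\<theta> + real j *\<^sub>R \<eta>)) / of_nat N - torus_mean p) < e / 2"
      using N1[rule_format, of N \<theta>] that by simp
    moreover have "cmod ((\<Sum>j<N. q (\<theta> + real j *\<^sub>R \<eta>)) / of_nat N - torus_mean q) < e / 2"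
      using N2[rule_format, of N \<theta>] that by simp
    ultimately show ?thesis
      using norm_triangle_ineq[of "(\<Sum>j<N. p (\<theta> + real j *\<^sub>R \<eta>)) / of_nat N - torus_mean p"
          "(\<Sum>j<N. q (\<theta> + real j *\<^sub>R \<eta>)) / of_nat N - torus_mean q"] by simp
  qed
  then show ?case by blast
qed

lemma torus_mean_mono:
  fixes F G :: "real \<times> real \<Rightarrow> real"
  assumes "continuous_on UNIV F" "continuous_on UNIV G" "\<And>\<theta>. F \<theta> \<le> G \<theta>"
  shows "torus_mean F \<le> torus_mean G"
  unfolding torus_mean_def
  by (intro integral_le integrable_continuous assms continuous_on_subset[OF assms(1)] continuous_on_subset[OF assms(2)]) auto

lemma torus_mean_const: "torus_mean (\<lambda>\<theta>. c) = (c :: real)"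
  unfolding torus_mean_def by (simp add: content_Pair)

theorem weyl_equidistribution_uniform:
  fixes G :: "complex \<times> complex \<Rightarrow> real"
  assumes \<eta>: "nonresonant \<eta>" and G: "continuous_on torus G" and e: "e > 0"
  shows "\<exists>N0. \<forall>N\<ge>N0. \<forall>\<theta>. \<bar>orbit_sum G \<eta> N \<theta> / real N
            - torus_mean (\<lambda>\<theta>. G (torus_point \<theta>))\<bar> < e"
proof -
  have e3: "e / 3 > 0" using e by simp
  obtain g where g: "real_polynomial_function g" "\<And>w. w \<in> torus \<Longrightarrow> \<bar>G w - g w\<bar> < e / 3"
    using Stone_Weierstrass_real_polynomial_function[OF compact_torus G e3] by blast
  define p where "p \<theta> = complex_of_real (g (torus_point \<theta>))" for \<theta>
  define M where "M = torus_mean (\<lambda>\<theta>. G (torus_point \<theta>))"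
  define m where "m = torus_mean (\<lambda>\<theta>. g (torus_point \<theta>))"
  have p: "p \<in> trig_polys" unfolding p_def by (rule real_polynomial_trig_poly[OF g(1)])
  have cg: "continuous_on torus g"
    using continuous_real_polymonial_function[OF g(1)] by (simp add: continuous_at_imp_continuous_on)
  note cG' = continuous_on_torus_comp[OF G] and cg' = continuous_on_torus_comp[OF cg]
  have pm: "torus_mean p = complex_of_real m"
    using integral_linear[OF integrable_continuous[OF cg'] bounded_linear_of_real]
    unfolding p_def m_def torus_mean_def by (simp add: o_def)
  obtain N0 where N0: "\<forall>N\<ge>N0. \<forall>\<theta>. cmod ((\<Sum>j<N. p (\<theta> + real j *\<^sub>R \<eta>)) / of_nat N - torus_mean p) < e / 3"
    using trig_poly_uniform_average[OF \<eta> p e3] by blast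
  have Mm: "\<bar>M - m\<bar> \<le> e / 3"
  proof -
    have b: "G (torus_point \<theta>) \<le> g (torus_point \<theta>) + e / 3" "g (torus_point \<theta>) \<le> G (torus_point \<theta>) + e / 3" for \<theta>
      using g(2)[OF torus_point_in_torus, of \<theta>] unfolding abs_less_iff by linarith+
    have "M \<le> torus_mean (\<lambda>\<theta>. g (torus_point \<theta>) + e / 3)"
      unfolding M_def by (intro torus_mean_mono cG' continuous_intros cg' b)
    also have "\<dots> = m + e / 3"
      using torus_mean_const[of "e / 3"] unfolding m_def torus_mean_def
      by (subst integral_add) (auto intro!: integrable_continuous cg')
    finally have 1: "M \<le> m + e / 3" .
    have "m \<le> torus_mean (\<lambda>\<theta>. G (torus_point \<theta>) + e / 3)"
      unfolding m_def by (intro torus_mean_mono cG' continuous_intros cg' b)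
    also have "\<dots> = M + e / 3"
      using torus_mean_const[of "e / 3"] unfolding M_def torus_mean_def
      by (subst integral_add) (auto intro!: integrable_continuous cG')
    finally show ?thesis using 1 by linarith
  qed
  have "\<bar>orbit_sum G \<eta> N \<theta> / real N - M\<bar> < e" if N: "N \<ge> max N0 1" for N \<theta>
  proof -
    have eq: "(\<Sum>j<N. p (\<theta> + real j *\<^sub>R \<eta>)) / of_nat N - torus_mean p
      = complex_of_real (orbit_sum g \<eta> N \<theta> / real N - m)"
      unfolding pm by (simp add: p_def)
    have "N0 \<le> N" using N by simp
    then have 1: "\<bar>orbit_sum g \<eta> N \<theta> / real N - m\<bar> < e / 3"
      using N0[rule_format, of N \<theta>] by (simp only: eq norm_of_real)
    have "\<bar>orbit_sum G \<eta> N \<theta> - orbit_sum g \<eta> N \<theta>\<bar> \<le> (\<Sum>j<N. e / 3)"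
      unfolding sum_subtractf[symmetric]
      by (rule order_trans[OF sum_abs]) (intro sum_mono less_imp_le g(2) torus_point_in_torus)
    then have "\<bar>orbit_sum G \<eta> N \<theta> / real N - orbit_sum g \<eta> N \<theta> / real N\<bar> \<le> e / 3"
      using N by (simp add: diff_divide_distrib[symmetric] field_simps)
    then show ?thesis using 1 Mm by linarith
  qed
  then show ?thesis unfolding M_def by blast
qed

text \<open>Density of forward orbits: the average of the excess of \<open>G\<close> over \<open>B\<close> vanishes along one orbit, hence the
  excess has mean zero, and a nonnegative continuous function with mean zero vanishes.\<close>

lemma orbit_bound_extends:
  fixes G :: "complex \<times> complex \<Rightarrow> real"
  assumes \<eta>: "nonresonant \<eta>" and G: "continuous_on torus G"
    and le: "\<And>j. G (torus_point (\<theta> + real j *\<^sub>R \<eta>)) \<le> B"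
  shows "G (torus_point \<phi>) \<le> B"
proof -
  define H where "H w = max (G w - B) 0" for w
  have H: "continuous_on torus H" unfolding H_def by (intro continuous_intros G)
  have H0: "H (torus_point (\<theta> + real j *\<^sub>R \<eta>)) = 0" for j using le[of j] by (simp add: H_def)
  have "\<bar>torus_mean (\<lambda>\<theta>. H (torus_point \<theta>))\<bar> < e" if "e > 0" for e
    using weyl_equidistribution_uniform[OF \<eta> H that] H0 by (metis (no_types, lifting) abs_minus_commute diff_zero div_0 order_refl sum.neutral)
  then have "torus_mean (\<lambda>\<theta>. H (torus_point \<theta>)) = 0"
    by (metis abs_le_zero_iff dense_ge less_eq_real_def zero_less_abs_iff)
  moreover have cH: "continuous_on (cbox (0, 0) (1, 1)) (\<lambda>\<theta>. H (torus_point \<theta>))"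
    by (rule continuous_on_torus_comp[OF H])
  ultimately have hi: "((\<lambda>\<theta>. H (torus_point \<theta>)) has_integral 0) (cbox (0, 0) (1, 1))"
    unfolding torus_mean_def by (metis integrable_continuous integrable_integral)
  define \<psi> where "\<psi> = (frac (fst \<phi>), frac (snd \<phi>))"
  have "torus_point \<phi> = torus_point \<psi>"
    unfolding \<psi>_def by (rule torus_point_frac[symmetric])
  moreover have "H (torus_point \<psi>) = 0"
  proof (rule has_integral_0_cbox_imp_0[OF cH _ hi])
    show "\<psi> \<in> cbox (0, 0) (1, 1)"
      by (simp add: \<psi>_def less_imp_le[OF frac_lt_1])
  qed (auto simp: H_def box_ne_empty Basis_prod_def)
  ultimately show ?thesis by (simp add: H_def max_def split: if_splits)
qed

section \<open>An ellipse swept along a segment\<close>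

text \<open>Its unit circle is the ellipse traced by \<open>exp (- g) * x + exp g / x\<close> on \<open>\<bar>x\<bar> = 1\<close>.\<close>

definition ellipse_norm :: "real \<Rightarrow> complex \<Rightarrow> real" where
  "ellipse_norm g w = cmod (Complex (Re w / (exp g + exp (- g))) (Im w / (exp g - exp (- g))))"

text \<open>The sum of the filled ellipse and the segment from \<open>-2\<close> to \<open>2\<close>.\<close>

definition filled_set :: "real \<Rightarrow> complex set" where
  "filled_set g = {z. \<exists>t\<in>{-2..2}. ellipse_norm g (z - of_real t) \<le> 1}"

text \<open>The equation \<open>exp (- g) * x + exp g / x = w\<close>, multiplied by \<open>x\<close>.\<close>

abbreviation joukowski_poly :: "real \<Rightarrow> complex \<Rightarrow> complex \<Rightarrow> complex" where
  "joukowski_poly g w x \<equiv> of_real (exp (- g)) * x\<^sup>2 - w * x + of_real (exp g)"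

lemma exp_gt_exp_minus: "g > 0 \<Longrightarrow> exp (- g) < exp (g::real)"
  by simp

lemma ellipse_norm_add: "ellipse_norm g (v + w) \<le> ellipse_norm g v + ellipse_norm g w"
proof -
  have "Complex (Re (v + w) / (exp g + exp (- g))) (Im (v + w) / (exp g - exp (- g)))
    = Complex (Re v / (exp g + exp (- g))) (Im v / (exp g - exp (- g)))
      + Complex (Re w / (exp g + exp (- g))) (Im w / (exp g - exp (- g)))"
    by (simp add: complex_eq_iff add_divide_distrib)
  then show ?thesis unfolding ellipse_norm_def by (metis norm_triangle_ineq)
qed

lemma ellipse_norm_scale: "ellipse_norm g (of_real c * w) = \<bar>c\<bar> * ellipse_norm g w"
proof -
  have "Complex (Re (of_real c * w) / (exp g + exp (- g))) (Im (of_real c * w) / (exp g - exp (- g)))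
    = of_real c * Complex (Re w / (exp g + exp (- g))) (Im w / (exp g - exp (- g)))"
    by (simp add: complex_eq_iff)
  then show ?thesis unfolding ellipse_norm_def by (simp add: norm_mult)
qed

lemma continuous_on_ellipse_norm [continuous_intros]:
  "continuous_on A f \<Longrightarrow> continuous_on A (\<lambda>x. ellipse_norm g (f x))"
  unfolding ellipse_norm_def Complex_eq divide_inverse by (intro continuous_intros)

text \<open>On the circle of radius \<open>\<rho>\<close> the map \<open>x \<mapsto> exp (- g) * x + exp g / x\<close> traces an ellipse with the same axes as the
  one for \<open>\<rho> = 1\<close> and semi-axes \<open>exp (- g) * \<rho> + exp g / \<rho>\<close> and \<open>\<bar>exp g / \<rho> - exp (- g) * \<rho>\<bar>\<close>.\<close>

lemma ellipse_norm_joukowski: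
  assumes g: "g > 0" and \<rho>: "\<rho> > 0" and y: "cmod y = 1"
    and w: "joukowski_poly g w (of_real \<rho> * y) = 0"
  shows "(ellipse_norm g w)\<^sup>2 = ((exp (- g) * \<rho> + exp g / \<rho>) / (exp g + exp (- g)))\<^sup>2 * (Re y)\<^sup>2
           + ((exp g / \<rho> - exp (- g) * \<rho>) / (exp g - exp (- g)))\<^sup>2 * (Im y)\<^sup>2"
proof -
  define x where "x = of_real \<rho> * y"
  have y0: "y \<noteq> 0" "y * cnj y = 1" using y by (auto simp: complex_norm_square[symmetric])
  have "w * x = of_real (exp (- g)) * x\<^sup>2 + of_real (exp g)"
    using w unfolding x_def[symmetric] by (metis add.commute add_diff_eq diff_add_cancel diff_eq_eq add_0)
  then have "w = of_real (exp (- g)) * x + of_real (exp g) / x"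
    using y0 \<rho> by (simp add: x_def field_simps power2_eq_square)
  also have "of_real (exp g) / x = of_real (exp g / \<rho>) * cnj y"
  proof -
    have "1 / x = cnj y / of_real \<rho>"
      using y0 \<rho> by (simp add: x_def field_simps)
    then have "of_real (exp g) * (1 / x) = of_real (exp g) * (cnj y / of_real \<rho>)" by simp
    then show ?thesis by simp
  qed
  finally have "w = of_real (exp (- g) * \<rho>) * y + of_real (exp g / \<rho>) * cnj y"
    by (simp add: x_def)
  then have "Re w = (exp (- g) * \<rho> + exp g / \<rho>) * Re y" "Im w = - (exp g / \<rho> - exp (- g) * \<rho>) * Im y"
    by (simp_all add: algebra_simps)
  then show ?thesis
    unfolding ellipse_norm_def cmod_power2 by (simp add: power_mult_distrib power_divide power2_commute[of "exp (- g) * \<rho>"])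
qed

lemma weighted_squares:
  fixes p q c s :: real
  assumes "c\<^sup>2 + s\<^sup>2 = 1" "0 \<le> p" "0 \<le> q"
  shows "p > 1 \<Longrightarrow> q > 1 \<Longrightarrow> p\<^sup>2 * c\<^sup>2 + q\<^sup>2 * s\<^sup>2 > 1"
    and "p \<le> 1 \<Longrightarrow> q \<le> 1 \<Longrightarrow> p\<^sup>2 * c\<^sup>2 + q\<^sup>2 * s\<^sup>2 \<le> 1"
proof -
  assume pq: "p > 1" "q > 1"
  define m where "m = min p q"
  have m: "m > 1" using pq by (simp add: m_def)
  have "1 < m\<^sup>2" using m by (simp add: one_less_power)
  also have "m\<^sup>2 = m\<^sup>2 * c\<^sup>2 + m\<^sup>2 * s\<^sup>2" using assms(1) by (metis distrib_left mult.right_neutral)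
  also have "\<dots> \<le> p\<^sup>2 * c\<^sup>2 + q\<^sup>2 * s\<^sup>2"
    using m by (intro add_mono mult_right_mono power_mono) (auto simp: m_def)
  finally show "p\<^sup>2 * c\<^sup>2 + q\<^sup>2 * s\<^sup>2 > 1" .
next
  assume pq: "p \<le> 1" "q \<le> 1"
  have "p\<^sup>2 * c\<^sup>2 + q\<^sup>2 * s\<^sup>2 \<le> 1 * c\<^sup>2 + 1 * s\<^sup>2"
    using pq assms by (intro add_mono mult_right_mono) (auto simp: power_le_one)
  then show "p\<^sup>2 * c\<^sup>2 + q\<^sup>2 * s\<^sup>2 \<le> 1" using assms(1) by simp
qed

text \<open>As \<open>\<rho>\<close> increases to \<open>exp g\<close>, both semi-axes decrease. Thus small roots \<open>x\<close> belong to points \<open>w\<close> outside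
  the ellipse, and roots between the unit circle and the radius \<open>exp g\<close> to points inside it.\<close>

lemma joukowski_root_location:
  assumes g: "g > 0" and root: "joukowski_poly g w x = 0"
  shows "x \<noteq> 0"
    and "cmod x < 1 \<Longrightarrow> ellipse_norm g w > 1"
    and "cmod x = 1 \<Longrightarrow> ellipse_norm g w = 1"
    and "1 \<le> cmod x \<Longrightarrow> cmod x \<le> exp g \<Longrightarrow> ellipse_norm g w \<le> 1"
proof -
  show x0: "x \<noteq> 0" using root by auto
  define \<rho> where "\<rho> = cmod x"
  define y where "y = x / of_real \<rho>"
  have \<rho>: "\<rho> > 0" using x0 by (simp add: \<rho>_def)
  have y: "cmod y = 1" using \<rho> by (simp add: y_def norm_divide) (simp add: \<rho>_def)
  have xy: "x = of_real \<rho> * y" using \<rho> by (simp add: y_def)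
  define a b A B where "a = exp g + exp (- g)" and "b = exp g - exp (- g)"
    and "A = exp (- g) * \<rho> + exp g / \<rho>" and "B = exp g / \<rho> - exp (- g) * \<rho>"
  have a: "a > 0" unfolding a_def by (simp add: add_pos_pos)
  have b: "b > 0" unfolding b_def using g by simp
  have n: "(ellipse_norm g w)\<^sup>2 = (A / a)\<^sup>2 * (Re y)\<^sup>2 + (B / b)\<^sup>2 * (Im y)\<^sup>2"
    using ellipse_norm_joukowski[OF g \<rho> y root[unfolded xy]] by (simp add: a_def b_def A_def B_def)
  have cs: "(Re y)\<^sup>2 + (Im y)\<^sup>2 = 1" using y by (metis cmod_power2 one_power2)
  have Aa: "A - a = (1 - \<rho>) * (exp g / \<rho> - exp (- g))" and Bb: "B - b = (1 - \<rho>) * (exp g / \<rho> + exp (- g))"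
    using \<rho> by (simp_all add: A_def a_def B_def b_def field_simps)
  have nn: "0 \<le> ellipse_norm g w" by (simp add: ellipse_norm_def)
  have A0: "0 \<le> A" using \<rho> by (simp add: A_def add_nonneg_nonneg)
  show "ellipse_norm g w > 1" if "cmod x < 1"
  proof -
    have r: "\<rho> < 1" using that by (simp add: \<rho>_def)
    have "exp g < exp g / \<rho>" using r \<rho> by (simp add: field_simps)
    then have "exp (- g) < exp g / \<rho>" using exp_gt_exp_minus[OF g] by linarith
    then have "A > a" using Aa r by (smt (verit) mult_pos_pos)
    moreover have "B > b" using Bb r \<rho> by (smt (verit) mult_pos_pos divide_pos_pos exp_gt_zero)
    ultimately have "(A / a)\<^sup>2 * (Re y)\<^sup>2 + (B / b)\<^sup>2 * (Im y)\<^sup>2 > 1"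
      using a b by (intro weighted_squares(1) cs) auto
    then show ?thesis using n nn by (smt (verit) power_le_one)
  qed
  show "ellipse_norm g w = 1" if "cmod x = 1"
  proof -
    have "\<rho> = 1" using that by (simp add: \<rho>_def)
    then have "A = a" "B = b" by (simp_all add: A_def a_def B_def b_def)
    then have "(ellipse_norm g w)\<^sup>2 = 1" using n cs a b by simp
    then show ?thesis using nn by (simp add: power2_eq_1_iff)
  qed
  show "ellipse_norm g w \<le> 1" if "1 \<le> cmod x" "cmod x \<le> exp g"
  proof -
    have r: "1 \<le> \<rho>" "\<rho> \<le> exp g" using that by (simp_all add: \<rho>_def)
    have e1: "1 \<le> exp g / \<rho>" using r \<rho> by simp
    have e2: "exp (- g) \<le> 1" using g by simp
    have "A \<le> a" using Aa r e1 e2 by (smt (verit) mult_nonpos_nonneg)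
    moreover have "B \<le> b" using Bb r e1 by (smt (verit) mult_nonpos_nonneg exp_gt_zero)
    moreover have "exp (- g) * \<rho> \<le> exp (- g) * exp g" using r by (intro mult_left_mono) auto
    then have "0 \<le> B" using e1 by (simp add: B_def exp_minus)
    ultimately have "(A / a)\<^sup>2 * (Re y)\<^sup>2 + (B / b)\<^sup>2 * (Im y)\<^sup>2 \<le> 1"
      using a b A0 by (intro weighted_squares(2) cs) auto
    then show ?thesis using n nn by (smt (verit) one_less_power zero_less_numeral)
  qed
qed

text \<open>The product of the roots is \<open>exp (2 * g)\<close>, so one of them has modulus at most \<open>exp g\<close> and falls under the
  previous lemma.\<close>

lemma joukowski_roots:
  assumes g: "g > 0"
  obtains x1 x2 where "x1 * x2 = of_real (exp (2 * g))" "cmod x1 \<le> exp g"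
    "\<And>x. joukowski_poly g w x = of_real (exp (- g)) * ((x - x1) * (x - x2))"
proof -
  define d where "d = csqrt (w\<^sup>2 - 4)"
  define E where "E = complex_of_real (exp g)"
  have d: "d\<^sup>2 = w\<^sup>2 - 4" by (simp add: d_def)
  have E: "E \<noteq> 0" "complex_of_real (exp (- g)) = 1 / E" "complex_of_real (exp (2 * g)) = E\<^sup>2"
    by (simp_all add: E_def exp_minus inverse_eq_divide exp_double)
  define y1 y2 where "y1 = E * (w + d) / 2" and "y2 = E * (w - d) / 2"
  have "y1 * y2 = E\<^sup>2 * (w\<^sup>2 - d\<^sup>2) / 4" by (simp add: y1_def y2_def power2_eq_square algebra_simps)
  also have "\<dots> = E\<^sup>2" by (simp add: d)
  finally have p: "y1 * y2 = E\<^sup>2" .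
  have s: "y1 + y2 = E * w" by (simp add: y1_def y2_def field_simps)
  have fac: "1 / E * x\<^sup>2 - w * x + E = 1 / E * ((x - y1) * (x - y2))" for x
  proof -
    have "(x - y1) * (x - y2) = x\<^sup>2 - (y1 + y2) * x + y1 * y2" by (simp add: power2_eq_square algebra_simps)
    then show ?thesis unfolding p s using E(1) by (simp add: field_simps power2_eq_square)
  qed
  have cp: "cmod y1 * cmod y2 = (exp g)\<^sup>2" using arg_cong[OF p, of cmod] by (simp add: norm_mult norm_power E_def)
  have "cmod y1 \<le> exp g \<or> cmod y2 \<le> exp g"
  proof (rule ccontr)
    assume "\<not> ?thesis"
    then have "exp g * exp g < cmod y1 * cmod y2" by (intro mult_strict_mono) auto
    then show False using cp by (simp add: power2_eq_square)
  qed
  then show ?thesis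
  proof
    assume "cmod y1 \<le> exp g"
    then show ?thesis using that[of y1 y2] p fac E by (simp add: E_def)
  next
    assume "cmod y2 \<le> exp g"
    then show ?thesis using that[of y2 y1] p fac E by (simp add: E_def mult.commute)
  qed
qed

lemma ellipse_point:
  assumes g: "g > 0"
  shows "ellipse_norm g w = 1 \<longleftrightarrow> (\<exists>\<phi>\<in>{0..1}. w = of_real (exp (- g)) * cis (2 * pi * \<phi>) + of_real (exp g) * cis (- 2 * pi * \<phi>))"
proof
  assume e: "ellipse_norm g w = 1"
  define a b where "a = exp g + exp (- g)" and "b = exp g - exp (- g)"
  have ab: "a > 0" "b > 0" using g by (auto simp: a_def b_def add_pos_pos)
  have "(Re w / a)\<^sup>2 + (- Im w / b)\<^sup>2 = 1"
    using arg_cong[OF e, of "\<lambda>t. t\<^sup>2"] unfolding ellipse_norm_def cmod_power2 by (simp add: a_def b_def)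
  then obtain t where t: "0 \<le> t" "t < 2 * pi" "Re w / a = cos t" "- Im w / b = sin t"
    using sincos_total_2pi by metis
  define \<phi> where "\<phi> = t / (2 * pi)"
  have "\<phi> \<in> {0..1}" using t(1,2) by (simp add: \<phi>_def)
  moreover have "Re w = a * cos t" "Im w = - b * sin t" using t ab by (auto simp: field_simps)
  then have "w = of_real (exp (- g)) * cis (2 * pi * \<phi>) + of_real (exp g) * cis (- 2 * pi * \<phi>)"
    by (simp add: complex_eq_iff \<phi>_def a_def b_def algebra_simps)
  ultimately show "\<exists>\<phi>\<in>{0..1}. w = of_real (exp (- g)) * cis (2 * pi * \<phi>) + of_real (exp g) * cis (- 2 * pi * \<phi>)"
    by blast
next
  assume "\<exists>\<phi>\<in>{0..1}. w = of_real (exp (- g)) * cis (2 * pi * \<phi>) + of_real (exp g) * cis (- 2 * pi * \<phi>)"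
  then obtain \<phi> where w: "w = of_real (exp (- g)) * cis (2 * pi * \<phi>) + of_real (exp g) * cis (- 2 * pi * \<phi>)" by blast
  have "cis (- 2 * pi * \<phi>) * cis (2 * pi * \<phi>) = 1" by (simp add: cis_mult)
  then have "joukowski_poly g w (cis (2 * pi * \<phi>)) = 0"
    unfolding w by (simp add: power2_eq_square distrib_right mult.assoc)
  then show "ellipse_norm g w = 1" by (rule joukowski_root_location(3)[OF g]) simp
qed

lemma E_set_alt:
  assumes "g > 0"
  shows "E_set g = {z. \<exists>t\<in>{-2..2}. ellipse_norm g (z - of_real t) = 1}"
proof -
  have "z \<in> E_set g \<longleftrightarrow> (\<exists>t\<in>{-2..2}. ellipse_norm g (z - of_real t) = 1)" for z
  proof
    assume "z \<in> E_set g"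
    then obtain t \<phi> where "t \<in> {-2..2}" "\<phi> \<in> {0..1}"
      "z = of_real t + of_real (exp (- g)) * cis (2 * pi * \<phi>) + of_real (exp g) * cis (- 2 * pi * \<phi>)"
      unfolding E_set_def by blast
    then have "ellipse_norm g (z - of_real t) = 1"
      unfolding ellipse_point[OF assms] by (intro bexI[of _ \<phi>]) simp_all
    with \<open>t \<in> {-2..2}\<close> show "\<exists>t\<in>{-2..2}. ellipse_norm g (z - of_real t) = 1" by blast
  next
    assume "\<exists>t\<in>{-2..2}. ellipse_norm g (z - of_real t) = 1"
    then obtain t \<phi> where t: "t \<in> {-2..2}" "\<phi> \<in> {0..1}"
      "z - of_real t = of_real (exp (- g)) * cis (2 * pi * \<phi>) + of_real (exp g) * cis (- 2 * pi * \<phi>)"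
      unfolding ellipse_point[OF assms] by blast
    then have "z = of_real t + of_real (exp (- g)) * cis (2 * pi * \<phi>) + of_real (exp g) * cis (- 2 * pi * \<phi>)"
      by (simp add: diff_eq_eq add.assoc add.commute)
    with t show "z \<in> E_set g" unfolding E_set_def by blast
  qed
  then show ?thesis by blast
qed

lemma convex_filled: "convex (filled_set g)"
proof (rule convexI)
  fix z w and u v :: real
  assume z: "z \<in> filled_set g" and w: "w \<in> filled_set g" and uv: "0 \<le> u" "0 \<le> v" "u + v = 1"
  obtain s t where s: "s \<in> {-2..2}" "ellipse_norm g (z - of_real s) \<le> 1"
    and t: "t \<in> {-2..2}" "ellipse_norm g (w - of_real t) \<le> 1"
    using z w by (auto simp: filled_set_def)
  have "u * s + v * t \<in> {-2..2}"
    using convexD[OF convex_real_interval(5)[of "-2" 2] s(1) t(1) uv] by simp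
  moreover have "ellipse_norm g ((u *\<^sub>R z + v *\<^sub>R w) - of_real (u * s + v * t)) \<le> 1"
  proof -
    have "(u *\<^sub>R z + v *\<^sub>R w) - of_real (u * s + v * t) = of_real u * (z - of_real s) + of_real v * (w - of_real t)"
      by (simp add: scaleR_conv_of_real algebra_simps)
    then have "ellipse_norm g ((u *\<^sub>R z + v *\<^sub>R w) - of_real (u * s + v * t))
        \<le> u * ellipse_norm g (z - of_real s) + v * ellipse_norm g (w - of_real t)"
      using ellipse_norm_add[of g "of_real u * (z - of_real s)" "of_real v * (w - of_real t)"] uv
      unfolding ellipse_norm_scale by simp
    also have "\<dots> \<le> u * 1 + v * 1" using s t uv by (intro add_mono mult_left_mono) auto
    finally show ?thesis using uv by simp
  qed
  ultimately show "u *\<^sub>R z + v *\<^sub>R w \<in> filled_set g" unfolding filled_set_def by blast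
qed

lemma closed_filled: "closed (filled_set g)"
proof -
  have "closed {w. ellipse_norm g w \<le> 1}"
    by (intro closed_Collect_le continuous_intros)
  moreover have "compact (complex_of_real ` {-2..2})"
    by (intro compact_continuous_image continuous_intros) auto
  ultimately have "closed (\<Union>t\<in>complex_of_real ` {-2..2}. \<Union>w\<in>{w. ellipse_norm g w \<le> 1}. {t + w})"
    by (intro compact_closed_sums)
  also have "(\<Union>t\<in>complex_of_real ` {-2..2}. \<Union>w\<in>{w. ellipse_norm g w \<le> 1}. {t + w}) = filled_set g"
  proof (intro equalityI subsetI)
    fix z assume "z \<in> filled_set g"
    then obtain t where t: "t \<in> {-2..2}" "ellipse_norm g (z - of_real t) \<le> 1"
      by (auto simp: filled_set_def)
    have "z = of_real t + (z - of_real t)" by simp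
    then show "z \<in> (\<Union>t\<in>complex_of_real ` {-2..2}. \<Union>w\<in>{w. ellipse_norm g w \<le> 1}. {t + w})"
      using t by blast
  next
    fix z assume "z \<in> (\<Union>t\<in>complex_of_real ` {-2..2}. \<Union>w\<in>{w. ellipse_norm g w \<le> 1}. {t + w})"
    then obtain t w where "t \<in> {-2..2}" "ellipse_norm g w \<le> 1" "z = of_real t + w" by blast
    then show "z \<in> filled_set g" unfolding filled_set_def by (intro CollectI bexI[of _ t]) simp_all
  qed
  finally show ?thesis .
qed

text \<open>Each point of the filled ellipse lies on the horizontal chord through it.\<close>

lemma filled_subset_hull:
  assumes g: "g > 0"
  shows "filled_set g \<subseteq> convex hull (E_set g)"
proof
  fix z assume "z \<in> filled_set g"
  then obtain t where t: "t \<in> {-2..2}" "ellipse_norm g (z - of_real t) \<le> 1" by (auto simp: filled_set_def)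
  define w where "w = z - of_real t"
  define a b where "a = exp g + exp (- g)" and "b = exp g - exp (- g)"
  have ab: "a > 0" "b > 0" using g by (auto simp: a_def b_def add_pos_pos)
  define c where "c = a * sqrt (1 - (Im w / b)\<^sup>2)"
  have n: "(Re w / a)\<^sup>2 + (Im w / b)\<^sup>2 \<le> 1"
  proof -
    have "(ellipse_norm g w)\<^sup>2 \<le> 1" using t by (simp add: w_def ellipse_norm_def power_le_one)
    then show ?thesis unfolding ellipse_norm_def cmod_power2 by (simp add: a_def b_def)
  qed
  then have y: "(Im w / b)\<^sup>2 \<le> 1" by (smt (verit) zero_le_power2)
  have c0: "0 \<le> c" using ab y by (simp add: c_def)
  have "(Re w)\<^sup>2 \<le> c\<^sup>2"
  proof -
    have "c\<^sup>2 = a\<^sup>2 * (1 - (Im w / b)\<^sup>2)" using y by (simp add: c_def power_mult_distrib)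
    moreover have "(Re w)\<^sup>2 = a\<^sup>2 * (Re w / a)\<^sup>2" using ab by (simp add: power_divide)
    moreover have "a\<^sup>2 * (Re w / a)\<^sup>2 \<le> a\<^sup>2 * (1 - (Im w / b)\<^sup>2)" using n by (intro mult_left_mono) auto
    ultimately show ?thesis by simp
  qed
  then have Rc: "\<bar>Re w\<bar> \<le> c" using c0 by (simp add: abs_le_square_iff[symmetric])
  have E: "of_real t + Complex r (Im w) \<in> E_set g" if "r\<^sup>2 = c\<^sup>2" for r
  proof -
    have "(r / a)\<^sup>2 = 1 - (Im w / b)\<^sup>2"
      using that ab y by (simp add: power_divide c_def power_mult_distrib)
    then have "(ellipse_norm g (Complex r (Im w)))\<^sup>2 = 1"
      unfolding ellipse_norm_def cmod_power2 by (simp add: a_def b_def)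
    then have "ellipse_norm g (Complex r (Im w)) = 1"
      by (simp add: power2_eq_1_iff ellipse_norm_def) (smt (verit) norm_ge_zero)
    then show ?thesis unfolding E_set_alt[OF g] using t(1) by (intro CollectI bexI[of _ t]) auto
  qed
  \<comment> \<open>The chord degenerates to a point at the top and the bottom of the ellipse.\<close>
  define u where "u = (if c = 0 then 0 else (c - Re w) / (2 * c))"
  have u: "0 \<le> u" "u \<le> 1" using Rc c0 by (auto simp: u_def field_simps abs_le_iff)
  have "z = (1 - u) *\<^sub>R (of_real t + Complex c (Im w)) + u *\<^sub>R (of_real t + Complex (- c) (Im w))"
  proof -
    have "Re w = (1 - u) * c + u * (- c)" using Rc c0 by (auto simp: u_def field_simps)
    moreover have "z = of_real t + w" by (simp add: w_def)
    ultimately show ?thesis by (simp add: complex_eq_iff algebra_simps)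
  qed
  moreover have "(1 - u) *\<^sub>R (of_real t + Complex c (Im w)) + u *\<^sub>R (of_real t + Complex (- c) (Im w)) \<in> convex hull (E_set g)"
    using u by (intro convexD[OF convex_convex_hull] hull_inc E) auto
  ultimately show "z \<in> convex hull (E_set g)" by simp
qed

lemma closure_hull_E_set:
  assumes g: "g > 0"
  shows "closure (convex hull (E_set g)) = filled_set g"
proof
  have "E_set g \<subseteq> filled_set g" unfolding E_set_alt[OF g] filled_set_def by force
  then have "convex hull (E_set g) \<subseteq> filled_set g" by (intro hull_minimal convex_filled)
  then show "closure (convex hull (E_set g)) \<subseteq> filled_set g" by (intro closure_minimal closed_filled)
  show "filled_set g \<subseteq> closure (convex hull (E_set g))"
    using filled_subset_hull[OF g] closure_subset by blast
qed

text \<open>For a point outside \<open>E_set g\<close>, the horizontal segment of its translates does not meet the ellipse, so by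
  connectedness it lies inside as soon as one of its points does.\<close>

lemma filled_minus_E_set:
  assumes g: "g > 0" and z: "z \<in> filled_set g" "z \<notin> E_set g" and t: "t \<in> {-2..2}"
  shows "ellipse_norm g (z - of_real t) < 1"
proof (rule ccontr)
  assume "\<not> ?thesis"
  then have 1: "1 \<le> ellipse_norm g (z - of_real t)" by simp
  obtain s where s: "s \<in> {-2..2}" "ellipse_norm g (z - of_real s) \<le> 1" using z by (auto simp: filled_set_def)
  have "connected ((\<lambda>t. ellipse_norm g (z - of_real t)) ` {-2..2})"
    by (intro connected_continuous_image continuous_intros) auto
  from connected_contains_Icc[OF this imageI[OF s(1)] imageI[OF t]] s 1
  obtain r where "r \<in> {-2..2}" "ellipse_norm g (z - of_real r) = 1" by force
  then show False using z(2) unfolding E_set_alt[OF g] by blast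
qed

section \<open>The operator as a convolution plus a plane wave\<close>

abbreviation V_at :: "real \<Rightarrow> real \<times> real \<Rightarrow> complex" where
  "V_at g \<theta> \<equiv> V g (fst \<theta>) (snd \<theta>)"

definition shifts :: "(int \<times> int) set" where
  "shifts = {(0, 0), (1, 0), (-1, 0), (0, 1), (0, -1)}"

text \<open>The coefficient at \<open>(0, 0)\<close> includes the spectral parameter, so that these are the coefficients of the hopping
  operator minus \<open>z\<close>.\<close>

definition H_coeff :: "real \<Rightarrow> complex \<Rightarrow> int \<times> int \<Rightarrow> complex" where
  "H_coeff g z y = (if y = (0, 0) then - z else if y = (1, 0) then of_real (exp g)
     else if y = (-1, 0) then of_real (exp (- g)) else if y = (0, 1) \<or> y = (0, -1) then 1 else 0)"

lemma shifts_basic: "finite shifts" "0 \<in> shifts" "y \<notin> shifts \<Longrightarrow> H_coeff g z y = 0"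
  by (auto simp: shifts_def H_coeff_def zero_prod_def)

lemma symbol_H: "symbol shifts (H_coeff g z) \<theta> = V_at g \<theta> - z"
proof -
  have "cis t + cis (- t) = of_real (2 * cos t)" for t
    by (simp add: complex_eq_iff)
  from this[of "2 * pi * fst \<theta>"] show ?thesis
    by (simp add: symbol_def shifts_def H_coeff_def wave_def V_def algebra_simps)
qed

lemma H_op_band:
  "H_op g \<alpha>\<^sub>1 \<alpha>\<^sub>2 lam \<omega> u x - z * u x
     = band shifts (kern (H_coeff g z) (lam * cis (2 * pi * \<omega>)) (\<alpha>\<^sub>2, - \<alpha>\<^sub>1)) u x"
proof -
  obtain m n where x: "x = (m, n)" by (cases x)
  have c: "cis (2 * pi * (\<omega> + of_int m * \<alpha>\<^sub>1 + of_int n * \<alpha>\<^sub>2)) = cis (2 * pi * \<omega>) * wave (\<alpha>\<^sub>2, - \<alpha>\<^sub>1) x"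
    by (simp add: wave_def x cis_mult algebra_simps)
  have "H_op g \<alpha>\<^sub>1 \<alpha>\<^sub>2 lam \<omega> u x = H0 g u x + lam * (cis (2 * pi * \<omega>) * wave (\<alpha>\<^sub>2, - \<alpha>\<^sub>1) x) * u x"
    unfolding c[symmetric] by (simp add: H_op_def x)
  then show ?thesis
    unfolding band_kern[OF shifts_basic(1,2)] H0_def
    by (simp add: x shifts_def H_coeff_def algebra_simps)
qed

lemma nonresonant_frequency:
  assumes "rationally_independent \<alpha>\<^sub>1 \<alpha>\<^sub>2"
  shows "nonresonant (\<alpha>\<^sub>2, - \<alpha>\<^sub>1)"
  unfolding nonresonant_def
proof (intro allI impI notI)
  fix x :: "int \<times> int" assume x: "x \<noteq> 0" and w: "wave (\<alpha>\<^sub>2, - \<alpha>\<^sub>1) x = 1"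
  obtain m n where mn: "x = (m, n)" by (cases x)
  have "cos (2 * pi * (of_int n * \<alpha>\<^sub>2 + of_int m * \<alpha>\<^sub>1)) = 1"
    using arg_cong[OF w, of Re] by (simp add: wave_def mn)
  then obtain k :: int where "2 * pi * (of_int n * \<alpha>\<^sub>2 + of_int m * \<alpha>\<^sub>1) = of_int k * 2 * pi"
    unfolding cos_one_2pi_int by blast
  then have "2 * pi * (of_int n * \<alpha>\<^sub>2 + of_int m * \<alpha>\<^sub>1) = 2 * pi * of_int k" by simp
  then have "of_int n * \<alpha>\<^sub>2 + of_int m * \<alpha>\<^sub>1 = of_int k" by simp
  then have "of_rat (of_int (- k)) * 1 + of_rat (of_int m) * \<alpha>\<^sub>1 + of_rat (of_int n) * \<alpha>\<^sub>2 = 0"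
    by (simp add: of_rat_minus)
  then have "of_int m = (0::rat)" "of_int n = (0::rat)"
    using assms unfolding rationally_independent_def by blast+
  then show False using x by (simp add: mn zero_prod_def)
qed

definition V_torus :: "real \<Rightarrow> complex \<times> complex \<Rightarrow> complex" where
  "V_torus g w = of_real (2 * Re (fst w)) + of_real (exp (- g)) * snd w + of_real (exp g) * cnj (snd w)"

lemma V_torus: "V_at g \<theta> = V_torus g (torus_point \<theta>)"
  by (simp add: V_def V_torus_def torus_point_def cis_cnj)

lemma continuous_on_V_torus [continuous_intros]:
  "continuous_on A f \<Longrightarrow> continuous_on A (\<lambda>x. V_torus g (f x))"
  unfolding V_torus_def by (intro continuous_intros)

lemma torus_point_surj: "w \<in> torus \<Longrightarrow> \<exists>\<theta>. torus_point \<theta> = w"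
proof -
  assume "w \<in> torus"
  then obtain a b where ab: "cmod a = 1" "cmod b = 1" "w = (a, b)" by (auto simp: torus_def)
  have "cis (2 * pi * (Arg c / (2 * pi))) = c" if "cmod c = 1" for c
    using that cis_Arg[of c] by (cases "c = 0") (auto simp: sgn_div_norm)
  then have "torus_point (Arg a / (2 * pi), Arg b / (2 * pi)) = w" using ab by (simp add: torus_point_def)
  then show ?thesis by blast
qed

lemma E_set_range: "z \<in> E_set g \<longleftrightarrow> (\<exists>\<theta>. V_at g \<theta> = z)"
proof
  assume "z \<in> E_set g"
  then obtain t \<phi> where t: "t \<in> {-2..2}"
    "z = of_real t + of_real (exp (- g)) * cis (2 * pi * \<phi>) + of_real (exp g) * cis (- 2 * pi * \<phi>)"
    unfolding E_set_def by blast
  define s where "s = arccos (t / 2) / (2 * pi)"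
  have "2 * cos (2 * pi * s) = t" using t by (simp add: s_def cos_arccos)
  then have "V g (fst (s, \<phi>)) (snd (s, \<phi>)) = z" unfolding V_def t(2) by simp
  then show "\<exists>\<theta>. V_at g \<theta> = z" by blast
next
  assume "\<exists>\<theta>. V_at g \<theta> = z"
  then obtain s \<phi> where z: "z = V g s \<phi>" by auto
  have c: "cis (2 * pi * frac \<phi>) = cis (2 * pi * \<phi>)"
    using torus_point_frac[of "(0, \<phi>)"] by (simp add: torus_point_def)
  then have "cnj (cis (2 * pi * frac \<phi>)) = cnj (cis (2 * pi * \<phi>))" by simp
  then have c': "cis (- 2 * pi * frac \<phi>) = cis (- 2 * pi * \<phi>)" by (simp add: cis_cnj)
  have "z = of_real (2 * cos (2 * pi * s)) + of_real (exp (- g)) * cis (2 * pi * frac \<phi>)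
      + of_real (exp g) * cis (- 2 * pi * frac \<phi>)"
    unfolding z V_def c c' ..
  moreover have "2 * cos (2 * pi * s) \<in> {-2..2}" using cos_ge_minus_one[of "2 * pi * s"] cos_le_one[of "2 * pi * s"] by simp
  moreover have "frac \<phi> \<in> {0..1}" by (simp add: less_imp_le[OF frac_lt_1])
  ultimately show "z \<in> E_set g" unfolding E_set_def by blast
qed

section \<open>Uniform growth of the cocycle\<close>

text \<open>The growth rate of the cocycle when \<open>z\<close> is outside the range of \<open>V\<close>.\<close>

definition log_mean :: "real \<Rightarrow> complex \<Rightarrow> real" where
  "log_mean g z = torus_mean (\<lambda>\<theta>. ln (cmod (V_at g \<theta> - z)))"

lemma V_torus_nonzero: "z \<notin> E_set g \<Longrightarrow> w \<in> torus \<Longrightarrow> V_torus g w - z \<noteq> 0"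
  using torus_point_surj[of w] E_set_range[of z g] V_torus by force

lemma continuous_on_log_V:
  "z \<notin> E_set g \<Longrightarrow> continuous_on torus (\<lambda>w. ln (cmod (V_torus g w - z)))"
  by (intro continuous_intros) (use V_torus_nonzero in auto)

abbreviation V_product :: "real \<Rightarrow> complex \<Rightarrow> real \<times> real \<Rightarrow> nat \<Rightarrow> real \<times> real \<Rightarrow> real" where
  "V_product g z \<eta> N \<theta> \<equiv> (\<Prod>k<N. cmod (V_at g (\<theta> + real k *\<^sub>R \<eta>) - z))"

text \<open>Outside \<open>E_set g\<close> the logarithm of \<open>\<bar>V - z\<bar>\<close> is continuous, so the averages of the logarithm converge
  uniformly.\<close>

lemma V_product_uniform:
  assumes \<eta>: "nonresonant \<eta>" and z: "z \<notin> E_set g" and e: "e > 0"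
  shows "\<exists>N0. \<forall>N\<ge>N0. \<forall>\<theta>. exp (N * (log_mean g z - e)) \<le> V_product g z \<eta> N \<theta>
           \<and> V_product g z \<eta> N \<theta> \<le> exp (N * (log_mean g z + e))"
proof -
  define G where "G w = ln (cmod (V_torus g w - z))" for w
  obtain N0 where N0: "\<forall>N\<ge>N0. \<forall>\<theta>. \<bar>orbit_sum G \<eta> N \<theta> / real N
            - torus_mean (\<lambda>\<theta>. G (torus_point \<theta>))\<bar> < e"
    using weyl_equidistribution_uniform[OF \<eta> continuous_on_log_V[OF z] e] unfolding G_def by blast
  have m: "torus_mean (\<lambda>\<theta>. G (torus_point \<theta>)) = log_mean g z"
    unfolding log_mean_def G_def V_torus ..
  have "exp (N * (log_mean g z - e)) \<le> V_product g z \<eta> N \<theta>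
           \<and> V_product g z \<eta> N \<theta> \<le> exp (N * (log_mean g z + e))" if N: "N \<ge> max N0 1" for N \<theta>
  proof -
    define S where "S = orbit_sum G \<eta> N \<theta>"
    have "\<bar>S / real N - log_mean g z\<bar> < e"
      using N0[rule_format, of N \<theta>] N by (simp add: S_def m)
    then have "log_mean g z - e \<le> S / real N" "S / real N \<le> log_mean g z + e" by auto
    then have "N * (log_mean g z - e) \<le> S" "S \<le> N * (log_mean g z + e)"
      using N by (simp_all add: field_simps)
    moreover have "exp S = V_product g z \<eta> N \<theta>"
    proof -
      have "exp S = (\<Prod>j<N. exp (G (torus_point (\<theta> + real j *\<^sub>R \<eta>))))"
        unfolding S_def by (rule exp_sum) simp
      also have "\<dots> = V_product g z \<eta> N \<theta>"
        unfolding G_def V_torus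
        by (intro prod.cong refl exp_ln) (use V_torus_nonzero[OF z] in auto)
      finally show ?thesis .
    qed
    ultimately show ?thesis by (metis exp_le_cancel_iff)
  qed
  then show ?thesis by blast
qed

lemma not_in_spectrum_H:
  assumes \<alpha>: "rationally_independent \<alpha>\<^sub>1 \<alpha>\<^sub>2"
    and gap: "(\<forall>\<theta>. V_product g z (\<alpha>\<^sub>2, - \<alpha>\<^sub>1) N \<theta> \<le> s) \<and> 0 \<le> s \<and> s < cmod lam ^ N
      \<or> (\<forall>\<theta>. s \<le> V_product g z (\<alpha>\<^sub>2, - \<alpha>\<^sub>1) N \<theta>) \<and> cmod lam ^ N < s"
  shows "z \<notin> ell2_spectrum (H_op g \<alpha>\<^sub>1 \<alpha>\<^sub>2 lam \<omega>)"
proof (rule cocycle_gap_resolvent[OF shifts_basic(1,2) nonresonant_frequency[OF \<alpha>]])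
  show "(\<forall>\<theta>. cocycle shifts (H_coeff g z) (\<alpha>\<^sub>2, - \<alpha>\<^sub>1) N \<theta> \<le> s) \<and>
      0 \<le> s \<and> s < cmod (lam * cis (2 * pi * \<omega>)) ^ N \<or>
      (\<forall>\<theta>. s \<le> cocycle shifts (H_coeff g z) (\<alpha>\<^sub>2, - \<alpha>\<^sub>1) N \<theta>) \<and>
      cmod (lam * cis (2 * pi * \<omega>)) ^ N < s"
    using gap unfolding symbol_H by (simp add: norm_mult del: split_paired_All)
qed (auto simp: shifts_basic H_op_band)

lemma resolvent_of_expanding:
  assumes \<alpha>: "rationally_independent \<alpha>\<^sub>1 \<alpha>\<^sub>2" and z: "z \<notin> E_set g" and lam: "cmod lam < exp (log_mean g z)"
  shows "z \<notin> ell2_spectrum (H_op g \<alpha>\<^sub>1 \<alpha>\<^sub>2 lam \<omega>)"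
proof -
  obtain c where c: "cmod lam < c" "c < exp (log_mean g z)" using dense[OF lam] by blast
  have c0: "c > 0" using c(1) norm_ge_zero[of lam] by linarith
  define e where "e = log_mean g z - ln c"
  have e: "e > 0" using c c0 by (simp add: e_def) (metis exp_ln exp_less_cancel_iff)
  obtain N0 where N0: "\<forall>N\<ge>N0. \<forall>\<theta>. exp (N * (log_mean g z - e)) \<le> V_product g z (\<alpha>\<^sub>2, - \<alpha>\<^sub>1) N \<theta>
           \<and> V_product g z (\<alpha>\<^sub>2, - \<alpha>\<^sub>1) N \<theta> \<le> exp (N * (log_mean g z + e))"
    using V_product_uniform[OF nonresonant_frequency[OF \<alpha>] z e] by blast
  define N where "N = Suc N0"
  have "exp (N * (log_mean g z - e)) = c ^ N"
    using c0 by (simp add: e_def exp_of_nat_mult)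
  then have "\<forall>\<theta>. c ^ N \<le> V_product g z (\<alpha>\<^sub>2, - \<alpha>\<^sub>1) N \<theta>"
    using N0[rule_format, of N] by (auto simp: N_def)
  moreover have "cmod lam ^ N < c ^ N" using c by (intro power_strict_mono) (auto simp: N_def)
  ultimately show ?thesis by (intro not_in_spectrum_H[OF \<alpha>, of g z N "c ^ N" lam]) blast
qed

text \<open>Truncation from below makes the logarithm continuous even when \<open>V - z\<close> has zeros, and it can only increase the
  products; the contracting case rests on an upper bound for them.\<close>

lemma resolvent_of_contracting:
  assumes \<alpha>: "rationally_independent \<alpha>\<^sub>1 \<alpha>\<^sub>2" and \<epsilon>: "\<epsilon> > 0" and lam: "lam \<noteq> 0"
    and mean: "torus_mean (\<lambda>\<theta>. ln (max (cmod (V_at g \<theta> - z)) \<epsilon>)) < ln (cmod lam)"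
  shows "z \<notin> ell2_spectrum (H_op g \<alpha>\<^sub>1 \<alpha>\<^sub>2 lam \<omega>)"
proof -
  define G where "G w = ln (max (cmod (V_torus g w - z)) \<epsilon>)" for w
  have "continuous_on torus G"
    unfolding G_def using \<epsilon> by (intro continuous_intros) (auto simp: max_def)
  have expG: "exp (G w) = max (cmod (V_torus g w - z)) \<epsilon>" for w
    unfolding G_def using \<epsilon> by (intro exp_ln) (simp add: less_max_iff_disj)
  define M where "M = torus_mean (\<lambda>\<theta>. G (torus_point \<theta>))"
  have M: "M < ln (cmod lam)" using mean by (simp add: M_def G_def V_torus)
  obtain b where b: "M < b" "b < ln (cmod lam)" using dense[OF M] by blast
  obtain N0 where N0: "\<forall>N\<ge>N0. \<forall>\<theta>. \<bar>orbit_sum G (\<alpha>\<^sub>2, - \<alpha>\<^sub>1) N \<theta> / real N - M\<bar> < b - M"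
    using weyl_equidistribution_uniform[OF nonresonant_frequency[OF \<alpha>] \<open>continuous_on torus G\<close>, of "b - M"] b unfolding M_def by auto
  define N where "N = Suc N0"
  have "V_product g z (\<alpha>\<^sub>2, - \<alpha>\<^sub>1) N \<theta> \<le> exp b ^ N" for \<theta>
  proof -
    define S where "S = orbit_sum G (\<alpha>\<^sub>2, - \<alpha>\<^sub>1) N \<theta>"
    have "\<bar>S / real N - M\<bar> < b - M" using N0[rule_format, of N \<theta>] by (simp add: S_def N_def)
    then have "S / real N < b" by linarith
    then have "S \<le> real N * b" by (simp add: N_def field_simps)
    have "V_product g z (\<alpha>\<^sub>2, - \<alpha>\<^sub>1) N \<theta> \<le> (\<Prod>j<N. exp (G (torus_point (\<theta> + real j *\<^sub>R (\<alpha>\<^sub>2, - \<alpha>\<^sub>1)))))"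
      unfolding V_torus by (intro prod_mono) (simp add: expG)
    also have "\<dots> = exp S" unfolding S_def by (rule exp_sum[symmetric]) simp
    also have "\<dots> \<le> exp (real N * b)" using \<open>S \<le> real N * b\<close> by simp
    also have "\<dots> = exp b ^ N" by (rule exp_of_nat_mult)
    finally show ?thesis .
  qed
  moreover have "exp b ^ N < cmod lam ^ N"
  proof (rule power_strict_mono)
    have "exp b < exp (ln (cmod lam))" using b by simp
    then show "exp b < cmod lam" using lam by simp
  qed (auto simp: N_def)
  ultimately show ?thesis by (intro not_in_spectrum_H[OF \<alpha>, of g z N "exp b ^ N" lam]) simp
qed

lemma spectrum_of_neutral:
  assumes \<alpha>: "rationally_independent \<alpha>\<^sub>1 \<alpha>\<^sub>2" and z: "z \<notin> E_set g" and lam: "cmod lam = exp (log_mean g z)"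
  shows "z \<in> ell2_spectrum (H_op g \<alpha>\<^sub>1 \<alpha>\<^sub>2 lam \<omega>)"
proof (rule neutral_cocycle_in_spectrum[OF shifts_basic(1,2) nonresonant_frequency[OF \<alpha>]])
  show "symbol shifts (H_coeff g z) \<theta> \<noteq> 0" for \<theta>
    unfolding symbol_H V_torus by (intro V_torus_nonzero z) simp
  have "cmod lam \<noteq> 0" using lam by simp
  then show "lam * cis (2 * pi * \<omega>) \<noteq> 0" by auto
  fix e :: real assume e: "e > 0"
  obtain N0 where N0: "\<forall>N\<ge>N0. \<forall>\<theta>. exp (N * (log_mean g z - e)) \<le> V_product g z (\<alpha>\<^sub>2, - \<alpha>\<^sub>1) N \<theta>
           \<and> V_product g z (\<alpha>\<^sub>2, - \<alpha>\<^sub>1) N \<theta> \<le> exp (N * (log_mean g z + e))"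
    using V_product_uniform[OF nonresonant_frequency[OF \<alpha>] z e] by blast
  have D: "exp (N * (log_mean g z + d)) = exp (d * N) * cmod lam ^ N" for N :: nat and d :: real
    unfolding lam exp_of_nat_mult[symmetric] exp_add[symmetric] by (simp add: algebra_simps)
  have "\<forall>n\<ge>N0. \<forall>\<theta>. exp (- e * n) * cmod lam ^ n \<le> V_product g z (\<alpha>\<^sub>2, - \<alpha>\<^sub>1) n \<theta> \<and>
       V_product g z (\<alpha>\<^sub>2, - \<alpha>\<^sub>1) n \<theta> \<le> exp (e * n) * cmod lam ^ n"
    using N0 D[where d=e] D[where d="- e"] by simp
  then show "\<exists>N. \<forall>n\<ge>N. \<forall>\<theta>. exp (- e * n) * cmod (lam * cis (2 * pi * \<omega>)) ^ n
       \<le> cocycle shifts (H_coeff g z) (\<alpha>\<^sub>2, - \<alpha>\<^sub>1) n \<theta> \<and>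
      cocycle shifts (H_coeff g z) (\<alpha>\<^sub>2, - \<alpha>\<^sub>1) n \<theta>
       \<le> exp (e * n) * cmod (lam * cis (2 * pi * \<omega>)) ^ n"
    unfolding symbol_H norm_mult norm_cis mult_1_right by blast
qed (auto simp: shifts_basic H_op_band)

section \<open>The growth rate by the maximum principle\<close>

text \<open>The maximum principle, in the form in which it produces a point on the circle.\<close>

lemma exists_unit_circle_ge:
  assumes "continuous_on (cball 0 1) p" "p holomorphic_on ball 0 1"
  shows "\<exists>x. cmod x = 1 \<and> cmod (p 0) \<le> cmod (p x)"
proof -
  have "compact (sphere (0::complex) 1)" "sphere (0::complex) 1 \<noteq> {}" by auto
  moreover have "continuous_on (sphere 0 1) (\<lambda>x. cmod (p x))"
    by (intro continuous_intros continuous_on_subset[OF assms(1)]) auto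
  ultimately obtain x where x: "x \<in> sphere 0 1" "\<And>y. y \<in> sphere 0 1 \<Longrightarrow> cmod (p y) \<le> cmod (p x)"
    using continuous_attains_sup by metis
  have "cmod (p 0) \<le> cmod (p x)"
    by (rule maximum_modulus_frontier[of p "cball 0 1"]) (use assms x in auto)
  with x show ?thesis by auto
qed

text \<open>For fixed first coordinate, \<open>V - z\<close> is up to a unimodular factor a quadratic polynomial in the
  exponential of the second coordinate.\<close>

lemma V_on_circle:
  assumes x: "x = cis (2 * pi * t)" and c: "c = cis (2 * pi * d)"
  shows "(V g s (t + d) - z) * (c * x)
    = joukowski_poly g (z - of_real (2 * cos (2 * pi * s))) (c * x)"
proof -
  have xc: "cis (2 * pi * (t + d)) = c * x" by (simp add: x c cis_mult algebra_simps)
  have "cis (- 2 * pi * (t + d)) * cis (2 * pi * (t + d)) = 1" by (simp add: cis_mult)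
  then have i: "cis (- 2 * pi * (t + d)) * (c * x) = 1" by (simp only: xc)
  have "(V g s (t + d) - z) * (c * x)
    = of_real (exp (- g)) * (c * x)\<^sup>2 - (z - of_real (2 * cos (2 * pi * s))) * (c * x)
      + of_real (exp g) * (cis (- 2 * pi * (t + d)) * (c * x))"
    unfolding V_def xc by (simp add: power2_eq_square algebra_simps)
  then show ?thesis by (simp only: i mult_1_right)
qed

lemma V_product_circle:
  fixes \<eta> :: "real \<times> real"
  assumes x: "x = cis (2 * pi * t)"
  shows "V_product g z \<eta> N (s, t)
    = cmod (\<Prod>k<N. joukowski_poly g (z - of_real (2 * cos (2 * pi * (s + real k * fst \<eta>)))) (cis (2 * pi * (real k * snd \<eta>)) * x))"
  unfolding prod_norm[symmetric]
proof (intro prod.cong refl)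
  fix k
  define c where "c = cis (2 * pi * (real k * snd \<eta>))"
  have "cmod (c * x) = 1" by (simp add: c_def x norm_mult)
  then have "cmod (V g (s + real k * fst \<eta>) (t + real k * snd \<eta>) - z)
      = cmod ((V g (s + real k * fst \<eta>) (t + real k * snd \<eta>) - z) * (c * x))"
    by (simp add: norm_mult)
  also have "\<dots> = cmod (of_real (exp (- g)) * (c * x)\<^sup>2
        - (z - of_real (2 * cos (2 * pi * (s + real k * fst \<eta>)))) * (c * x) + of_real (exp g))"
    by (subst V_on_circle[OF x c_def]) (rule refl)
  finally show "cmod (V g (fst ((s, t) + real k *\<^sub>R \<eta>)) (snd ((s, t) + real k *\<^sub>R \<eta>)) - z)
      = cmod (joukowski_poly g (z - of_real (2 * cos (2 * pi * (s + real k * fst \<eta>)))) (cis (2 * pi * (real k * snd \<eta>)) * x))"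
    by (simp add: c_def)
qed

lemma unit_circle_angle:
  assumes "cmod x = 1" obtains t where "x = cis (2 * pi * t)"
proof
  show "x = cis (2 * pi * (Arg x / (2 * pi)))"
    using assms cis_Arg[of x] by (cases "x = 0") (auto simp: sgn_div_norm)
qed

text \<open>The polynomial of the previous lemma has modulus \<open>exp (N * g)\<close> at the origin, hence a value at least as large
  on the unit circle.\<close>

lemma V_product_large:
  fixes \<eta> :: "real \<times> real"
  shows "\<exists>t. exp (N * g) \<le> V_product g z \<eta> N (s, t)"
proof -
  define p where "p x = (\<Prod>k<N. joukowski_poly g (z - of_real (2 * cos (2 * pi * (s + real k * fst \<eta>)))) (cis (2 * pi * (real k * snd \<eta>)) * x))" for x
  have "\<exists>x. cmod x = 1 \<and> cmod (p 0) \<le> cmod (p x)"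
    unfolding p_def by (intro exists_unit_circle_ge continuous_intros holomorphic_intros)
  then obtain x where x: "cmod x = 1" "cmod (p 0) \<le> cmod (p x)" by blast
  obtain t where t: "x = cis (2 * pi * t)" using unit_circle_angle[OF x(1)] .
  have "cmod (p 0) = exp (N * g)" by (simp add: p_def norm_power exp_of_nat_mult)
  moreover have "V_product g z \<eta> N (s, t) = cmod (p x)"
    using V_product_circle[OF t, where g=g and z=z and \<eta>=\<eta> and N=N and s=s] by (simp only: p_def)
  ultimately show ?thesis using x(2) by (intro exI[of _ t]) linarith
qed

lemma log_mean_ge:
  assumes \<alpha>: "rationally_independent \<alpha>\<^sub>1 \<alpha>\<^sub>2" and z: "z \<notin> E_set g"
    and large: "\<And>N. \<exists>\<theta>. exp (real N * b) \<le> V_product g z (\<alpha>\<^sub>2, - \<alpha>\<^sub>1) N \<theta>"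
  shows "b \<le> log_mean g z"
proof (rule field_le_epsilon)
  fix e :: real assume "e > 0"
  from V_product_uniform[OF nonresonant_frequency[OF \<alpha>] z this]
  obtain N0 where N0: "\<forall>N\<ge>N0. \<forall>\<theta>. exp (N * (log_mean g z - e)) \<le> V_product g z (\<alpha>\<^sub>2, - \<alpha>\<^sub>1) N \<theta>
           \<and> V_product g z (\<alpha>\<^sub>2, - \<alpha>\<^sub>1) N \<theta> \<le> exp (N * (log_mean g z + e))" by blast
  obtain \<theta> where "exp (real (Suc N0) * b) \<le> V_product g z (\<alpha>\<^sub>2, - \<alpha>\<^sub>1) (Suc N0) \<theta>"
    using large by blast
  also have "\<dots> \<le> exp (real (Suc N0) * (log_mean g z + e))"
    by (rule N0[rule_format, OF le_SucI[OF order_refl], THEN conjunct2])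
  finally show "b \<le> log_mean g z + e" by simp
qed

lemma log_mean_le:
  assumes \<alpha>: "rationally_independent \<alpha>\<^sub>1 \<alpha>\<^sub>2" and z: "z \<notin> E_set g"
    and small: "\<And>N. \<exists>\<theta>. V_product g z (\<alpha>\<^sub>2, - \<alpha>\<^sub>1) N \<theta> \<le> exp (real N * b)"
  shows "log_mean g z \<le> b"
proof (rule field_le_epsilon)
  fix e :: real assume "e > 0"
  from V_product_uniform[OF nonresonant_frequency[OF \<alpha>] z this]
  obtain N0 where N0: "\<forall>N\<ge>N0. \<forall>\<theta>. exp (N * (log_mean g z - e)) \<le> V_product g z (\<alpha>\<^sub>2, - \<alpha>\<^sub>1) N \<theta>
           \<and> V_product g z (\<alpha>\<^sub>2, - \<alpha>\<^sub>1) N \<theta> \<le> exp (N * (log_mean g z + e))" by blast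
  obtain \<theta> where \<theta>: "V_product g z (\<alpha>\<^sub>2, - \<alpha>\<^sub>1) (Suc N0) \<theta> \<le> exp (real (Suc N0) * b)"
    using small by blast
  have "exp (real (Suc N0) * (log_mean g z - e)) \<le> V_product g z (\<alpha>\<^sub>2, - \<alpha>\<^sub>1) (Suc N0) \<theta>"
    by (rule N0[rule_format, OF le_SucI[OF order_refl], THEN conjunct1])
  also note \<theta>
  finally have "log_mean g z - e \<le> b" by simp
  then show "log_mean g z \<le> b + e" by simp
qed

lemma log_mean_ge_g:
  assumes "rationally_independent \<alpha>\<^sub>1 \<alpha>\<^sub>2" "z \<notin> E_set g"
  shows "g \<le> log_mean g z"
  by (rule log_mean_ge[OF assms]) (use V_product_large in blast)

text \<open>Here the quadratic polynomials have no zeros in the closed unit disc, and the maximum principle for the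
  reciprocal of their product gives a point of the circle where the product is at most its value \<open>exp (N * g)\<close> at the origin.\<close>

lemma log_mean_inside:
  assumes \<alpha>: "rationally_independent \<alpha>\<^sub>1 \<alpha>\<^sub>2" and g: "g > 0" and z: "z \<in> filled_set g" "z \<notin> E_set g"
  shows "log_mean g z = g"
proof (rule antisym[OF log_mean_le[OF \<alpha> z(2)] log_mean_ge_g[OF \<alpha> z(2)]])
  fix N
  define \<eta> where "\<eta> = (\<alpha>\<^sub>2, - \<alpha>\<^sub>1)"
  define p where "p x = (\<Prod>k<N. joukowski_poly g (z - of_real (2 * cos (2 * pi * (0 + real k * fst \<eta>)))) (cis (2 * pi * (real k * snd \<eta>)) * x))" for x
  have nz: "p x \<noteq> 0" if x: "cmod x \<le> 1" for x
    unfolding p_def prod_zero_iff[OF finite_lessThan]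
  proof (rule notI, elim bexE)
    fix k
    define c where "c = cis (2 * pi * (real k * snd \<eta>))"
    define s where "s = 2 * cos (2 * pi * (0 + real k * fst \<eta>))"
    assume "joukowski_poly g (z - of_real (2 * cos (2 * pi * (0 + real k * fst \<eta>)))) (cis (2 * pi * (real k * snd \<eta>)) * x) = 0"
    then have root: "joukowski_poly g (z - of_real s) (c * x) = 0"
      by (simp only: c_def s_def)
    have "s \<in> {-2..2}" unfolding s_def using cos_ge_minus_one cos_le_one by auto
    then have lt: "ellipse_norm g (z - of_real s) < 1" by (rule filled_minus_E_set[OF g z])
    have "cmod (c * x) \<le> 1" using x by (simp add: c_def norm_mult)
    then show False
      using joukowski_root_location(2,3)[OF g root] lt by linarith
  qed
  have "\<exists>x. cmod x = 1 \<and> cmod (inverse (p 0)) \<le> cmod (inverse (p x))"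
  proof (rule exists_unit_circle_ge)
    show "continuous_on (cball 0 1) (\<lambda>x. inverse (p x))"
      using nz by (intro continuous_on_inverse) (auto simp: p_def intro!: continuous_intros)
    show "(\<lambda>x. inverse (p x)) holomorphic_on ball 0 1"
      using nz by (intro holomorphic_on_inverse) (auto simp: p_def intro!: holomorphic_intros)
  qed
  then obtain x where x: "cmod x = 1" "cmod (inverse (p 0)) \<le> cmod (inverse (p x))" by blast
  obtain t where t: "x = cis (2 * pi * t)" using unit_circle_angle[OF x(1)] .
  have "cmod (p 0) = exp (N * g)" by (simp add: p_def norm_power exp_of_nat_mult)
  moreover have "cmod (p x) > 0" using nz x(1) by simp
  ultimately have "cmod (p x) \<le> exp (N * g)"
    using x(2) by (simp add: norm_inverse)
  moreover have "V_product g z \<eta> N (0, t) = cmod (p x)"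
    using V_product_circle[OF t, where g=g and z=z and \<eta>=\<eta> and N=N and s=0] by (simp only: p_def)
  ultimately show "\<exists>\<theta>. V_product g z (\<alpha>\<^sub>2, - \<alpha>\<^sub>1) N \<theta> \<le> exp (real N * g)"
    unfolding \<eta>_def by (intro exI[of _ "(0, t)"]) simp
qed

text \<open>Outside the filled set each quadratic polynomial has a root in the open disc. Compactness of the set of
  parameters gives a common bound \<open>\<rho> < 1\<close> for these roots.\<close>

lemma small_roots_outside:
  assumes g: "g > 0" and z: "z \<notin> filled_set g"
  obtains \<rho> where "0 < \<rho>" "\<rho> < 1" "\<And>t x. t \<in> {-2..2} \<Longrightarrow> cmod x \<le> 1 \<Longrightarrow>
     joukowski_poly g (z - of_real t) x = 0 \<Longrightarrow> cmod x \<le> \<rho>"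
proof -
  define C where "C = ({-2..2::real} \<times> cball (0::complex) 1) \<inter>
     {w. joukowski_poly g (z - of_real (fst w)) (snd w) = 0}"
  have lt: "cmod (snd w) < 1" if w: "w \<in> C" for w
  proof (rule ccontr)
    assume "\<not> cmod (snd w) < 1"
    then have "cmod (snd w) = 1" using w by (auto simp: C_def)
    moreover have root: "joukowski_poly g (z - of_real (fst w)) (snd w) = 0"
      using w by (simp add: C_def)
    ultimately have "ellipse_norm g (z - of_real (fst w)) \<le> 1"
      using joukowski_root_location(3)[OF g root] by simp
    moreover have "fst w \<in> {-2..2}" using w by (auto simp: C_def)
    ultimately show False using z unfolding filled_set_def by blast
  qed
  have cl: "closed {w. joukowski_poly g (z - of_real (fst w)) (snd w) = 0}"
    by (intro closed_Collect_eq continuous_intros)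
  have "compact C"
    unfolding C_def by (intro compact_Int_closed compact_Times cl) auto
  show ?thesis
  proof (cases "C = {}")
    case True
    show ?thesis
    proof (rule that[of "1/2"])
      fix t x assume "t \<in> {-2..2}" "cmod x \<le> 1"
        "joukowski_poly g (z - of_real t) x = 0"
      then have "(t, x) \<in> C" by (simp add: C_def)
      with True show "cmod x \<le> 1/2" by blast
    qed auto
  next
    case False
    obtain w where w: "w \<in> C" "\<And>v. v \<in> C \<Longrightarrow> cmod (snd v) \<le> cmod (snd w)"
    proof -
      have "continuous_on C (\<lambda>w. cmod (snd w))" by (intro continuous_intros)
      from continuous_attains_sup[OF \<open>compact C\<close> False this] show ?thesis using that by blast
    qed
    show ?thesis
    proof (rule that[of "cmod (snd w)"])
      have "snd w \<noteq> 0" using w(1) by (auto simp: C_def)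
      then show "0 < cmod (snd w)" by simp
      show "cmod (snd w) < 1" by (rule lt[OF w(1)])
      fix t x assume "t \<in> {-2..2}" "cmod x \<le> 1"
        "joukowski_poly g (z - of_real t) x = 0"
      then have "(t, x) \<in> C" by (simp add: C_def)
      from w(2)[OF this] show "cmod x \<le> cmod (snd w)" by simp
    qed
  qed
qed

lemma norm_reflected_root:
  assumes "cmod y = 1"
  shows "cmod (1 - cnj a * y) = cmod (y - a)"
proof -
  have "y * cnj y = 1" using assms by (simp add: complex_norm_square[symmetric])
  then have "1 - cnj a * y = y * cnj (y - a)" by (simp add: algebra_simps)
  then show ?thesis using assms by (simp add: norm_mult del: complex_cnj_diff)
qed

text \<open>Jensen's formula in multiplicative form: each root \<open>a\<close> in the disc is reflected, \<open>y - a\<close> being replaced by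
  \<open>1 - cnj a * y\<close>, which has the same modulus on the circle. The new product has modulus at least \<open>(exp g / \<rho>) ^ N\<close> at the
  origin, so the maximum principle yields the growth rate \<open>g - ln \<rho>\<close>.\<close>

lemma log_mean_outside:
  assumes \<alpha>: "rationally_independent \<alpha>\<^sub>1 \<alpha>\<^sub>2" and g: "g > 0" and z: "z \<notin> filled_set g"
  shows "g < log_mean g z"
proof -
  have zE: "z \<notin> E_set g" using z unfolding E_set_alt[OF g] filled_set_def by force
  obtain \<rho> where \<rho>: "0 < \<rho>" "\<rho> < 1" "\<And>t x. t \<in> {-2..2} \<Longrightarrow> cmod x \<le> 1 \<Longrightarrow>
     joukowski_poly g (z - of_real t) x = 0 \<Longrightarrow> cmod x \<le> \<rho>"
    by (rule small_roots_outside[OF g z]) blast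
  define \<eta> where "\<eta> = (\<alpha>\<^sub>2, - \<alpha>\<^sub>1)"
  define s where "s k = 2 * cos (2 * pi * (0 + real k * fst \<eta>))" for k :: nat
  define c where "c k = cis (2 * pi * (real k * snd \<eta>))" for k :: nat
  have c1: "cmod (c k) = 1" for k by (simp add: c_def)
  have "\<forall>k. \<exists>x1 x2. x1 * x2 = of_real (exp (2 * g)) \<and> cmod x1 \<le> \<rho> \<and>
      (\<forall>x. joukowski_poly g (z - of_real (s k)) x = of_real (exp (- g)) * ((x - x1) * (x - x2)))"
  proof
    fix k
    obtain x1 x2 where x: "x1 * x2 = of_real (exp (2 * g))" "cmod x1 \<le> exp g"
      "\<And>x. joukowski_poly g (z - of_real (s k)) x = of_real (exp (- g)) * ((x - x1) * (x - x2))"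
      using joukowski_roots[OF g] by blast
    have root: "joukowski_poly g (z - of_real (s k)) x1 = 0"
      unfolding x(3) by simp
    have sk: "s k \<in> {-2..2}" unfolding s_def using cos_ge_minus_one cos_le_one by auto
    then have "ellipse_norm g (z - of_real (s k)) > 1" using z unfolding filled_set_def by force
    then have "cmod x1 < 1"
      using joukowski_root_location(4)[OF g root] x(2) by linarith
    then have "cmod x1 \<le> \<rho>" using \<rho>(3)[OF sk _ root] by simp
    with x show "\<exists>x1 x2. x1 * x2 = of_real (exp (2 * g)) \<and> cmod x1 \<le> \<rho> \<and>
      (\<forall>x. joukowski_poly g (z - of_real (s k)) x = of_real (exp (- g)) * ((x - x1) * (x - x2)))"
      by blast
  qed
  then obtain a b where ab: "\<And>k. a k * b k = complex_of_real (exp (2 * g))" "\<And>k. cmod (a k) \<le> \<rho>"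
    "\<And>k x. joukowski_poly g (z - of_real (s k)) x = of_real (exp (- g)) * ((x - a k) * (x - b k))"
    by metis
  have "g - ln \<rho> \<le> log_mean g z"
  proof (rule log_mean_ge[OF \<alpha> zE])
    fix N
    \<comment> \<open>The product with all small roots reflected.\<close>
    define q where "q x = (\<Prod>k<N. of_real (exp (- g)) * ((1 - cnj (a k) * (c k * x)) * (c k * x - b k)))" for x
    have "\<exists>x. cmod x = 1 \<and> cmod (q 0) \<le> cmod (q x)"
      unfolding q_def by (intro exists_unit_circle_ge continuous_intros holomorphic_intros)
    then obtain x where x: "cmod x = 1" "cmod (q 0) \<le> cmod (q x)" by blast
    obtain t where t: "x = cis (2 * pi * t)" using unit_circle_angle[OF x(1)] .
    have "V_product g z \<eta> N (0, t) = cmod (q x)"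
      unfolding V_product_circle[OF t] q_def prod_norm[symmetric]
    proof (intro prod.cong refl)
      fix k
      have "cmod (c k * x) = 1" using x(1) c1 by (simp add: norm_mult)
      then show "cmod (joukowski_poly g (z - of_real (2 * cos (2 * pi * (0 + real k * fst \<eta>)))) (cis (2 * pi * (real k * snd \<eta>)) * x)) = cmod (of_real (exp (- g)) * ((1 - cnj (a k) * (c k * x)) * (c k * x - b k)))"
        unfolding c_def[symmetric] s_def[symmetric] ab(3) by (simp add: norm_mult norm_reflected_root)
    qed
    moreover have "exp (real N * (g - ln \<rho>)) \<le> cmod (q 0)"
    proof -
      have "exp (g - ln \<rho>) \<le> exp (- g) * cmod (b k)" for k
      proof -
        have ab': "cmod (a k) * cmod (b k) = exp g * exp g"
          using arg_cong[OF ab(1)[of k], of cmod] by (simp add: norm_mult exp_double power2_eq_square)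
        have "exp g * exp g \<le> \<rho> * cmod (b k)"
          unfolding ab'[symmetric] by (intro mult_right_mono ab) auto
        then show ?thesis using \<rho> by (simp add: exp_diff exp_minus field_simps)
      qed
      then have "(\<Prod>k<N. exp (g - ln \<rho>)) \<le> (\<Prod>k<N. exp (- g) * cmod (b k))"
        by (intro prod_mono) auto
      then show ?thesis by (simp add: q_def exp_of_nat_mult prod_norm[symmetric] norm_mult)
    qed
    ultimately show "\<exists>\<theta>. exp (real N * (g - ln \<rho>)) \<le> V_product g z (\<alpha>\<^sub>2, - \<alpha>\<^sub>1) N \<theta>"
      using x(2) unfolding \<eta>_def by (intro exI[of _ "(0, t)"]) linarith
  qed
  moreover have "ln \<rho> < 0" using \<rho> by simp
  ultimately show ?thesis by linarith
qed

section \<open>Weak and critical coupling\<close>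

text \<open>If \<open>z\<close> is a value of \<open>V\<close> and has a bounded inverse, the products of \<open>\<bar>V - z\<bar>\<close> along the forward orbit of a zero
  are exponentially smaller than \<open>\<bar>\<lambda>\<bar> ^ M\<close>. The orbit is dense, so this holds on the whole torus, whereas the
  products reach \<open>exp (M * g)\<close> somewhere.\<close>

lemma E_set_in_spectrum:
  assumes \<alpha>: "rationally_independent \<alpha>\<^sub>1 \<alpha>\<^sub>2" and z: "z \<in> E_set g" and lam: "cmod lam \<le> exp g"
  shows "z \<in> ell2_spectrum (H_op g \<alpha>\<^sub>1 \<alpha>\<^sub>2 lam \<omega>)"
proof (rule ccontr)
  assume nz: "z \<notin> ell2_spectrum (H_op g \<alpha>\<^sub>1 \<alpha>\<^sub>2 lam \<omega>)"
  define \<eta> where "\<eta> = (\<alpha>\<^sub>2, - \<alpha>\<^sub>1)"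
  have \<eta>: "nonresonant \<eta>" unfolding \<eta>_def by (rule nonresonant_frequency[OF \<alpha>])
  obtain \<theta> where \<theta>: "V_at g \<theta> = z" using z E_set_range by blast
  have zero: "symbol shifts (H_coeff g z) \<theta> = 0" by (simp add: symbol_H \<theta>)
  obtain K q where Kq: "0 \<le> q" "q < 1" "0 < K"
    "\<And>M j. (\<Prod>k<M. (cmod (symbol shifts (H_coeff g z) (\<theta> + real (j + 1 + k) *\<^sub>R \<eta>)))\<^sup>2)
        \<le> K * q ^ M * (cmod (lam * cis (2 * pi * \<omega>))) ^ (2 * M)"
    using resolvent_orbit_of_zero_decay[OF nz shifts_basic(1,2) \<eta> shifts_basic(3) H_op_band[where \<alpha>\<^sub>1=\<alpha>\<^sub>1 and \<alpha>\<^sub>2=\<alpha>\<^sub>2, folded \<eta>_def] zero]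
    by blast
  have "1 \<le> K * q ^ M" for M
  proof -
    define G where "G w = (\<Prod>k<M. (cmod (V_torus g (cis (2 * pi * (real k * fst \<eta>)) * fst w,
        cis (2 * pi * (real k * snd \<eta>)) * snd w) - z))\<^sup>2)" for w
    have G: "G (torus_point \<phi>) = (V_product g z \<eta> M \<phi>)\<^sup>2" for \<phi>
      unfolding G_def prod_power_distrib V_torus
      by (intro prod.cong refl) (simp add: torus_point_def cis_mult algebra_simps)
    have "continuous_on torus G" unfolding G_def by (intro continuous_intros)
    have orb: "G (torus_point ((\<theta> + \<eta>) + real j *\<^sub>R \<eta>)) \<le> K * q ^ M * cmod lam ^ (2 * M)" for j
    proof -
      have "(\<theta> + \<eta>) + real j *\<^sub>R \<eta> + real k *\<^sub>R \<eta> = \<theta> + real (j + 1 + k) *\<^sub>R \<eta>" for k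
        by (simp add: algebra_simps)
      then have "G (torus_point ((\<theta> + \<eta>) + real j *\<^sub>R \<eta>))
          = (\<Prod>k<M. (cmod (symbol shifts (H_coeff g z) (\<theta> + real (j + 1 + k) *\<^sub>R \<eta>)))\<^sup>2)"
        by (simp only: G symbol_H prod_power_distrib)
      then show ?thesis using Kq(4)[of j M] by (simp add: norm_mult)
    qed
    obtain t where t: "exp (M * g) \<le> V_product g z \<eta> M (0, t)" using V_product_large by blast
    have "exp g ^ (2 * M) = (exp (M * g))\<^sup>2"
      unfolding exp_of_nat_mult power_mult[symmetric] by (simp add: mult.commute)
    also have "\<dots> \<le> (V_product g z \<eta> M (0, t))\<^sup>2" using t by (intro power_mono) auto
    also have "\<dots> = G (torus_point (0, t))" by (rule G[symmetric])
    also have "\<dots> \<le> K * q ^ M * cmod lam ^ (2 * M)"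
      by (rule orbit_bound_extends[OF \<eta> \<open>continuous_on torus G\<close> orb])
    also have "\<dots> \<le> K * q ^ M * exp g ^ (2 * M)"
      using Kq lam by (intro mult_left_mono power_mono) auto
    finally show ?thesis by simp
  qed
  moreover have "(\<lambda>M. K * q ^ M) \<longlonglongrightarrow> K * 0"
    using Kq by (intro tendsto_intros LIMSEQ_realpow_zero) auto
  ultimately have "1 \<le> K * 0" by (intro LIMSEQ_le_const[of "\<lambda>M. K * q ^ M"]) auto
  then show False by simp
qed

theorem spectrum_small_coupling:
  assumes \<alpha>: "rationally_independent \<alpha>\<^sub>1 \<alpha>\<^sub>2" and lam: "cmod lam < exp g"
  shows "ell2_spectrum (H_op g \<alpha>\<^sub>1 \<alpha>\<^sub>2 lam \<omega>) = E_set g"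
proof (intro equalityI subsetI)
  fix z assume z: "z \<in> ell2_spectrum (H_op g \<alpha>\<^sub>1 \<alpha>\<^sub>2 lam \<omega>)"
  show "z \<in> E_set g"
  proof (rule ccontr)
    assume zE: "z \<notin> E_set g"
    have "exp g \<le> exp (log_mean g z)" using log_mean_ge_g[OF \<alpha> zE] by simp
    then show False using resolvent_of_expanding[OF \<alpha> zE less_le_trans[OF lam]] z by blast
  qed
qed (use E_set_in_spectrum[OF \<alpha>] lam in auto)

theorem spectrum_critical_coupling:
  assumes \<alpha>: "rationally_independent \<alpha>\<^sub>1 \<alpha>\<^sub>2" and g: "g > 0" and lam: "cmod lam = exp g"
  shows "ell2_spectrum (H_op g \<alpha>\<^sub>1 \<alpha>\<^sub>2 lam \<omega>) = closure (convex hull (E_set g))"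
  unfolding closure_hull_E_set[OF g]
proof (intro equalityI subsetI)
  fix z assume z: "z \<in> ell2_spectrum (H_op g \<alpha>\<^sub>1 \<alpha>\<^sub>2 lam \<omega>)"
  show "z \<in> filled_set g"
  proof (rule ccontr)
    assume zK: "z \<notin> filled_set g"
    then have zE: "z \<notin> E_set g" unfolding E_set_alt[OF g] filled_set_def by force
    have "exp g < exp (log_mean g z)" using log_mean_outside[OF \<alpha> g zK] by simp
    then show False using resolvent_of_expanding[OF \<alpha> zE] z lam by simp
  qed
next
  fix z assume z: "z \<in> filled_set g"
  show "z \<in> ell2_spectrum (H_op g \<alpha>\<^sub>1 \<alpha>\<^sub>2 lam \<omega>)"
  proof (cases "z \<in> E_set g")
    case True
    then show ?thesis using E_set_in_spectrum[OF \<alpha>] lam by simp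
  next
    case False
    then show ?thesis using spectrum_of_neutral[OF \<alpha> False] log_mean_inside[OF \<alpha> g z] lam by simp
  qed
qed

section \<open>Holomorphic maps are real analytic\<close>

text \<open>The power series in \<open>x + \<i> y\<close> is expanded by the binomial theorem. The double series converges absolutely
  because the power series does at \<open>\<bar>x\<bar> + \<bar>y\<bar>\<close>, which is kept below half the radius of the disc.\<close>

lemma holomorphic_imp_real_analytic:
  assumes f: "f holomorphic_on U" and U: "open U"
  shows "real_analytic_on f U"
  unfolding real_analytic_on_def
proof
  fix p assume "p \<in> U"
  then obtain \<rho> where \<rho>: "\<rho> > 0" "ball p \<rho> \<subseteq> U" using U openE by blast
  define c where "c n = (deriv ^^ n) f p / fact n" for n
  have ps: "(\<lambda>n. c n * h ^ n) sums f (p + h)" if "cmod h < \<rho>" for h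
  proof -
    have "f holomorphic_on ball p \<rho>" using f \<rho> holomorphic_on_subset by blast
    from holomorphic_power_series[OF this, of "p + h"] that show ?thesis
      by (simp add: c_def dist_norm)
  qed
  \<comment> \<open>The coefficient of \<open>x ^ j * y ^ k\<close> in \<open>(\<Sum>n. c n * (x + \<i> * y) ^ n)\<close>.\<close>
  define a where "a j k = c (j + k) * of_nat ((j + k) choose k) * \<i> ^ k" for j k :: nat
  show "\<exists>a :: nat \<Rightarrow> nat \<Rightarrow> complex. \<exists>r>0. \<forall>x y :: real. \<bar>x\<bar> < r \<longrightarrow> \<bar>y\<bar> < r \<longrightarrow>
        ((\<lambda>(j, k). a j k * of_real x ^ j * of_real y ^ k) has_sum f (p + Complex x y)) UNIV"
  proof (intro exI[of _ a] exI[of _ "\<rho> / 4"] conjI allI impI)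
    show "\<rho> / 4 > 0" using \<rho> by simp
    fix x y :: real assume xy: "\<bar>x\<bar> < \<rho> / 4" "\<bar>y\<bar> < \<rho> / 4"
    define s where "s = \<bar>x\<bar> + \<bar>y\<bar>"
    have s: "0 \<le> s" "s < \<rho> / 2" using xy by (auto simp: s_def)
    define T where "T n k = c n * of_nat (n choose k) * \<i> ^ k * of_real x ^ (n - k) * of_real y ^ k" for n k
    have summ: "summable (\<lambda>n. cmod (c n) * s ^ n)"
    proof -
      have "summable (\<lambda>n. c n * of_real (\<rho> / 2) ^ n)"
        using ps[of "of_real (\<rho> / 2)"] \<rho> by (auto simp: sums_iff)
      from powser_insidea[OF this, of "of_real s"] s \<rho> show ?thesis
        by (simp add: norm_mult norm_power)
    qed
    have row: "(\<Sum>k\<le>n. T n k) = c n * (Complex x y) ^ n" for n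
    proof -
      have "Complex x y = \<i> * of_real y + of_real x" by (simp add: complex_eq_iff)
      then have "(Complex x y) ^ n = (\<Sum>k\<le>n. of_nat (n choose k) * (\<i> * of_real y) ^ k * of_real x ^ (n - k))"
        by (simp only: binomial_ring)
      then show ?thesis by (simp add: T_def sum_distrib_left power_mult_distrib mult_ac)
    qed
    have rownorm: "(\<Sum>k\<le>n. cmod (T n k)) = cmod (c n) * s ^ n" for n
    proof -
      have "s ^ n = (\<Sum>k\<le>n. of_nat (n choose k) * \<bar>y\<bar> ^ k * \<bar>x\<bar> ^ (n - k))"
        unfolding s_def add.commute[of "\<bar>x\<bar>"] by (rule binomial_ring)
      then show ?thesis
        by (simp add: T_def sum_distrib_left norm_mult norm_power mult_ac)
    qed
    have "(\<lambda>(n, k). cmod (T n k)) summable_on (SIGMA n:UNIV. {..n})"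
    proof (rule summable_on_SigmaI[where g="\<lambda>n. cmod (c n) * s ^ n"])
      show "((\<lambda>k. case (n, k) of (n, k) \<Rightarrow> cmod (T n k)) has_sum cmod (c n) * s ^ n) {..n}" for n
        using has_sum_finite[of "{..n}" "\<lambda>k. cmod (T n k)"] by (simp add: rownorm)
      show "(\<lambda>n. cmod (c n) * s ^ n) summable_on UNIV"
        using summ s by (intro norm_summable_imp_summable_on) simp
    qed auto
    then have "(\<lambda>w. cmod (case w of (n, k) \<Rightarrow> T n k)) summable_on (SIGMA n:UNIV. {..n})"
      by (simp add: case_prod_unfold)
    then have sT: "(\<lambda>(n, k). T n k) summable_on (SIGMA n:UNIV. {..n})"
      by (rule abs_summable_summable)
    have "((\<lambda>(n, k). T n k) has_sum f (p + Complex x y)) (SIGMA n:UNIV. {..n})"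
    proof (rule has_sum_SigmaI[where g="\<lambda>n. c n * (Complex x y) ^ n"])
      show "((\<lambda>k. case (n, k) of (n, k) \<Rightarrow> T n k) has_sum c n * (Complex x y) ^ n) {..n}" for n
        using has_sum_finite[of "{..n}" "\<lambda>k. T n k"] by (simp add: row)
      have h: "cmod (Complex x y) \<le> s" unfolding s_def using cmod_le[of "Complex x y"] by simp
      then have "cmod (Complex x y) < \<rho>" using s \<rho> by linarith
      moreover have "summable (\<lambda>n. cmod (c n * Complex x y ^ n))"
        by (rule summable_comparison_test'[OF summ, of 0])
           (use h in \<open>auto simp: norm_mult norm_power intro!: mult_left_mono power_mono\<close>)
      ultimately show "((\<lambda>n. c n * (Complex x y) ^ n) has_sum f (p + Complex x y)) UNIV"
        by (intro norm_summable_imp_has_sum ps)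
    qed (rule sT)
    moreover have "bij_betw (\<lambda>(j, k). (j + k, k)) UNIV (SIGMA n:(UNIV::nat set). {..n})"
      by (rule bij_betwI[of _ _ _ "\<lambda>(n, k). (n - k, k)"]) auto
    ultimately have "((\<lambda>w. case (case w of (j, k) \<Rightarrow> (j + k, k)) of (n, k) \<Rightarrow> T n k) has_sum f (p + Complex x y)) UNIV"
      by (subst has_sum_reindex_bij_betw)
    then show "((\<lambda>(j, k). a j k * of_real x ^ j * of_real y ^ k) has_sum f (p + Complex x y)) UNIV"
      by (simp add: T_def a_def case_prod_unfold)
  qed
qed

section \<open>The exponent on the range of the symbol\<close>

abbreviation unit_square :: "(real \<times> real) set" where
  "unit_square \<equiv> {0..1} \<times> {0..1}"

lemma unit_square_cbox: "unit_square = cbox (0, 0) (1, 1)"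
  by (auto simp: cbox_Pair_eq)

lemma set_integrable_continuous:
  fixes F :: "real \<times> real \<Rightarrow> real"
  assumes "continuous_on UNIV F"
  shows "set_integrable lborel unit_square F"
  unfolding set_integrable_def unit_square_cbox
  by (rule borel_integrable_compact) (auto intro: continuous_on_subset[OF assms])

lemma torus_mean_eq_LINT:
  fixes F :: "real \<times> real \<Rightarrow> real"
  assumes "continuous_on UNIV F"
  shows "(LINT \<theta>:unit_square|lborel. F \<theta>) = torus_mean F"
  using set_borel_integral_eq_integral(2)[OF set_integrable_continuous[OF assms]]
  by (simp add: torus_mean_def unit_square_cbox)

lemma G2_eq_log_mean:
  assumes "z \<notin> E_set g"
  shows "G2 g z = log_mean g z"
proof -
  have "continuous_on UNIV (\<lambda>\<theta>. ln (cmod (V_torus g (torus_point \<theta>) - z)))"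
    by (rule continuous_on_torus_comp[OF continuous_on_log_V[OF assms]])
  from torus_mean_eq_LINT[OF this] show ?thesis
    by (simp add: G2_def log_mean_def V_torus norm_minus_commute)
qed

lemma cmod_V_le: "cmod (V g s t) \<le> exp g + exp (- g) + 2"
proof -
  have "cmod (V g s t) \<le> cmod (of_real (2 * cos (2 * pi * s))) + cmod (of_real (exp (- g)) * cis (2 * pi * t))
          + cmod (of_real (exp g) * cis (- 2 * pi * t))"
    unfolding V_def by (meson norm_triangle_ineq order_trans add_right_mono)
  also have "\<dots> = 2 * \<bar>cos (2 * pi * s)\<bar> + exp (- g) + exp g"
    by (simp add: norm_mult del: of_real_mult)
  also have "\<dots> \<le> exp g + exp (- g) + 2" using abs_cos_le_one[of "2 * pi * s"] by simp
  finally show ?thesis .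
qed

text \<open>A logarithm that failed to be integrable would have integral \<open>0\<close> by convention, which still respects the
  bound \<open>C \<ge> 0\<close>.\<close>

lemma G2_bounded_above: "bdd_above (G2 g ` {z. cmod z \<le> R})"
proof (rule bdd_aboveI2)
  fix z assume "z \<in> {z. cmod z \<le> R}"
  then have z: "cmod z \<le> R" by simp
  define C where "C = \<bar>R\<bar> + (exp g + exp (- g) + 2)"
  have C: "C \<ge> 0" by (simp add: C_def add_nonneg_nonneg)
  define f where "f \<theta> = ln (cmod (z - V_at g \<theta>))" for \<theta>
  have fC: "f \<theta> \<le> C" for \<theta>
  proof -
    have "cmod (z - V_at g \<theta>) \<le> C"
      using norm_triangle_ineq4[of z "V_at g \<theta>"] cmod_V_le[of g "fst \<theta>" "snd \<theta>"] z
      by (simp add: C_def)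
    moreover have "ln (cmod (z - V_at g \<theta>)) \<le> cmod (z - V_at g \<theta>)"
      by (cases "z = V_at g \<theta>") (auto intro: ln_bound)
    ultimately show ?thesis by (simp add: f_def)
  qed
  show "G2 g z \<le> C"
  proof (cases "set_integrable lborel unit_square f")
    case True
    have "(LINT \<theta>:unit_square|lborel. f \<theta>) \<le> (LINT \<theta>:unit_square|lborel. C)"
      by (rule set_integral_mono[OF True set_integrable_continuous]) (auto simp: fC)
    also have "\<dots> = C" by (subst torus_mean_eq_LINT) (auto simp: torus_mean_const)
    finally show ?thesis by (simp add: G2_def f_def)
  next
    case False
    then have "(LINT \<theta>:unit_square|lborel. f \<theta>) = 0"
      by (simp add: set_integrable_def set_lebesgue_integral_def not_integrable_integral_eq)
    then show ?thesis using C by (simp add: G2_def f_def)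
  qed
qed

text \<open>As \<open>\<epsilon>\<close> decreases to \<open>0\<close>, the truncated logarithms decrease. Off the zero set of \<open>V - z\<close> monotone convergence
  applies; if all the truncated means were at least \<open>L\<close>, it would give integrability and \<open>G2 g z \<ge> L\<close>. On the
  zero set the truncated logarithms are at most \<open>0 = ln 0\<close>, so this set can only help.\<close>

lemma truncated_log_mean_less:
  assumes L: "G2 g z < L"
  shows "\<exists>\<epsilon>>0. torus_mean (\<lambda>\<theta>. ln (max (cmod (V_at g \<theta> - z)) \<epsilon>)) < L"
proof (rule ccontr)
  assume "\<not> ?thesis"
  then have ge: "L \<le> torus_mean (\<lambda>\<theta>. ln (max (cmod (V_at g \<theta> - z)) \<epsilon>))" if "\<epsilon> > 0" for \<epsilon>
    using that by force
  define f where "f \<theta> = cmod (V_at g \<theta> - z)" for \<theta>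
  define \<epsilon> where "\<epsilon> n = 1 / real (Suc n)" for n
  have \<epsilon>: "\<epsilon> n > 0" "\<epsilon> n \<le> 1" for n by (auto simp: \<epsilon>_def)
  have \<epsilon>mono: "\<epsilon> n \<le> \<epsilon> m" if "m \<le> n" for m n using that by (simp add: \<epsilon>_def frac_le)
  define F where "F n \<theta> = ln (max (f \<theta>) (\<epsilon> n))" for n \<theta>
  have contf: "continuous_on UNIV f"
    unfolding f_def V_torus by (intro continuous_intros)
  have mpos: "0 < max (f \<theta>) (\<epsilon> n)" for n \<theta>
    using \<epsilon>(1)[of n] by (simp add: less_max_iff_disj)
  have contF: "continuous_on UNIV (F n)" for n
    unfolding F_def by (intro continuous_intros contf ballI mpos[THEN less_imp_neq, symmetric])
  have [measurable]: "f \<in> borel_measurable borel" using contf by (rule borel_measurable_continuous_onI)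
  have [measurable]: "F n \<in> borel_measurable borel" for n using contF by (rule borel_measurable_continuous_onI)
  have sq [measurable]: "unit_square \<in> sets borel" by (simp add: unit_square_cbox)
  have iF: "integrable lborel (\<lambda>\<theta>. indicat_real unit_square \<theta> * F n \<theta>)" for n
    using set_integrable_continuous[OF contF] by (simp add: set_integrable_def)
  \<comment> \<open>The indicator of the part of the square where \<open>V - z\<close> does not vanish.\<close>
  define D where "D \<theta> = indicat_real (unit_square \<inter> {\<theta>. f \<theta> \<noteq> 0}) \<theta>" for \<theta>
  have Dm [measurable]: "D \<in> borel_measurable borel"
    unfolding D_def[abs_def] by measurable
  have D: "D \<theta> = (if \<theta> \<in> unit_square \<and> f \<theta> \<noteq> 0 then 1 else 0)" for \<theta> by (simp add: D_def indicator_def)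
  have iDF: "integrable lborel (\<lambda>\<theta>. D \<theta> * F n \<theta>)" for n
    by (rule Bochner_Integration.integrable_bound[OF iF[of n]])
       (auto simp: D indicator_def)
  define k where "k n \<theta> = D \<theta> * F 0 \<theta> - D \<theta> * F n \<theta>" for n \<theta>
  define u where "u \<theta> = D \<theta> * (F 0 \<theta> - ln (f \<theta>))" for \<theta>
  have f0: "0 \<le> f \<theta>" for \<theta> by (simp add: f_def)
  have ik: "integrable lborel (k n)" for n unfolding k_def by (intro Bochner_Integration.integrable_diff iDF)
  have monoF: "F n \<theta> \<le> F m \<theta>" if "m \<le> n" for m n \<theta>
    unfolding F_def ln_le_cancel_iff[OF mpos mpos] using \<epsilon>mono[OF that] by (rule max.mono[OF order_refl])
  have monok: "mono (\<lambda>n. k n \<theta>)" for \<theta>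
    unfolding k_def by (rule monoI) (use monoF[of _ _ \<theta>] in \<open>auto simp: D\<close>)
  have limk: "(\<lambda>n. k n \<theta>) \<longlonglongrightarrow> u \<theta>" for \<theta>
  proof (cases "D \<theta> = 0")
    case True
    then show ?thesis by (simp add: k_def u_def)
  next
    case False
    then have pos: "f \<theta> > 0" "D \<theta> = 1" using f0[of \<theta>] by (auto simp: D split: if_splits)
    have "\<epsilon> \<longlonglongrightarrow> 0" unfolding \<epsilon>_def by (rule LIMSEQ_inverse_real_of_nat[unfolded inverse_eq_divide])
    then have "(\<lambda>n. max (f \<theta>) (\<epsilon> n)) \<longlonglongrightarrow> max (f \<theta>) 0" by (intro tendsto_intros)
    then have "(\<lambda>n. ln (max (f \<theta>) (\<epsilon> n))) \<longlonglongrightarrow> ln (f \<theta>)"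
      using pos by (intro tendsto_ln) (auto simp: max_def)
    then show ?thesis unfolding k_def u_def F_def pos by (auto intro!: tendsto_intros)
  qed
  define M where "M = integral\<^sup>L lborel (\<lambda>\<theta>. D \<theta> * F 0 \<theta>)"
  have kM: "integral\<^sup>L lborel (k n) \<le> M - L" for n
  proof -
    have "L \<le> torus_mean (F n)" using ge[OF \<epsilon>(1)] by (simp add: F_def[abs_def] f_def)
    also have "\<dots> = integral\<^sup>L lborel (\<lambda>\<theta>. indicat_real unit_square \<theta> * F n \<theta>)"
      by (simp add: torus_mean_eq_LINT[OF contF, symmetric] set_lebesgue_integral_def)
    also have "\<dots> \<le> integral\<^sup>L lborel (\<lambda>\<theta>. D \<theta> * F n \<theta>)"
    proof (rule integral_mono[OF iF iDF])
      fix \<theta>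
      have "F n \<theta> \<le> 0" if "f \<theta> = 0" using that \<epsilon>[of n] by (simp add: F_def)
      then show "indicat_real unit_square \<theta> * F n \<theta> \<le> D \<theta> * F n \<theta>" by (auto simp: D indicator_def)
    qed
    finally show ?thesis
      unfolding k_def M_def by (subst Bochner_Integration.integral_diff[OF iDF iDF]) simp
  qed
  have "incseq (\<lambda>n. integral\<^sup>L lborel (k n))"
    by (intro monoI integral_mono ik) (use monok in \<open>auto simp: mono_def\<close>)
  then obtain x where x: "(\<lambda>n. integral\<^sup>L lborel (k n)) \<longlonglongrightarrow> x"
    using incseq_convergent[of "\<lambda>n. integral\<^sup>L lborel (k n)" "M - L"] kM by metis
  have xM: "x \<le> M - L" by (rule LIMSEQ_le_const2[OF x]) (use kM in auto)
  have um: "u \<in> borel_measurable lborel" unfolding u_def[abs_def] by measurable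
  have u: "integrable lborel u" "integral\<^sup>L lborel u = x"
    by (rule integrable_monotone_convergence integral_monotone_convergence; use ik monok limk x um in auto)+
  have "G2 g z = integral\<^sup>L lborel (\<lambda>\<theta>. D \<theta> * F 0 \<theta> - u \<theta>)"
    unfolding G2_def set_lebesgue_integral_def
    by (intro Bochner_Integration.integral_cong refl)
       (auto simp: D u_def indicator_def f_def norm_minus_commute algebra_simps)
  also have "\<dots> = M - x" unfolding M_def u(2)[symmetric] by (rule Bochner_Integration.integral_diff[OF iDF u(1)])
  finally show False using xM L by linarith
qed

section \<open>Strong coupling\<close>

text \<open>The maximum of \<open>\<bar>V\<bar>\<close>, attained at the origin.\<close>

definition V_bound :: "real \<Rightarrow> real" where
  "V_bound g = exp g + exp (- g) + 2"

lemma V_bound_pos: "0 < V_bound g"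
  by (simp add: V_bound_def add_pos_pos)

lemma not_in_E_set_outer: "V_bound g < cmod z \<Longrightarrow> z \<notin> E_set g"
proof
  assume z: "V_bound g < cmod z" and "z \<in> E_set g"
  then obtain \<theta> where "V_at g \<theta> = z" using E_set_range by blast
  then show False using cmod_V_le[of g "fst \<theta>" "snd \<theta>"] z by (simp add: V_bound_def)
qed

lemma quotient_small:
  assumes "V_bound g < cmod z"
  shows "cmod (V_torus g (torus_point \<theta>) / z) \<le> V_bound g / cmod z" "V_bound g / cmod z < 1"
proof -
  have "cmod z > 0" using assms V_bound_pos[of g] by linarith
  then show "cmod (V_torus g (torus_point \<theta>) / z) \<le> V_bound g / cmod z" "V_bound g / cmod z < 1"
    using cmod_V_le[of g "fst \<theta>" "snd \<theta>"] assms
    unfolding V_torus V_bound_def[symmetric] by (simp_all add: norm_divide divide_right_mono)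
qed

lemma one_minus_quotient:
  assumes "V_bound g < cmod z"
  shows "0 < Re (1 - V_torus g (torus_point \<theta>) / z)"
  using quotient_small(1)[OF assms, of \<theta>] quotient_small(2)[OF assms] complex_Re_le_cmod[of "V_torus g (torus_point \<theta>) / z"] by simp

text \<open>The logarithmic potential \<open>G2 g z\<close> is the real part of \<open>Ln z + log_potential g z\<close>. Since \<open>1 - V / z\<close> stays in the right
  half plane when \<open>\<bar>z\<bar>\<close> exceeds \<open>V_bound g\<close>, the principal branch is holomorphic there.\<close>

definition log_potential :: "real \<Rightarrow> complex \<Rightarrow> complex" where
  "log_potential g z = torus_mean (\<lambda>\<theta>. Ln (1 - V_torus g (torus_point \<theta>) / z))"

lemma torus_mean_Re:
  assumes "continuous_on UNIV F"
  shows "Re (torus_mean F) = torus_mean (\<lambda>\<theta>. Re (F \<theta>))"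
  using integral_linear[OF integrable_continuous[OF continuous_on_subset[OF assms subset_UNIV]] bounded_linear_Re]
  unfolding torus_mean_def by (simp add: o_def)

lemma continuous_on_Ln_quotient:
  assumes "V_bound g < cmod z"
  shows "continuous_on UNIV (\<lambda>\<theta>. Ln (1 - V_torus g (torus_point \<theta>) / z))"
proof -
  have "z \<noteq> 0" using assms V_bound_pos[of g] by auto
  moreover have "1 - V_torus g (torus_point \<theta>) / z \<notin> \<real>\<^sub>\<le>\<^sub>0" for \<theta>
    using one_minus_quotient[OF assms, of \<theta>] unfolding complex_nonpos_Reals_iff by linarith
  ultimately show ?thesis by (intro continuous_intros) blast+
qed

lemma G2_log_potential:
  assumes z: "V_bound g < cmod z"
  shows "G2 g z = ln (cmod z) + Re (log_potential g z)"
proof -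
  have z0: "z \<noteq> 0" using z V_bound_pos[of g] by auto
  have nz: "1 - V_torus g (torus_point \<theta>) / z \<noteq> 0" for \<theta>
    using one_minus_quotient[OF z, of \<theta>] by force
  have "log_mean g z = torus_mean (\<lambda>\<theta>. ln (cmod z) + Re (Ln (1 - V_torus g (torus_point \<theta>) / z)))"
    unfolding log_mean_def
  proof (rule arg_cong[where f=torus_mean], rule ext)
    fix \<theta>
    have "cmod (V_at g \<theta> - z) = cmod z * cmod (1 - V_torus g (torus_point \<theta>) / z)"
      unfolding V_torus norm_mult[symmetric] using z0 by (simp add: right_diff_distrib norm_minus_commute)
    then show "ln (cmod (V_at g \<theta> - z)) = ln (cmod z) + Re (Ln (1 - V_torus g (torus_point \<theta>) / z))"
      using z0 nz[of \<theta>] by (simp add: ln_mult)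
  qed
  also have "\<dots> = ln (cmod z) + torus_mean (\<lambda>\<theta>. Re (Ln (1 - V_torus g (torus_point \<theta>) / z)))"
    using torus_mean_const[of "ln (cmod z)"] unfolding torus_mean_def
    by (subst integral_add) (auto intro!: integrable_continuous continuous_on_Re continuous_on_subset[OF continuous_on_Ln_quotient[OF z]])
  also have "torus_mean (\<lambda>\<theta>. Re (Ln (1 - V_torus g (torus_point \<theta>) / z))) = Re (log_potential g z)"
    unfolding log_potential_def by (rule torus_mean_Re[OF continuous_on_Ln_quotient[OF z], symmetric])
  finally show ?thesis using G2_eq_log_mean[OF not_in_E_set_outer[OF z]] by simp
qed

lemma log_potential_deriv:
  assumes z: "V_bound g < cmod z"
  shows "(log_potential g has_field_derivative
     torus_mean (\<lambda>\<theta>. (V_torus g (torus_point \<theta>) / z\<^sup>2) / (1 - V_torus g (torus_point \<theta>) / z))) (at z)"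
proof -
  define U where "U = ball z (cmod z - V_bound g)"
  have U: "V_bound g < cmod w" if "w \<in> U" for w
  proof -
    have "cmod z \<le> cmod w + dist z w" using norm_triangle_sub[of z w] by (simp add: dist_norm)
    then show ?thesis using that by (simp add: U_def)
  qed
  have zU: "z \<in> U" using z by (simp add: U_def)
  have "((\<lambda>w. integral (cbox (0, 0) (1, 1)) (\<lambda>\<theta>. Ln (1 - V_torus g (torus_point \<theta>) / w))) has_field_derivative
      integral (cbox (0, 0) (1, 1)) (\<lambda>\<theta>. (V_torus g (torus_point \<theta>) / z\<^sup>2) / (1 - V_torus g (torus_point \<theta>) / z))) (at z within U)"
  proof (rule leibniz_rule_field_derivative[OF _ _ _ zU])
    fix w \<theta> assume w: "w \<in> U"
    have w0: "w \<noteq> 0" using U[OF w] V_bound_pos[of g] by auto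
    have "1 - V_torus g (torus_point \<theta>) / w \<notin> \<real>\<^sub>\<le>\<^sub>0"
      using one_minus_quotient[OF U[OF w], of \<theta>] by (auto simp: complex_nonpos_Reals_iff)
    then show "((\<lambda>w. Ln (1 - V_torus g (torus_point \<theta>) / w)) has_field_derivative
         (V_torus g (torus_point \<theta>) / w\<^sup>2) / (1 - V_torus g (torus_point \<theta>) / w)) (at w within U)"
      using w0 by (auto intro!: derivative_eq_intros simp: power2_eq_square) (simp add: divide_inverse mult_ac)
  next
    fix w assume w: "w \<in> U"
    show "(\<lambda>\<theta>. Ln (1 - V_torus g (torus_point \<theta>) / w)) integrable_on cbox (0, 0) (1, 1)"
      by (intro integrable_continuous continuous_on_subset[OF continuous_on_Ln_quotient[OF U[OF w]]]) auto
  next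
    have "continuous_on (U \<times> cbox (0, 0) (1, 1)) (\<lambda>v. (V_torus g (torus_point (snd v)) / (fst v)\<^sup>2) / (1 - V_torus g (torus_point (snd v)) / fst v))"
    proof (intro continuous_intros ballI)
      fix v assume v: "v \<in> U \<times> cbox (0::real, 0::real) (1, 1)"
      then have w: "V_bound g < cmod (fst v)" using U by auto
      show "fst v \<noteq> 0" "(fst v)\<^sup>2 \<noteq> 0" using w V_bound_pos[of g] by auto
      show "1 - V_torus g (torus_point (snd v)) / fst v \<noteq> 0"
        using one_minus_quotient[OF w, of "snd v"] by force
    qed
    then show "continuous_on (U \<times> cbox (0, 0) (1, 1)) (\<lambda>(w, \<theta>). (V_torus g (torus_point \<theta>) / w\<^sup>2) / (1 - V_torus g (torus_point \<theta>) / w))"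
      by (simp add: case_prod_unfold)
  qed (auto simp: U_def)
  moreover have "at z within U = at z" using zU by (intro at_within_open) (auto simp: U_def)
  ultimately show ?thesis unfolding log_potential_def[abs_def] torus_mean_def by simp
qed

lemma log_potential_holomorphic: "log_potential g holomorphic_on {z. V_bound g < cmod z}"
proof -
  have "open {z. V_bound g < cmod z}" by (intro open_Collect_less continuous_intros)
  then show ?thesis
    unfolding holomorphic_on_open[OF \<open>open _\<close>] using log_potential_deriv by blast
qed

text \<open>The expression times \<open>z\<close> is the mean of \<open>1 / (1 - W)\<close> with \<open>W = V / z\<close>. As \<open>\<bar>W\<bar> \<le> r < 1\<close>, the real part of the
  integrand is at least \<open>1 / (1 + r) > 0\<close>.\<close>

lemma gradient_nonzero:
  assumes z: "V_bound g < cmod z"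
  shows "1 / z + deriv (log_potential g) z \<noteq> 0"
proof
  define W where "W \<theta> = V_torus g (torus_point \<theta>) / z" for \<theta>
  define r where "r = V_bound g / cmod z"
  have z0: "z \<noteq> 0" using z V_bound_pos[of g] by auto
  have W: "cmod (W \<theta>) \<le> r" "r < 1" for \<theta> using quotient_small(1)[OF z, of \<theta>] quotient_small(2)[OF z] by (auto simp: W_def r_def)
  have nz: "1 - W \<theta> \<noteq> 0" for \<theta> using W(1)[of \<theta>] W(2) by force
  have contW: "continuous_on A W" for A
    unfolding W_def by (intro continuous_intros) (use z0 in blast)
  have cW: "continuous_on A (\<lambda>\<theta>. W \<theta> / (1 - W \<theta>))" for A
    by (intro continuous_intros contW) (use nz in auto)
  have d: "z * deriv (log_potential g) z = torus_mean (\<lambda>\<theta>. W \<theta> / (1 - W \<theta>))"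
  proof -
    have "deriv (log_potential g) z = torus_mean (\<lambda>\<theta>. (V_torus g (torus_point \<theta>) / z\<^sup>2) / (1 - V_torus g (torus_point \<theta>) / z))"
      by (rule DERIV_imp_deriv[OF log_potential_deriv[OF z]])
    then have "z * deriv (log_potential g) z = torus_mean (\<lambda>\<theta>. z * ((V_torus g (torus_point \<theta>) / z\<^sup>2) / (1 - V_torus g (torus_point \<theta>) / z)))"
      unfolding torus_mean_def by (simp only: integral_mult_right)
    also have "(\<lambda>\<theta>. z * ((V_torus g (torus_point \<theta>) / z\<^sup>2) / (1 - V_torus g (torus_point \<theta>) / z))) = (\<lambda>\<theta>. W \<theta> / (1 - W \<theta>))"
      using z0 by (simp add: W_def power2_eq_square)
    finally show ?thesis .
  qed
  have Re: "Re (W \<theta> / (1 - W \<theta>)) \<ge> - r / (1 + r)" for \<theta>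
  proof -
    have r: "0 \<le> r" using W(1)[of \<theta>] norm_ge_zero order_trans by blast
    have "W \<theta> / (1 - W \<theta>) = 1 / (1 - W \<theta>) - 1" using nz[of \<theta>] by (simp add: field_simps)
    then have "Re (W \<theta> / (1 - W \<theta>)) = Re (1 / (1 - W \<theta>)) - 1" by (simp only: minus_complex.sel one_complex.sel)
    moreover have "- r / (1 + r) = 1 / (1 + r) - 1" using r by (simp add: field_simps)
    moreover have "Re (1 / (1 - W \<theta>)) \<ge> 1 / (1 + r)"
    proof -
      define a b where "a = Re (W \<theta>)" and "b = Im (W \<theta>)"
      have ab: "a\<^sup>2 + b\<^sup>2 \<le> r\<^sup>2" using power_mono[OF W(1)[of \<theta>], of 2] by (simp add: a_def b_def cmod_power2)
      have ar: "\<bar>a\<bar> \<le> r" using abs_Re_le_cmod[of "W \<theta>"] W(1)[of \<theta>] by (simp add: a_def)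
      have pos: "(1 - a)\<^sup>2 + b\<^sup>2 > 0" using ar W(2) by (intro add_pos_nonneg) auto
      have eq: "Re (1 / (1 - W \<theta>)) = (1 - a) / ((1 - a)\<^sup>2 + b\<^sup>2)"
        by (simp add: Re_divide a_def b_def power2_eq_square)
      have "(1 - a)\<^sup>2 + b\<^sup>2 \<le> (1 - a) * (1 + r)"
      proof -
        have "(1 - a) * (1 + r) - ((1 - a)\<^sup>2 + b\<^sup>2) \<ge> (1 - a) * (1 + r) - (1 - 2 * a + r\<^sup>2)"
          using ab by (simp add: power2_eq_square algebra_simps)
        also have "(1 - a) * (1 + r) - (1 - 2 * a + r\<^sup>2) = (1 - r) * (r + a)"
          by (simp add: power2_eq_square algebra_simps)
        finally show ?thesis using ar W(2) by (smt (verit) mult_nonneg_nonneg abs_le_D2)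
      qed
      then have "1 / (1 + r) \<le> (1 - a) / ((1 - a)\<^sup>2 + b\<^sup>2)"
        using pos r by (simp add: field_simps)
      then show ?thesis using eq by simp
    qed
    ultimately show ?thesis by linarith
  qed
  have r0: "0 \<le> r" using W(1)[of 0] norm_ge_zero order_trans by blast
  have "- r / (1 + r) = torus_mean (\<lambda>\<theta>. - r / (1 + r))" by (simp only: torus_mean_const)
  also have "\<dots> \<le> torus_mean (\<lambda>\<theta>. Re (W \<theta> / (1 - W \<theta>)))"
    by (rule torus_mean_mono) (use Re cW in \<open>auto intro: continuous_on_Re\<close>)
  also have "\<dots> = Re (torus_mean (\<lambda>\<theta>. W \<theta> / (1 - W \<theta>)))"
    by (rule torus_mean_Re[symmetric, OF cW])
  finally have "- r / (1 + r) \<le> Re (z * deriv (log_potential g) z)" unfolding d .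
  moreover assume "1 / z + deriv (log_potential g) z = 0"
  then have "z * deriv (log_potential g) z = - 1"
    using z0 by (simp add: add_eq_0_iff field_simps)
  ultimately have "- r / (1 + r) \<le> -1" by simp
  then show False using r0 by (simp add: field_simps)
qed

definition outer_level_set :: "real \<Rightarrow> real \<Rightarrow> real \<Rightarrow> complex set" where
  "outer_level_set g R L = {z. R < cmod z \<and> G2 g z = L}"

text \<open>Near \<open>p\<close> the function \<open>G2 g - L\<close> is the imaginary part of a holomorphic function with nonzero derivative at \<open>p\<close>. That
  function is locally biholomorphic and serves as the straightening map. The branch \<open>Ln (z / p) + ln \<bar>p\<bar>\<close> of the
  logarithm is used because \<open>z / p\<close> is near \<open>1\<close>.\<close>

lemma outer_level_set_straightening:
  assumes R: "V_bound g \<le> R" and p: "p \<in> outer_level_set g R L"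
  shows "\<exists>U W \<phi> \<psi>. open U \<and> p \<in> U \<and> open W \<and>
        real_analytic_on \<phi> U \<and> real_analytic_on \<psi> W \<and>
        \<phi> ` U = W \<and> (\<forall>z\<in>U. \<psi> (\<phi> z) = z) \<and>
        \<phi> ` (outer_level_set g R L \<inter> U) = {w \<in> W. Im w = 0}"
proof -
  have pR: "R < cmod p" using p by (simp add: outer_level_set_def)
  have p0: "p \<noteq> 0" using pR R V_bound_pos[of g] by auto
  define A where "A = {z. R < cmod z} \<inter> {z. 0 < Re (z / p)}"
  have "open {z. R < cmod z}" "open {z. 0 < Re (z / p)}"
    by (intro open_Collect_less continuous_intros; use p0 in blast)+
  then have oA: "open A" unfolding A_def by (rule open_Int)
  have pA: "p \<in> A" using pR p0 by (simp add: A_def)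
  define F where "F z = \<i> * (Ln (z / p) + log_potential g z + of_real (ln (cmod p) - L))" for z
  have VA: "V_bound g < cmod z" if "z \<in> A" for z using that R by (auto simp: A_def)
  have nonpos: "z / p \<notin> \<real>\<^sub>\<le>\<^sub>0" if "z \<in> A" for z using that by (auto simp: A_def complex_nonpos_Reals_iff)
  have holF: "F holomorphic_on A"
    unfolding F_def using VA nonpos p0
    by (intro holomorphic_intros holomorphic_on_subset[OF log_potential_holomorphic]) auto
  have dF: "deriv F p \<noteq> 0"
  proof -
    have "(log_potential g has_field_derivative deriv (log_potential g) p) (at p)"
      unfolding DERIV_imp_deriv[OF log_potential_deriv[OF VA[OF pA]]] by (rule log_potential_deriv[OF VA[OF pA]])
    then have "(F has_field_derivative \<i> * (1 / p + deriv (log_potential g) p)) (at p)"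
      unfolding F_def using p0 nonpos[OF pA] by (auto intro!: derivative_eq_intros)
    then have "deriv F p = \<i> * (1 / p + deriv (log_potential g) p)" by (rule DERIV_imp_deriv)
    then show ?thesis using gradient_nonzero[OF VA[OF pA]] by simp
  qed
  have ImF: "Im (F z) = G2 g z - L" if "z \<in> A" for z
  proof -
    have z0: "z \<noteq> 0" using VA[OF that] V_bound_pos[of g] by auto
    have "Im (F z) = ln (cmod (z / p)) + Re (log_potential g z) + (ln (cmod p) - L)"
      using z0 p0 by (simp add: F_def)
    also have "ln (cmod (z / p)) = ln (cmod z) - ln (cmod p)"
      using z0 p0 by (simp add: norm_divide ln_div)
    finally show ?thesis using G2_log_potential[OF VA[OF that]] by simp
  qed
  obtain r where r: "r > 0" "ball p r \<subseteq> A" "inj_on F (ball p r)"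
    using has_complex_derivative_locally_injective[OF holF pA oA dF] .
  have holB: "F holomorphic_on ball p r" using holF r(2) by (rule holomorphic_on_subset)
  have "\<exists>\<psi>. \<psi> holomorphic_on (F ` ball p r) \<and> (\<forall>z\<in>ball p r. \<psi> (F z) = z)"
  proof (rule holomorphic_has_inverse[OF holB open_ball r(3)])
    fix \<psi> assume "\<psi> holomorphic_on (F ` ball p r)" "\<And>z. z \<in> ball p r \<Longrightarrow> \<psi> (F z) = z"
    then show "\<exists>\<psi>. \<psi> holomorphic_on (F ` ball p r) \<and> (\<forall>z\<in>ball p r. \<psi> (F z) = z)" by blast
  qed
  then obtain \<psi> where \<psi>: "\<psi> holomorphic_on (F ` ball p r)" "\<forall>z\<in>ball p r. \<psi> (F z) = z"
    by blast
  have oW: "open (F ` ball p r)" by (rule open_mapping_thm3[OF holB open_ball r(3)])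
  have level: "F ` (outer_level_set g R L \<inter> ball p r) = {w \<in> F ` ball p r. Im w = 0}"
  proof -
    have "z \<in> outer_level_set g R L \<longleftrightarrow> Im (F z) = 0" if "z \<in> ball p r" for z
      using subsetD[OF r(2) that] ImF[of z] by (simp add: outer_level_set_def A_def)
    then show ?thesis by blast
  qed
  show ?thesis
  proof (rule exI[of _ "ball p r"], rule exI[of _ "F ` ball p r"], rule exI[of _ F], rule exI[of _ \<psi>], intro conjI)
    show "real_analytic_on F (ball p r)" by (rule holomorphic_imp_real_analytic[OF holB open_ball])
    show "real_analytic_on \<psi> (F ` ball p r)" by (rule holomorphic_imp_real_analytic[OF \<psi>(1) oW])
    show "\<forall>z\<in>ball p r. \<psi> (F z) = z" by (rule \<psi>(2))
  qed (use r(1) oW level in simp_all)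
qed

text \<open>On the positive real axis \<open>G2 g\<close> is continuous, is below \<open>L\<close> at \<open>R\<close>, and is at least \<open>L\<close> once the distance to all
  values of \<open>V\<close> exceeds \<open>exp L\<close>.\<close>

lemma outer_level_set_nonempty:
  assumes R: "V_bound g < R" and L: "G2 g (of_real R) < L"
  shows "outer_level_set g R L \<noteq> {}"
proof -
  \<comment> \<open>All values of \<open>V\<close> have distance at least \<open>exp L\<close> from this point.\<close>
  define X where "X = max R (V_bound g + exp L)"
  have VX: "V_bound g + exp L \<le> X" "R \<le> X" by (auto simp: X_def)
  have V0: "0 < V_bound g" by (rule V_bound_pos)
  have big: "L \<le> G2 g (of_real X)"
  proof -
    have VX': "V_bound g < cmod (of_real X)" using VX R V0 by simp
    note zE = not_in_E_set_outer[OF VX']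
    have "L = torus_mean (\<lambda>\<theta>. L)" by (simp only: torus_mean_const)
    also have "\<dots> \<le> torus_mean (\<lambda>\<theta>. ln (cmod (V_at g \<theta> - of_real X)))"
    proof (rule torus_mean_mono)
      show "continuous_on UNIV (\<lambda>\<theta>. ln (cmod (V_at g \<theta> - of_real X)))"
        unfolding V_torus by (rule continuous_on_torus_comp[OF continuous_on_log_V[OF zE]])
      fix \<theta>
      have "exp L \<le> cmod (of_real X - V_at g \<theta>)"
        using norm_triangle_ineq2[of "of_real X" "V_at g \<theta>"] cmod_V_le[of g "fst \<theta>" "snd \<theta>"] VX V0 R
        by (simp add: V_bound_def)
      then have "exp L \<le> cmod (V_at g \<theta> - of_real X)" by (simp add: norm_minus_commute)
      moreover from this have "0 < cmod (V_at g \<theta> - of_real X)"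
        using exp_gt_zero[of L] by linarith
      ultimately show "L \<le> ln (cmod (V_at g \<theta> - of_real X))" by (simp add: ln_ge_iff)
    qed auto
    also have "\<dots> = G2 g (of_real X)" using G2_eq_log_mean[OF zE] by (simp add: log_mean_def)
    finally show ?thesis .
  qed
  have cont: "continuous_on {R..X} (\<lambda>t. G2 g (complex_of_real t))"
  proof -
    have "continuous_on {R..X} (\<lambda>t. ln (cmod (complex_of_real t)) + Re (log_potential g (of_real t)))"
    proof -
      have "\<forall>t\<in>{R..X}. cmod (complex_of_real t) \<noteq> 0" using R V0 by auto
      moreover have "continuous_on {R..X} (\<lambda>t. log_potential g (complex_of_real t))"
        by (rule continuous_on_compose2[OF holomorphic_on_imp_continuous_on[OF log_potential_holomorphic]])
           (use R V0 in \<open>auto intro!: continuous_intros\<close>)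
      ultimately show ?thesis by (intro continuous_intros)
    qed
    moreover have "ln (cmod (complex_of_real t)) + Re (log_potential g (of_real t)) = G2 g (of_real t)" if "t \<in> {R..X}" for t
      using that R V0 by (intro G2_log_potential[symmetric]) auto
    ultimately show ?thesis by (rule continuous_on_eq)
  qed
  obtain t where t: "R \<le> t" "t \<le> X" "G2 g (of_real t) = L"
    using IVT'[OF _ big VX(2) cont] L by force
  have "t \<noteq> R" using t(3) L by auto
  then have "of_real t \<in> outer_level_set g R L"
    using t R V0 by (simp add: outer_level_set_def)
  then show ?thesis by blast
qed

text \<open>Points with \<open>\<bar>z\<bar> \<le> R\<close> are in the contracting case, whether or not they are values of \<open>V\<close>. Further out the
  cocycle is contracting, neutral or expanding according to the sign of \<open>G2 g z - ln \<bar>\<lambda>\<bar>\<close>, and only the neutral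
  case belongs to the spectrum.\<close>

theorem spectrum_strong_coupling:
  assumes \<alpha>: "rationally_independent \<alpha>\<^sub>1 \<alpha>\<^sub>2" and R: "V_bound g \<le> R"
    and lam: "exp (SUP z\<in>{z. cmod z \<le> R}. G2 g z) < cmod lam"
  shows "ell2_spectrum (H_op g \<alpha>\<^sub>1 \<alpha>\<^sub>2 lam \<omega>) = outer_level_set g R (ln (cmod lam))"
proof -
  have lam0: "lam \<noteq> 0" using lam exp_gt_zero by (metis less_asym norm_zero)
  have expL: "cmod lam = exp (ln (cmod lam))" using lam0 by simp
  then have SUP: "(SUP z\<in>{z. cmod z \<le> R}. G2 g z) < ln (cmod lam)"
    using lam by (metis exp_less_cancel_iff)
  have contract: "z \<notin> ell2_spectrum (H_op g \<alpha>\<^sub>1 \<alpha>\<^sub>2 lam \<omega>)" if "G2 g z < ln (cmod lam)" for z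
    using truncated_log_mean_less[OF that] resolvent_of_contracting[OF \<alpha> _ lam0] by blast
  show ?thesis
  proof (intro equalityI subsetI)
    fix z assume z: "z \<in> ell2_spectrum (H_op g \<alpha>\<^sub>1 \<alpha>\<^sub>2 lam \<omega>)"
    have ge: "ln (cmod lam) \<le> G2 g z" using contract z by force
    have zR: "R < cmod z"
    proof (rule ccontr)
      assume "\<not> R < cmod z"
      then have "G2 g z \<le> (SUP z\<in>{z. cmod z \<le> R}. G2 g z)"
        by (intro cSUP_upper G2_bounded_above) simp
      then show False using ge SUP by linarith
    qed
    then have zE: "z \<notin> E_set g" using R by (intro not_in_E_set_outer) simp
    have "\<not> ln (cmod lam) < G2 g z"
    proof
      assume "ln (cmod lam) < G2 g z"
      then have "cmod lam < exp (log_mean g z)"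
        by (subst expL) (simp add: G2_eq_log_mean[OF zE])
      then show False using resolvent_of_expanding[OF \<alpha> zE] z by blast
    qed
    then show "z \<in> outer_level_set g R (ln (cmod lam))" using zR ge by (simp add: outer_level_set_def)
  next
    fix z assume z: "z \<in> outer_level_set g R (ln (cmod lam))"
    then have zE: "z \<notin> E_set g" using R by (intro not_in_E_set_outer) (simp add: outer_level_set_def)
    have "cmod lam = exp (log_mean g z)"
      using z by (subst expL) (simp add: outer_level_set_def G2_eq_log_mean[OF zE])
    then show "z \<in> ell2_spectrum (H_op g \<alpha>\<^sub>1 \<alpha>\<^sub>2 lam \<omega>)" by (rule spectrum_of_neutral[OF \<alpha> zE])
  qed
qed

theorem spectrum_strong_coupling_curve:
  assumes \<alpha>: "rationally_independent \<alpha>\<^sub>1 \<alpha>\<^sub>2" and R: "V_bound g < R"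
    and lam: "exp (SUP z\<in>{z. cmod z \<le> R}. G2 g z) < cmod lam"
  shows "real_analytic_curve (ell2_spectrum (H_op g \<alpha>\<^sub>1 \<alpha>\<^sub>2 lam \<omega>))"
proof -
  have lam0: "0 < cmod lam" using lam exp_gt_zero by (meson less_trans)
  have "(SUP z\<in>{z. cmod z \<le> R}. G2 g z) < ln (cmod lam)"
    using lam lam0 by (metis exp_less_cancel_iff exp_ln)
  moreover have "G2 g (of_real R) \<le> (SUP z\<in>{z. cmod z \<le> R}. G2 g z)"
    using R V_bound_pos[of g] by (intro cSUP_upper G2_bounded_above) simp
  ultimately have "outer_level_set g R (ln (cmod lam)) \<noteq> {}"
    by (intro outer_level_set_nonempty R) linarith
  then show ?thesis
    unfolding spectrum_strong_coupling[OF \<alpha> less_imp_le[OF R] lam] real_analytic_curve_def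
    using outer_level_set_straightening[OF less_imp_le[OF R]] by blast
qed

theorem corollary1p5:
  fixes \<alpha>\<^sub>1 \<alpha>\<^sub>2 \<omega> g :: real and lam :: complex
  assumes "rationally_independent \<alpha>\<^sub>1 \<alpha>\<^sub>2" and "g > 0"
  shows "(cmod lam < exp g \<longrightarrow> ell2_spectrum (H_op g \<alpha>\<^sub>1 \<alpha>\<^sub>2 lam \<omega>) = E_set g) \<and>
    (cmod lam = exp g \<longrightarrow>
       ell2_spectrum (H_op g \<alpha>\<^sub>1 \<alpha>\<^sub>2 lam \<omega>) = closure (convex hull (E_set g))) \<and>
    (cmod lam > exp (SUP z\<in>{z. cmod z \<le> 2 * (exp g + exp (- g) + 2)}. G2 g z) \<longrightarrow>
       real_analytic_curve (ell2_spectrum (H_op g \<alpha>\<^sub>1 \<alpha>\<^sub>2 lam \<omega>)))"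
proof (intro conjI impI)
  show "ell2_spectrum (H_op g \<alpha>\<^sub>1 \<alpha>\<^sub>2 lam \<omega>) = E_set g" if "cmod lam < exp g"
    by (rule spectrum_small_coupling[OF assms(1) that])
  show "ell2_spectrum (H_op g \<alpha>\<^sub>1 \<alpha>\<^sub>2 lam \<omega>) = closure (convex hull (E_set g))" if "cmod lam = exp g"
    by (rule spectrum_critical_coupling[OF assms that])
  have "V_bound g < 2 * (exp g + exp (- g) + 2)"
    using V_bound_pos[of g] by (simp add: V_bound_def)
  then show "real_analytic_curve (ell2_spectrum (H_op g \<alpha>\<^sub>1 \<alpha>\<^sub>2 lam \<omega>))"
    if "cmod lam > exp (SUP z\<in>{z. cmod z \<le> 2 * (exp g + exp (- g) + 2)}. G2 g z)"
    using that by (rule spectrum_strong_coupling_curve[OF assms(1)])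
qed

end
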